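(* There is a spectrally enriched functor $\Phi\colon\mathbb{K}_\bullet(\mathrm{Perm})\to\mathcal{S}pec$ which sends a permutative category $\mathcal{A}\in\mathrm{Perm}$ to its $K$-theory spectrum $\mathbb{K}(\mathcal{A})$.
   Context: **Permutative categories and multilinear functors.** A permutative category is a symmetric monoidal category whose associativity and unit constraints are identities; product $\oplus$, unit $0$, symmetry $\gamma$. Permutative categories, functors and natural transformations are assumed topologically enriched. A strictly unital lax symmetric monoidal functor $(f,\delta)\colon\mathcal{A}\to\mathcal{B}$ is a functor $f$ with a natural transformation $\delta\colon f(a)\oplus f(a')\to f(a\oplus a')$ (the structure morphism) such that $f(0)=0$; $\delta=\mathrm{id}$ if $a$ or $a'$ is $0$; $\delta\circ(\mathrm{id}\oplus\delta)=\delta\circ(\delta\oplus\mathrm{id})$ as maps $f(a)\oplus f(a')\oplus f(a'')\to f(a\oplus a'\oplus a'')$; and $f(\gamma)\circ\delta=\delta\circ\gamma$. A multilinear functor $(f;\delta_1,\dots,\delta_k)\colon(\mathcal{A}_1,\dots,\mathcal{A}_k)\to\mathcal{B}$ is a functor $f\colon\mathcal{A}_1\times\cdots\times\mathcal{A}_k\to\mathcal{B}$ with natural transformations (linearity constraints) $\delta_i\colon f(\dots,a_i,\dots)\oplus f(\dots,a_i',\dots)\to f(\dots,a_i\oplus a_i',\dots)$ such that: $f(a_1,\dots,a_k)=0$ if some $a_j=0$ (and likewise $f$ of morphisms is $\mathrm{id}_0$ if one of them is $\mathrm{id}_0$); $\delta_i$ is the identity if $a_i$, $a_i'$ or some other $a_j$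 is $0$; each $\delta_i$ satisfies the associativity and symmetry conditions above in the $i$-th variable; and for $i\ne j$ the two maps $f(a_i,a_j)\oplus f(a_i',a_j)\oplus f(a_i,a_j')\oplus f(a_i',a_j')\to f(a_i\oplus a_i',a_j\oplus a_j')$ given by $\delta_j\circ(\delta_i\oplus\delta_i)$ and $\delta_i\circ(\delta_j\oplus\delta_j)\circ(\mathrm{id}\oplus\gamma\oplus\mathrm{id})$ agree. The (symmetric) multicategory $\underline{\mathrm{Perm}}$ has small permutative categories as objects and multilinear functors as $k$-morphisms; a $0$-morphism $()\to\mathcal{A}$ is an object of $\mathcal{A}$. The underlying functor of a composite $g\circ(f_1,\dots,f_n)$ is the evident one, and its constraint in the $i$-th variable of $f_j$ is $g(\delta_i^{f_j})\circ\delta_j^g$. A $\mathbf{PC}$-category is a category enriched in $\underline{\mathrm{Perm}}$ (hom permutative categories, bilinear strictly associative and unital composition). **The $\mathbf{PC}$-category $\mathrm{Perm}$.** Objects: small permutative categories. $\mathrm{Perm}(\mathcal{A},\mathcal{B})$: strictly unital lax symmetric monoidal functors and monoidal natural transformations, with pointwise sum $(f\oplus g)(a)=f(a)\oplus g(a)$ and structure morphism $(\delta^f\oplus\delta^g)\circ(1\oplus\gamma\oplus1)$. Composition is the usual one, with linearity constraints $\delta_1=\mathrm{id}$ and $\delta_2\colon(g\circ f)\oplus(g\circ f')\to g\circ(f\oplus f')$ the structure morphism of $g$. **$K$-theory.** $\mathcal{S}pec$ is a closed symmetric monoidal category of spectra (smash product $\wedge$, unit $S$, function spectra $F(-,-)$),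 viewed as a multicategory with $k$-morphisms the maps $E_1\wedge\cdots\wedge E_k\to E'$ and $0$-morphisms the maps $S\to E'$, and as a category enriched in itself. $\mathbb{K}\colon\underline{\mathrm{Perm}}\to\mathcal{S}pec$ is a fixed $K$-theory machine that is a multifunctor (so a multilinear functor $f\colon(\mathcal{A}_1,\dots,\mathcal{A}_k)\to\mathcal{B}$ induces $\mathbb{K}(f)\colon\mathbb{K}\mathcal{A}_1\wedge\cdots\wedge\mathbb{K}\mathcal{A}_k\to\mathbb{K}\mathcal{B}$, compatibly with composition and identities). $\mathbb{K}_\bullet(\mathrm{Perm})$ is the spectrally enriched category with the same objects as $\mathrm{Perm}$, morphism spectra $\mathbb{K}(\mathrm{Perm}(\mathcal{A},\mathcal{B}))$, composition $\mathbb{K}(\circ)$ and units $\mathbb{K}(\mathrm{id}_{\mathcal{A}})\colon S\to\mathbb{K}(\mathrm{Perm}(\mathcal{A},\mathcal{A}))$, where $\mathrm{id}_{\mathcal{A}}$ is viewed as a $0$-morphism. A spectrally enriched functor is a functor enriched in $\mathcal{S}pec$. *)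

theory Defs
  imports "HOL-Analysis.Function_Topology" "HOL-Analysis.Product_Topology"
begin

section \<open>Categories and functors\<close>

record ('o, 'm) cat =
  Ob  :: "'o set"
  Ar  :: "'m set"
  Dom :: "'m \<Rightarrow> 'o"
  Cod :: "'m \<Rightarrow> 'o"
  Id  :: "'o \<Rightarrow> 'm"
  Cmp :: "'m \<Rightarrow> 'm \<Rightarrow> 'm"  (infixr \<open>\<cdot>\<index>\<close> 55)

definition Hom :: "('o, 'm, 'z) cat_scheme \<Rightarrow> 'o \<Rightarrow> 'o \<Rightarrow> 'm set" where
  "Hom C x y = {f \<in> Ar C. Dom C f = x \<and> Cod C f = y}"

locale category =
  fixes C :: "('o, 'm, 'z) cat_scheme" (structure)
  assumes dom_in_Ob: "f \<in> Ar C \<Longrightarrow> Dom C f \<in> Ob C"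
    and cod_in_Ob: "f \<in> Ar C \<Longrightarrow> Cod C f \<in> Ob C"
    and Id_in_Hom: "x \<in> Ob C \<Longrightarrow> Id C x \<in> Hom C x x"
    and Cmp_in_Hom: "f \<in> Hom C x y \<Longrightarrow> g \<in> Hom C y z \<Longrightarrow> g \<cdot> f \<in> Hom C x z"
    and Id_left: "f \<in> Hom C x y \<Longrightarrow> Id C y \<cdot> f = f"
    and Id_right: "f \<in> Hom C x y \<Longrightarrow> f \<cdot> Id C x = f"
    and Cmp_assoc: "f \<in> Hom C w x \<Longrightarrow> g \<in> Hom C x y \<Longrightarrow> h \<in> Hom C y z \<Longrightarrow>
          h \<cdot> (g \<cdot> f) = (h \<cdot> g) \<cdot> f"

definition is_inverse :: "('o, 'm, 'z) cat_scheme \<Rightarrow> 'm \<Rightarrow> 'm \<Rightarrow> bool" where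
  "is_inverse C f g \<longleftrightarrow> g \<in> Hom C (Cod C f) (Dom C f) \<and>
     g \<cdot>\<^bsub>C\<^esub> f = Id C (Dom C f) \<and> f \<cdot>\<^bsub>C\<^esub> g = Id C (Cod C f)"

definition is_iso :: "('o, 'm, 'z) cat_scheme \<Rightarrow> 'm \<Rightarrow> bool" where
  "is_iso C f \<longleftrightarrow> f \<in> Ar C \<and> (\<exists>g. is_inverse C f g)"

definition inverse_of :: "('o, 'm, 'z) cat_scheme \<Rightarrow> 'm \<Rightarrow> 'm" where
  "inverse_of C f = (THE g. is_inverse C f g)"

locale cat_functor =
  fixes C :: "('o, 'm, 'z) cat_scheme" and D :: "('p, 'n, 'y) cat_scheme"
    and FO :: "'o \<Rightarrow> 'p" and FA :: "'m \<Rightarrow> 'n"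
  assumes functor_Ob: "x \<in> Ob C \<Longrightarrow> FO x \<in> Ob D"
    and functor_Hom: "x \<in> Ob C \<Longrightarrow> y \<in> Ob C \<Longrightarrow> f \<in> Hom C x y \<Longrightarrow> FA f \<in> Hom D (FO x) (FO y)"
    and functor_Id: "x \<in> Ob C \<Longrightarrow> FA (Id C x) = Id D (FO x)"
    and functor_Cmp: "f \<in> Hom C x y \<Longrightarrow> g \<in> Hom C y z \<Longrightarrow>
          FA (g \<cdot>\<^bsub>C\<^esub> f) = FA g \<cdot>\<^bsub>D\<^esub> FA f"

text \<open>The product of a list of categories; the product of the empty list is the terminal category
  with the single object \<^term>\<open>[]\<close>.\<close>

definition prod_cat :: "('o, 'm, 'z) cat_scheme list \<Rightarrow> ('o list, 'm list) cat" where
  "prod_cat Cs = \<lparr>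
     Ob = {xs. list_all2 (\<lambda>C x. x \<in> Ob C) Cs xs},
     Ar = {fs. list_all2 (\<lambda>C f. f \<in> Ar C) Cs fs},
     Dom = map2 Dom Cs,
     Cod = map2 Cod Cs,
     Id = map2 Id Cs,
     Cmp = (\<lambda>gs fs. map (\<lambda>i. gs ! i \<cdot>\<^bsub>Cs ! i\<^esub> fs ! i) [0..<length Cs]) \<rparr>"


section \<open>Symmetric monoidal categories\<close>

record ('o, 'm) moncat = "('o, 'm) cat" +
  Ten   :: "'o \<Rightarrow> 'o \<Rightarrow> 'o"  (infixr \<open>\<otimes>\<index>\<close> 70)
  TenA  :: "'m \<Rightarrow> 'm \<Rightarrow> 'm"  (infixr \<open>\<boxtimes>\<index>\<close> 70)
  Unit  :: "'o"
  Assoc :: "'o \<Rightarrow> 'o \<Rightarrow> 'o \<Rightarrow> 'm"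
  LUnit :: "'o \<Rightarrow> 'm"
  RUnit :: "'o \<Rightarrow> 'm"
  Sym   :: "'o \<Rightarrow> 'o \<Rightarrow> 'm"

locale symmetric_monoidal = category C
  for C :: "('o, 'm, 'z) moncat_scheme" (structure) +
  assumes Ten_Ob: "x \<in> Ob C \<Longrightarrow> y \<in> Ob C \<Longrightarrow> x \<otimes> y \<in> Ob C"
    and Unit_Ob: "Unit C \<in> Ob C"
    and TenA_Hom: "f \<in> Hom C x y \<Longrightarrow> f' \<in> Hom C x' y' \<Longrightarrow> f \<boxtimes> f' \<in> Hom C (x \<otimes> x') (y \<otimes> y')"
    and TenA_Id: "x \<in> Ob C \<Longrightarrow> y \<in> Ob C \<Longrightarrow> Id C x \<boxtimes> Id C y = Id C (x \<otimes> y)"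
    and TenA_Cmp: "f \<in> Hom C x y \<Longrightarrow> g \<in> Hom C y z \<Longrightarrow> f' \<in> Hom C x' y' \<Longrightarrow> g' \<in> Hom C y' z' \<Longrightarrow>
          (g \<cdot> f) \<boxtimes> (g' \<cdot> f') = (g \<boxtimes> g') \<cdot> (f \<boxtimes> f')"
    and Assoc_Hom: "x \<in> Ob C \<Longrightarrow> y \<in> Ob C \<Longrightarrow> z \<in> Ob C \<Longrightarrow>
          Assoc C x y z \<in> Hom C ((x \<otimes> y) \<otimes> z) (x \<otimes> (y \<otimes> z))"
    and Assoc_iso: "x \<in> Ob C \<Longrightarrow> y \<in> Ob C \<Longrightarrow> z \<in> Ob C \<Longrightarrow> is_iso C (Assoc C x y z)"
    and Assoc_natural: "f \<in> Hom C x x' \<Longrightarrow> g \<in> Hom C y y' \<Longrightarrow> h \<in> Hom C z z' \<Longrightarrow>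
          Assoc C x' y' z' \<cdot> ((f \<boxtimes> g) \<boxtimes> h) = (f \<boxtimes> (g \<boxtimes> h)) \<cdot> Assoc C x y z"
    and LUnit_Hom: "x \<in> Ob C \<Longrightarrow> LUnit C x \<in> Hom C (Unit C \<otimes> x) x"
    and LUnit_iso: "x \<in> Ob C \<Longrightarrow> is_iso C (LUnit C x)"
    and LUnit_natural: "f \<in> Hom C x y \<Longrightarrow> LUnit C y \<cdot> (Id C (Unit C) \<boxtimes> f) = f \<cdot> LUnit C x"
    and RUnit_Hom: "x \<in> Ob C \<Longrightarrow> RUnit C x \<in> Hom C (x \<otimes> Unit C) x"
    and RUnit_iso: "x \<in> Ob C \<Longrightarrow> is_iso C (RUnit C x)"
    and RUnit_natural: "f \<in> Hom C x y \<Longrightarrow> RUnit C y \<cdot> (f \<boxtimes> Id C (Unit C)) = f \<cdot> RUnit C x"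
    and pentagon: "w \<in> Ob C \<Longrightarrow> x \<in> Ob C \<Longrightarrow> y \<in> Ob C \<Longrightarrow> z \<in> Ob C \<Longrightarrow>
          (Id C w \<boxtimes> Assoc C x y z) \<cdot> Assoc C w (x \<otimes> y) z \<cdot> (Assoc C w x y \<boxtimes> Id C z)
            = Assoc C w x (y \<otimes> z) \<cdot> Assoc C (w \<otimes> x) y z"
    and triangle: "x \<in> Ob C \<Longrightarrow> y \<in> Ob C \<Longrightarrow>
          (Id C x \<boxtimes> LUnit C y) \<cdot> Assoc C x (Unit C) y = RUnit C x \<boxtimes> Id C y"
    and Sym_Hom: "x \<in> Ob C \<Longrightarrow> y \<in> Ob C \<Longrightarrow> Sym C x y \<in> Hom C (x \<otimes> y) (y \<otimes> x)"
    and Sym_natural: "f \<in> Hom C x x' \<Longrightarrow> g \<in> Hom C y y' \<Longrightarrow>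
          Sym C x' y' \<cdot> (f \<boxtimes> g) = (g \<boxtimes> f) \<cdot> Sym C x y"
    and Sym_Sym: "x \<in> Ob C \<Longrightarrow> y \<in> Ob C \<Longrightarrow> Sym C y x \<cdot> Sym C x y = Id C (x \<otimes> y)"
    and hexagon: "x \<in> Ob C \<Longrightarrow> y \<in> Ob C \<Longrightarrow> z \<in> Ob C \<Longrightarrow>
          Assoc C y z x \<cdot> Sym C x (y \<otimes> z) \<cdot> Assoc C x y z
            = (Id C y \<boxtimes> Sym C x z) \<cdot> Assoc C y x z \<cdot> (Sym C x y \<boxtimes> Id C z)"

record ('o, 'm) clmoncat = "('o, 'm) moncat" +
  IHom :: "'o \<Rightarrow> 'o \<Rightarrow> 'o"
  Ev   :: "'o \<Rightarrow> 'o \<Rightarrow> 'm"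

text \<open>\<^term>\<open>IHom C y z\<close> is the internal hom (function object) from \<open>y\<close> to \<open>z\<close>.\<close>

locale closed_symmetric_monoidal = symmetric_monoidal C
  for C :: "('o, 'm, 'z) clmoncat_scheme" (structure) +
  assumes IHom_Ob: "y \<in> Ob C \<Longrightarrow> z \<in> Ob C \<Longrightarrow> IHom C y z \<in> Ob C"
    and Ev_Hom: "y \<in> Ob C \<Longrightarrow> z \<in> Ob C \<Longrightarrow> Ev C y z \<in> Hom C (IHom C y z \<otimes> y) z"
    and Ev_universal: "x \<in> Ob C \<Longrightarrow> y \<in> Ob C \<Longrightarrow> z \<in> Ob C \<Longrightarrow> f \<in> Hom C (x \<otimes> y) z \<Longrightarrow>
          \<exists>!g. g \<in> Hom C x (IHom C y z) \<and> Ev C y z \<cdot> (g \<boxtimes> Id C y) = f"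

definition adjunct :: "('o, 'm, 'z) clmoncat_scheme \<Rightarrow> 'o \<Rightarrow> 'o \<Rightarrow> 'o \<Rightarrow> 'm \<Rightarrow> 'm" where
  "adjunct C x y z f =
     (THE g. g \<in> Hom C x (IHom C y z) \<and> Ev C y z \<cdot>\<^bsub>C\<^esub> (g \<boxtimes>\<^bsub>C\<^esub> Id C y) = f)"


section \<open>Enriched categories\<close>

text \<open>The data of an enriched category. The composition \<^term>\<open>EComp E x y z\<close> goes from the pair
  (\<^term>\<open>EHom E y z\<close>, \<^term>\<open>EHom E x y\<close>) to \<^term>\<open>EHom E x z\<close>. For enrichment in a monoidal category
  the type \<open>'m\<close> is that of its morphisms; for enrichment in a multicategory the compositions are
  \<open>2\<close>-morphisms and the units are \<open>0\<close>-morphisms.\<close>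

record ('e, 'o, 'm) enr =
  EOb   :: "'e set"
  EHom  :: "'e \<Rightarrow> 'e \<Rightarrow> 'o"
  EComp :: "'e \<Rightarrow> 'e \<Rightarrow> 'e \<Rightarrow> 'm"
  EId   :: "'e \<Rightarrow> 'm"

locale enriched_category = symmetric_monoidal V
  for V :: "('o, 'm, 'z) moncat_scheme" (structure) and E :: "('e, 'o, 'm) enr" +
  assumes EHom_Ob: "x \<in> EOb E \<Longrightarrow> y \<in> EOb E \<Longrightarrow> EHom E x y \<in> Ob V"
    and EComp_Hom: "x \<in> EOb E \<Longrightarrow> y \<in> EOb E \<Longrightarrow> z \<in> EOb E \<Longrightarrow>
          EComp E x y z \<in> Hom V (EHom E y z \<otimes> EHom E x y) (EHom E x z)"
    and EId_Hom: "x \<in> EOb E \<Longrightarrow> EId E x \<in> Hom V (Unit V) (EHom E x x)"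
    and EComp_assoc: "w \<in> EOb E \<Longrightarrow> x \<in> EOb E \<Longrightarrow> y \<in> EOb E \<Longrightarrow> z \<in> EOb E \<Longrightarrow>
          EComp E w x z \<cdot> (EComp E x y z \<boxtimes> Id V (EHom E w x))
            = EComp E w y z \<cdot> (Id V (EHom E y z) \<boxtimes> EComp E w x y)
                \<cdot> Assoc V (EHom E y z) (EHom E x y) (EHom E w x)"
    and EId_left: "x \<in> EOb E \<Longrightarrow> y \<in> EOb E \<Longrightarrow>
          EComp E x y y \<cdot> (EId E y \<boxtimes> Id V (EHom E x y)) = LUnit V (EHom E x y)"
    and EId_right: "x \<in> EOb E \<Longrightarrow> y \<in> EOb E \<Longrightarrow>
          EComp E x x y \<cdot> (Id V (EHom E x y) \<boxtimes> EId E x) = RUnit V (EHom E x y)"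

locale enriched_functor =
  source: enriched_category V E + target: enriched_category V E'
  for V :: "('o, 'm, 'z) moncat_scheme" (structure)
    and E :: "('e, 'o, 'm) enr" and E' :: "('f, 'o, 'm) enr"
    and FO :: "'e \<Rightarrow> 'f" and FM :: "'e \<Rightarrow> 'e \<Rightarrow> 'm" +
  assumes FO_EOb: "x \<in> EOb E \<Longrightarrow> FO x \<in> EOb E'"
    and FM_Hom: "x \<in> EOb E \<Longrightarrow> y \<in> EOb E \<Longrightarrow> FM x y \<in> Hom V (EHom E x y) (EHom E' (FO x) (FO y))"
    and FM_EComp: "x \<in> EOb E \<Longrightarrow> y \<in> EOb E \<Longrightarrow> z \<in> EOb E \<Longrightarrow>
          FM x z \<cdot> EComp E x y z = EComp E' (FO x) (FO y) (FO z) \<cdot> (FM y z \<boxtimes> FM x y)"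
    and FM_EId: "x \<in> EOb E \<Longrightarrow> FM x x \<cdot> EId E x = EId E' (FO x)"

definition self_enriched :: "('o, 'm, 'z) clmoncat_scheme \<Rightarrow> ('o, 'o, 'm) enr" where
  "self_enriched V = \<lparr>
     EOb = Ob V,
     EHom = IHom V,
     EComp = (\<lambda>x y z. adjunct V (IHom V y z \<otimes>\<^bsub>V\<^esub> IHom V x y) x z
        (Ev V y z \<cdot>\<^bsub>V\<^esub> (Id V (IHom V y z) \<boxtimes>\<^bsub>V\<^esub> Ev V x y)
           \<cdot>\<^bsub>V\<^esub> Assoc V (IHom V y z) (IHom V x y) x)),
     EId = (\<lambda>x. adjunct V (Unit V) x x (LUnit V x)) \<rparr>"


section \<open>Multicategories and multifunctors\<close>

text \<open>In \<^term>\<open>MCmp M Xss Ys Z g fs\<close> the \<open>j\<close>-th entry of \<open>fs\<close> goes from the \<open>j\<close>-th entry of \<open>Xss\<close> to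
  the \<open>j\<close>-th entry of \<open>Ys\<close>, and \<open>g\<close> goes from \<open>Ys\<close> to \<open>Z\<close>. The symmetric group actions are not
  recorded, and a multifunctor is not required to preserve them; a symmetric multifunctor is in
  particular a multifunctor in the sense below.\<close>

record ('o, 'm) multicat =
  MOb  :: "'o set"
  MHom :: "'o list \<Rightarrow> 'o \<Rightarrow> 'm set"
  MId  :: "'o \<Rightarrow> 'm"
  MCmp :: "'o list list \<Rightarrow> 'o list \<Rightarrow> 'o \<Rightarrow> 'm \<Rightarrow> 'm list \<Rightarrow> 'm"

locale multifunctor =
  fixes M :: "('o, 'm) multicat" and N :: "('p, 'n) multicat"
    and KO :: "'o \<Rightarrow> 'p" and KM :: "'o list \<Rightarrow> 'o \<Rightarrow> 'm \<Rightarrow> 'n"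
  assumes KO_MOb: "X \<in> MOb M \<Longrightarrow> KO X \<in> MOb N"
    and KM_MHom: "set Xs \<subseteq> MOb M \<Longrightarrow> Y \<in> MOb M \<Longrightarrow> f \<in> MHom M Xs Y \<Longrightarrow>
          KM Xs Y f \<in> MHom N (map KO Xs) (KO Y)"
    and KM_MId: "X \<in> MOb M \<Longrightarrow> KM [X] X (MId M X) = MId N (KO X)"
    and KM_MCmp: "length Xss = length Ys \<Longrightarrow> length fs = length Ys \<Longrightarrow>
          (\<And>Xs. Xs \<in> set Xss \<Longrightarrow> set Xs \<subseteq> MOb M) \<Longrightarrow> set Ys \<subseteq> MOb M \<Longrightarrow> Z \<in> MOb M \<Longrightarrow>
          (\<And>j. j < length Ys \<Longrightarrow> fs ! j \<in> MHom M (Xss ! j) (Ys ! j)) \<Longrightarrow> g \<in> MHom M Ys Z \<Longrightarrow>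
          KM (concat Xss) Z (MCmp M Xss Ys Z g fs)
            = MCmp N (map (map KO) Xss) (map KO Ys) (KO Z) (KM Ys Z g)
                (map (\<lambda>j. KM (Xss ! j) (Ys ! j) (fs ! j)) [0..<length Ys])"

text \<open>The multicategory underlying a symmetric monoidal category. Iterated products are bracketed
  to the right, \<open>x \<otimes> (y \<otimes> (\<dots> \<otimes> z))\<close>; a one-fold product is the object itself and the empty product
  is the unit.\<close>

fun ten_list :: "('o, 'm, 'z) moncat_scheme \<Rightarrow> 'o list \<Rightarrow> 'o" where
  "ten_list C [] = Unit C"
| "ten_list C [x] = x"
| "ten_list C (x # y # ys) = x \<otimes>\<^bsub>C\<^esub> ten_list C (y # ys)"

fun tenA_list :: "('o, 'm, 'z) moncat_scheme \<Rightarrow> 'm list \<Rightarrow> 'm" where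
  "tenA_list C [] = Id C (Unit C)"
| "tenA_list C [f] = f"
| "tenA_list C (f # g # gs) = f \<boxtimes>\<^bsub>C\<^esub> tenA_list C (g # gs)"

text \<open>\<open>ten_split C xs ys\<close> is the coherence isomorphism
  \<open>ten_list C (xs @ ys) \<rightarrow> ten_list C xs \<otimes> ten_list C ys\<close>.\<close>

fun ten_split :: "('o, 'm, 'z) moncat_scheme \<Rightarrow> 'o list \<Rightarrow> 'o list \<Rightarrow> 'm" where
  "ten_split C [] ys = inverse_of C (LUnit C (ten_list C ys))"
| "ten_split C [x] [] = inverse_of C (RUnit C x)"
| "ten_split C [x] (y # ys) = Id C (x \<otimes>\<^bsub>C\<^esub> ten_list C (y # ys))"
| "ten_split C (x # x' # xs) ys =
     inverse_of C (Assoc C x (ten_list C (x' # xs)) (ten_list C ys))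
       \<cdot>\<^bsub>C\<^esub> (Id C x \<boxtimes>\<^bsub>C\<^esub> ten_split C (x' # xs) ys)"

text \<open>\<open>ten_regroup C xss\<close> is the coherence isomorphism
  \<open>ten_list C (concat xss) \<rightarrow> ten_list C (map (ten_list C) xss)\<close>.\<close>

fun ten_regroup :: "('o, 'm, 'z) moncat_scheme \<Rightarrow> 'o list list \<Rightarrow> 'm" where
  "ten_regroup C [] = Id C (Unit C)"
| "ten_regroup C [xs] = Id C (ten_list C xs)"
| "ten_regroup C (xs # ys # yss) =
     (Id C (ten_list C xs) \<boxtimes>\<^bsub>C\<^esub> ten_regroup C (ys # yss))
       \<cdot>\<^bsub>C\<^esub> ten_split C xs (concat (ys # yss))"

definition underlying_multicat :: "('o, 'm, 'z) moncat_scheme \<Rightarrow> ('o, 'm) multicat" where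
  "underlying_multicat C = \<lparr>
     MOb = Ob C,
     MHom = (\<lambda>xs y. Hom C (ten_list C xs) y),
     MId = Id C,
     MCmp = (\<lambda>xss ys z g fs. g \<cdot>\<^bsub>C\<^esub> tenA_list C fs \<cdot>\<^bsub>C\<^esub> ten_regroup C xss) \<rparr>"


section \<open>Permutative categories and multilinear functors\<close>

text \<open>Hom spaces are topological spaces on the hom sets; objects form a discrete set.\<close>

record ('o, 'm) topmoncat = "('o, 'm) moncat" +
  HomT :: "'o \<Rightarrow> 'o \<Rightarrow> 'm topology"

text \<open>Via the typing and the naturality of the constraints, the last three conditions force the
  product to be strictly associative and unital on objects and on morphisms.\<close>

locale permutative_category = symmetric_monoidal A
  for A :: "('o, 'm) topmoncat" (structure) +
  assumes topspace_HomT: "x \<in> Ob A \<Longrightarrow> y \<in> Ob A \<Longrightarrow> topspace (HomT A x y) = Hom A x y"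
    and continuous_Cmp: "x \<in> Ob A \<Longrightarrow> y \<in> Ob A \<Longrightarrow> z \<in> Ob A \<Longrightarrow>
          continuous_map (prod_topology (HomT A y z) (HomT A x y)) (HomT A x z) (\<lambda>(g, f). g \<cdot> f)"
    and continuous_TenA: "x \<in> Ob A \<Longrightarrow> y \<in> Ob A \<Longrightarrow> x' \<in> Ob A \<Longrightarrow> y' \<in> Ob A \<Longrightarrow>
          continuous_map (prod_topology (HomT A x y) (HomT A x' y'))
            (HomT A (x \<otimes> x') (y \<otimes> y')) (\<lambda>(f, f'). f \<boxtimes> f')"
    and Assoc_is_Id: "x \<in> Ob A \<Longrightarrow> y \<in> Ob A \<Longrightarrow> z \<in> Ob A \<Longrightarrow>
          Assoc A x y z = Id A (x \<otimes> (y \<otimes> z))"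
    and LUnit_is_Id: "x \<in> Ob A \<Longrightarrow> LUnit A x = Id A x"
    and RUnit_is_Id: "x \<in> Ob A \<Longrightarrow> RUnit A x = Id A x"

text \<open>Strictly unital lax symmetric monoidal functors.\<close>

record ('o, 'm) laxfun =
  FunO :: "'o \<Rightarrow> 'o"
  FunA :: "'m \<Rightarrow> 'm"
  FunD :: "'o \<Rightarrow> 'o \<Rightarrow> 'm"

locale lax_functor =
  cat_functor A B "FunO f" "FunA f"
  for A B :: "('o, 'm) topmoncat" and f :: "('o, 'm) laxfun" +
  assumes FunA_continuous: "a \<in> Ob A \<Longrightarrow> a' \<in> Ob A \<Longrightarrow>
          continuous_map (HomT A a a') (HomT B (FunO f a) (FunO f a')) (FunA f)"
    and FunO_Unit: "FunO f (Unit A) = Unit B"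
    and FunD_Hom: "a \<in> Ob A \<Longrightarrow> a' \<in> Ob A \<Longrightarrow>
          FunD f a a' \<in> Hom B (FunO f a \<otimes>\<^bsub>B\<^esub> FunO f a') (FunO f (a \<otimes>\<^bsub>A\<^esub> a'))"
    and FunD_natural: "\<phi> \<in> Hom A a b \<Longrightarrow> \<phi>' \<in> Hom A a' b' \<Longrightarrow>
          FunA f (\<phi> \<boxtimes>\<^bsub>A\<^esub> \<phi>') \<cdot>\<^bsub>B\<^esub> FunD f a a' = FunD f b b' \<cdot>\<^bsub>B\<^esub> (FunA f \<phi> \<boxtimes>\<^bsub>B\<^esub> FunA f \<phi>')"
    and FunD_Unit: "a \<in> Ob A \<Longrightarrow> a' \<in> Ob A \<Longrightarrow> a = Unit A \<or> a' = Unit A \<Longrightarrow>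
          FunD f a a' = Id B (FunO f (a \<otimes>\<^bsub>A\<^esub> a'))"
    and FunD_assoc: "a \<in> Ob A \<Longrightarrow> a' \<in> Ob A \<Longrightarrow> a'' \<in> Ob A \<Longrightarrow>
          FunD f a (a' \<otimes>\<^bsub>A\<^esub> a'') \<cdot>\<^bsub>B\<^esub> (Id B (FunO f a) \<boxtimes>\<^bsub>B\<^esub> FunD f a' a'')
            = FunD f (a \<otimes>\<^bsub>A\<^esub> a') a'' \<cdot>\<^bsub>B\<^esub> (FunD f a a' \<boxtimes>\<^bsub>B\<^esub> Id B (FunO f a''))"
    and FunD_Sym: "a \<in> Ob A \<Longrightarrow> a' \<in> Ob A \<Longrightarrow>
          FunA f (Sym A a a') \<cdot>\<^bsub>B\<^esub> FunD f a a' = FunD f a' a \<cdot>\<^bsub>B\<^esub> Sym B (FunO f a) (FunO f a')"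

text \<open>Pointwise sum, zero, identity and composition of strictly unital lax symmetric monoidal functors.\<close>

definition fun_sum :: "('o, 'm) topmoncat \<Rightarrow> ('o, 'm) laxfun \<Rightarrow> ('o, 'm) laxfun \<Rightarrow> ('o, 'm) laxfun" where
  "fun_sum B f g = \<lparr>
     FunO = (\<lambda>a. FunO f a \<otimes>\<^bsub>B\<^esub> FunO g a),
     FunA = (\<lambda>\<phi>. FunA f \<phi> \<boxtimes>\<^bsub>B\<^esub> FunA g \<phi>),
     FunD = (\<lambda>a a'. (FunD f a a' \<boxtimes>\<^bsub>B\<^esub> FunD g a a')
       \<cdot>\<^bsub>B\<^esub> (Id B (FunO f a) \<boxtimes>\<^bsub>B\<^esub> Sym B (FunO g a) (FunO f a') \<boxtimes>\<^bsub>B\<^esub> Id B (FunO g a'))) \<rparr>"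

definition fun_zero :: "('o, 'm) topmoncat \<Rightarrow> ('o, 'm) laxfun" where
  "fun_zero B = \<lparr>
     FunO = (\<lambda>_. Unit B),
     FunA = (\<lambda>_. Id B (Unit B)),
     FunD = (\<lambda>_ _. Id B (Unit B)) \<rparr>"

definition fun_id :: "('o, 'm) topmoncat \<Rightarrow> ('o, 'm) laxfun" where
  "fun_id A = \<lparr>
     FunO = (\<lambda>a. a),
     FunA = (\<lambda>\<phi>. \<phi>),
     FunD = (\<lambda>a a'. Id A (a \<otimes>\<^bsub>A\<^esub> a')) \<rparr>"

definition fun_comp :: "('o, 'm) topmoncat \<Rightarrow> ('o, 'm) laxfun \<Rightarrow> ('o, 'm) laxfun \<Rightarrow> ('o, 'm) laxfun" where
  "fun_comp C g f = \<lparr>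
     FunO = (\<lambda>a. FunO g (FunO f a)),
     FunA = (\<lambda>\<phi>. FunA g (FunA f \<phi>)),
     FunD = (\<lambda>a a'. FunA g (FunD f a a') \<cdot>\<^bsub>C\<^esub> FunD g (FunO f a) (FunO f a')) \<rparr>"

locale monoidal_nat =
  fixes A B :: "('o, 'm) topmoncat" and f g :: "('o, 'm) laxfun" and \<tau> :: "'o \<Rightarrow> 'm"
  assumes nat_Hom: "a \<in> Ob A \<Longrightarrow> \<tau> a \<in> Hom B (FunO f a) (FunO g a)"
    and nat_natural: "\<phi> \<in> Hom A a a' \<Longrightarrow> FunA g \<phi> \<cdot>\<^bsub>B\<^esub> \<tau> a = \<tau> a' \<cdot>\<^bsub>B\<^esub> FunA f \<phi>"
    and nat_Unit: "\<tau> (Unit A) = Id B (Unit B)"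
    and nat_FunD: "a \<in> Ob A \<Longrightarrow> a' \<in> Ob A \<Longrightarrow>
          \<tau> (a \<otimes>\<^bsub>A\<^esub> a') \<cdot>\<^bsub>B\<^esub> FunD f a a' = FunD g a a' \<cdot>\<^bsub>B\<^esub> (\<tau> a \<boxtimes>\<^bsub>B\<^esub> \<tau> a')"

text \<open>In a multilinear functor of \<open>k\<close> variables the variables are numbered \<open>0, \<dots>, k - 1\<close>, and
  \<^term>\<open>MulD f i xs x'\<close> is the constraint
  \<open>f(\<dots>, xs ! i, \<dots>) \<oplus> f(\<dots>, x', \<dots>) \<rightarrow> f(\<dots>, xs ! i \<oplus> x', \<dots>)\<close>. All three components are
  \<open>undefined\<close> outside their domains, so that equality of multilinear functors is equality in HOL.\<close>

record ('o, 'm) mulfun =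
  MulO :: "'o list \<Rightarrow> 'o"
  MulA :: "'m list \<Rightarrow> 'm"
  MulD :: "nat \<Rightarrow> 'o list \<Rightarrow> 'o \<Rightarrow> 'm"

locale multilinear =
  cat_functor "prod_cat As" B "MulO f" "MulA f"
  for As :: "('o, 'm) topmoncat list" and B :: "('o, 'm) topmoncat" (structure)
    and f :: "('o, 'm) mulfun" +
  assumes MulO_extensional: "MulO f \<in> extensional (Ob (prod_cat As))"
    and MulA_extensional: "MulA f \<in> extensional (Ar (prod_cat As))"
    and MulD_extensional:
          "\<not> (i < length As \<and> xs \<in> Ob (prod_cat As) \<and> x' \<in> Ob (As ! i)) \<Longrightarrow> MulD f i xs x' = undefined"
    and MulA_continuous: "xs \<in> Ob (prod_cat As) \<Longrightarrow> ys \<in> Ob (prod_cat As) \<Longrightarrow>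
          continuous_map (product_topology (\<lambda>i. HomT (As ! i) (xs ! i) (ys ! i)) {..<length As})
            (HomT B (MulO f xs) (MulO f ys)) (\<lambda>\<phi>. MulA f (map \<phi> [0..<length As]))"
    and MulO_Unit: "xs \<in> Ob (prod_cat As) \<Longrightarrow> i < length As \<Longrightarrow> xs ! i = Unit (As ! i) \<Longrightarrow>
          MulO f xs = Unit B"
    and MulA_Unit: "\<phi>s \<in> Ar (prod_cat As) \<Longrightarrow> i < length As \<Longrightarrow>
          \<phi>s ! i = Id (As ! i) (Unit (As ! i)) \<Longrightarrow> MulA f \<phi>s = Id B (Unit B)"
    and MulD_Hom: "i < length As \<Longrightarrow> xs \<in> Ob (prod_cat As) \<Longrightarrow> x' \<in> Ob (As ! i) \<Longrightarrow>
          MulD f i xs x' \<in>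
            Hom B (MulO f xs \<otimes> MulO f (xs[i := x'])) (MulO f (xs[i := xs ! i \<otimes>\<^bsub>As ! i\<^esub> x']))"
    and MulD_natural: "i < length As \<Longrightarrow> \<phi>s \<in> Hom (prod_cat As) xs ys \<Longrightarrow>
          \<phi>' \<in> Hom (As ! i) x' y' \<Longrightarrow>
          MulA f (\<phi>s[i := \<phi>s ! i \<boxtimes>\<^bsub>As ! i\<^esub> \<phi>']) \<cdot> MulD f i xs x'
            = MulD f i ys y' \<cdot> (MulA f \<phi>s \<boxtimes> MulA f (\<phi>s[i := \<phi>']))"
    and MulD_Unit: "i < length As \<Longrightarrow> xs \<in> Ob (prod_cat As) \<Longrightarrow> x' \<in> Ob (As ! i) \<Longrightarrow>
          x' = Unit (As ! i) \<or> (\<exists>j < length As. xs ! j = Unit (As ! j)) \<Longrightarrow>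
          MulD f i xs x' = Id B (MulO f (xs[i := xs ! i \<otimes>\<^bsub>As ! i\<^esub> x']))"
    and MulD_assoc: "i < length As \<Longrightarrow> xs \<in> Ob (prod_cat As) \<Longrightarrow>
          x' \<in> Ob (As ! i) \<Longrightarrow> x'' \<in> Ob (As ! i) \<Longrightarrow>
          MulD f i xs (x' \<otimes>\<^bsub>As ! i\<^esub> x'') \<cdot> (Id B (MulO f xs) \<boxtimes> MulD f i (xs[i := x']) x'')
            = MulD f i (xs[i := xs ! i \<otimes>\<^bsub>As ! i\<^esub> x']) x''
                \<cdot> (MulD f i xs x' \<boxtimes> Id B (MulO f (xs[i := x''])))"
    and MulD_Sym: "i < length As \<Longrightarrow> xs \<in> Ob (prod_cat As) \<Longrightarrow> x' \<in> Ob (As ! i) \<Longrightarrow>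
          MulA f ((Id (prod_cat As) xs)[i := Sym (As ! i) (xs ! i) x']) \<cdot> MulD f i xs x'
            = MulD f i (xs[i := x']) (xs ! i) \<cdot> Sym B (MulO f xs) (MulO f (xs[i := x']))"
    and MulD_MulD: "i < length As \<Longrightarrow> j < length As \<Longrightarrow> i \<noteq> j \<Longrightarrow> xs \<in> Ob (prod_cat As) \<Longrightarrow>
          x' \<in> Ob (As ! i) \<Longrightarrow> y' \<in> Ob (As ! j) \<Longrightarrow>
          MulD f j (xs[i := xs ! i \<otimes>\<^bsub>As ! i\<^esub> x']) y'
              \<cdot> (MulD f i xs x' \<boxtimes> MulD f i (xs[j := y']) x')
            = MulD f i (xs[j := xs ! j \<otimes>\<^bsub>As ! j\<^esub> y']) x'
              \<cdot> (MulD f j xs y' \<boxtimes> MulD f j (xs[i := x']) y')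
              \<cdot> (Id B (MulO f xs) \<boxtimes> Sym B (MulO f (xs[i := x'])) (MulO f (xs[j := y']))
                   \<boxtimes> Id B (MulO f (xs[i := x', j := y'])))"

definition mul_id :: "('o, 'm) topmoncat \<Rightarrow> ('o, 'm) mulfun" where
  "mul_id A = \<lparr>
     MulO = restrict hd (Ob (prod_cat [A])),
     MulA = restrict hd (Ar (prod_cat [A])),
     MulD = (\<lambda>i xs x'. if i = 0 \<and> xs \<in> Ob (prod_cat [A]) \<and> x' \<in> Ob A
       then Id A (hd xs \<otimes>\<^bsub>A\<^esub> x') else undefined) \<rparr>"

text \<open>An object viewed as a \<open>0\<close>-morphism.\<close>

definition mul_ob :: "('o, 'm) topmoncat \<Rightarrow> 'o \<Rightarrow> ('o, 'm) mulfun" where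
  "mul_ob A a = \<lparr>
     MulO = restrict (\<lambda>_. a) {[]},
     MulA = restrict (\<lambda>_. Id A a) {[]},
     MulD = (\<lambda>_ _ _. undefined) \<rparr>"

fun blocks :: "nat list \<Rightarrow> 'a list \<Rightarrow> 'a list list" where
  "blocks [] xs = []"
| "blocks (k # ks) xs = take k xs # blocks ks (drop k xs)"

text \<open>\<open>block_pos ks p = (j, i)\<close> if position \<open>p\<close> of a concatenation of blocks of lengths \<open>ks\<close> is
  position \<open>i\<close> of block \<open>j\<close>.\<close>

fun block_pos :: "nat list \<Rightarrow> nat \<Rightarrow> nat \<times> nat" where
  "block_pos [] p = undefined"
| "block_pos (k # ks) p = (if p < k then (0, p) else apfst Suc (block_pos ks (p - k)))"

definition mul_comp :: "('o, 'm) topmoncat list list \<Rightarrow> ('o, 'm) topmoncat list \<Rightarrow>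
    ('o, 'm) topmoncat \<Rightarrow> ('o, 'm) mulfun \<Rightarrow> ('o, 'm) mulfun list \<Rightarrow> ('o, 'm) mulfun" where
  "mul_comp Ass Bs C g fs = \<lparr>
     MulO = restrict (\<lambda>xs. MulO g (map2 MulO fs (blocks (map length Ass) xs)))
       (Ob (prod_cat (concat Ass))),
     MulA = restrict (\<lambda>\<phi>s. MulA g (map2 MulA fs (blocks (map length Ass) \<phi>s)))
       (Ar (prod_cat (concat Ass))),
     MulD = (\<lambda>p xs x'.
       if p < length (concat Ass) \<and> xs \<in> Ob (prod_cat (concat Ass)) \<and> x' \<in> Ob (concat Ass ! p)
       then (let (j, i) = block_pos (map length Ass) p;
                 xss = blocks (map length Ass) xs;
                 bs = map2 MulO fs xss
             in MulA g ((Id (prod_cat Bs) bs)[j := MulD (fs ! j) i (xss ! j) x'])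
                  \<cdot>\<^bsub>C\<^esub> MulD g j bs (MulO (fs ! j) ((xss ! j)[i := x'])))
       else undefined) \<rparr>"


section \<open>Universes\<close>

text \<open>A Grothendieck universe: the elements of the type \<open>'u\<close> are the sets in the universe and
  \<open>elts x\<close> is the extension of \<open>x\<close>, so that the small collections are those in the range of \<open>elts\<close>.
  An infinite member is not demanded; it would only exclude the universe of hereditarily finite sets.\<close>

locale universe =
  fixes elts :: "'u \<Rightarrow> 'u set"
  assumes elts_inj: "inj elts"
    and elts_subset: "X \<subseteq> elts x \<Longrightarrow> \<exists>y. elts y = X"
    and elts_pair: "\<exists>z. elts z = {x, y}"
    and elts_Pow: "\<exists>p. elts p = {y. elts y \<subseteq> elts x}"
    and elts_Union: "\<exists>u. elts u = (\<Union>i \<in> elts x. elts (t i))"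
begin

definition small :: "'u set \<Rightarrow> bool" where
  "small X \<longleftrightarrow> X \<in> range elts"

definition set_code :: "'u set \<Rightarrow> 'u" where
  "set_code X = (THE x. elts x = X)"

definition pair :: "'u \<Rightarrow> 'u \<Rightarrow> 'u" where
  "pair x y = set_code {set_code {x}, set_code {x, y}}"

definition proj1 :: "'u \<Rightarrow> 'u" where
  "proj1 p = (THE x. \<exists>y. p = pair x y)"

definition proj2 :: "'u \<Rightarrow> 'u" where
  "proj2 p = (THE y. \<exists>x. p = pair x y)"

definition graph :: "'u set \<Rightarrow> ('u \<Rightarrow> 'u) \<Rightarrow> 'u" where
  "graph X f = set_code ((\<lambda>x. pair x (f x)) ` X)"

definition app :: "'u \<Rightarrow> 'u \<Rightarrow> 'u" where
  "app f x = (THE y. pair x y \<in> elts f)"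

end


section \<open>The multicategory of small permutative categories\<close>

type_synonym 'u permcat = "('u, 'u) topmoncat"

context universe
begin

text \<open>The fields of a record are unconstrained outside the carriers, so one permutative category may be
  represented by several (isomorphic) objects of the multicategory.\<close>

definition small_permcat :: "'u permcat \<Rightarrow> bool" where
  "small_permcat A \<longleftrightarrow> permutative_category A \<and> small (Ob A) \<and> small (Ar A)"

definition perm_multicat :: "('u permcat, ('u, 'u) mulfun) multicat" where
  "perm_multicat = \<lparr>
     MOb = Collect small_permcat,
     MHom = (\<lambda>As B. Collect (multilinear As B)),
     MId = mul_id,
     MCmp = mul_comp \<rparr>"


section \<open>The category Perm enriched in small permutative categories\<close>

text \<open>The objects and morphisms of \<open>Perm(A, B)\<close> are coded as elements of the universe:
  a functor by its three graphs, a natural transformation by its domain, codomain and graph.\<close>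

definition fun_code :: "'u permcat \<Rightarrow> ('u, 'u) laxfun \<Rightarrow> 'u" where
  "fun_code A f = pair (graph (Ob A) (FunO f)) (pair (graph (Ar A) (FunA f))
     (graph (Ob A) (\<lambda>a. graph (Ob A) (FunD f a))))"

definition fun_of :: "'u \<Rightarrow> ('u, 'u) laxfun" where
  "fun_of u = \<lparr>
     FunO = app (proj1 u),
     FunA = app (proj1 (proj2 u)),
     FunD = (\<lambda>a. app (app (proj2 (proj2 u)) a)) \<rparr>"

definition nat_code :: "'u permcat \<Rightarrow> 'u \<Rightarrow> 'u \<Rightarrow> ('u \<Rightarrow> 'u) \<Rightarrow> 'u" where
  "nat_code A u v \<tau> = pair u (pair v (graph (Ob A) \<tau>))"

definition nat_dom :: "'u \<Rightarrow> 'u" where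
  "nat_dom m = proj1 m"

definition nat_cod :: "'u \<Rightarrow> 'u" where
  "nat_cod m = proj1 (proj2 m)"

definition nat_of :: "'u \<Rightarrow> 'u \<Rightarrow> 'u" where
  "nat_of m = app (proj2 (proj2 m))"

definition perm_sum :: "'u permcat \<Rightarrow> 'u permcat \<Rightarrow> 'u \<Rightarrow> 'u \<Rightarrow> 'u" where
  "perm_sum A B u v = fun_code A (fun_sum B (fun_of u) (fun_of v))"

definition perm_id :: "'u permcat \<Rightarrow> 'u permcat \<Rightarrow> 'u \<Rightarrow> 'u" where
  "perm_id A B u = nat_code A u u (\<lambda>a. Id B (FunO (fun_of u) a))"

text \<open>Hom spaces carry the subspace topology of the product of the hom spaces of \<open>B\<close> over all
  objects of \<open>A\<close>.\<close>

definition perm_hom :: "'u permcat \<Rightarrow> 'u permcat \<Rightarrow> 'u permcat" where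
  "perm_hom A B = (let
     obs = {fun_code A f | f. lax_functor A B f};
     ars = {nat_code A u v \<tau> | u v \<tau>. u \<in> obs \<and> v \<in> obs \<and> monoidal_nat A B (fun_of u) (fun_of v) \<tau>}
   in \<lparr>
     Ob = obs,
     Ar = ars,
     Dom = nat_dom,
     Cod = nat_cod,
     Id = perm_id A B,
     Cmp = (\<lambda>n m. nat_code A (nat_dom m) (nat_cod n) (\<lambda>a. nat_of n a \<cdot>\<^bsub>B\<^esub> nat_of m a)),
     Ten = perm_sum A B,
     TenA = (\<lambda>m n. nat_code A (perm_sum A B (nat_dom m) (nat_dom n))
       (perm_sum A B (nat_cod m) (nat_cod n)) (\<lambda>a. nat_of m a \<boxtimes>\<^bsub>B\<^esub> nat_of n a)),
     Unit = fun_code A (fun_zero B),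
     Assoc = (\<lambda>u v w. perm_id A B (perm_sum A B u (perm_sum A B v w))),
     LUnit = perm_id A B,
     RUnit = perm_id A B,
     Sym = (\<lambda>u v. nat_code A (perm_sum A B u v) (perm_sum A B v u)
       (\<lambda>a. Sym B (FunO (fun_of u) a) (FunO (fun_of v) a))),
     HomT = (\<lambda>u v. pullback_topology {m \<in> ars. nat_dom m = u \<and> nat_cod m = v}
       (\<lambda>m. restrict (nat_of m) (Ob A))
       (product_topology (\<lambda>a. HomT B (FunO (fun_of u) a) (FunO (fun_of v) a)) (Ob A))) \<rparr>)"

text \<open>The composition \<open>Perm(B, C) \<times> Perm(A, B) \<rightarrow> Perm(A, C)\<close>.\<close>

definition perm_comp :: "'u permcat \<Rightarrow> 'u permcat \<Rightarrow> 'u permcat \<Rightarrow> ('u, 'u) mulfun" where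
  "perm_comp A B C = (let
     PP = prod_cat [perm_hom B C, perm_hom A B];
     comp = (\<lambda>u v. fun_code A (fun_comp C (fun_of u) (fun_of v)))
   in \<lparr>
     MulO = restrict (\<lambda>us. comp (us ! 0) (us ! 1)) (Ob PP),
     MulA = restrict (\<lambda>ms. nat_code A
         (comp (nat_dom (ms ! 0)) (nat_dom (ms ! 1)))
         (comp (nat_cod (ms ! 0)) (nat_cod (ms ! 1)))
         (\<lambda>a. nat_of (ms ! 0) (FunO (fun_of (nat_cod (ms ! 1))) a)
                \<cdot>\<^bsub>C\<^esub> FunA (fun_of (nat_dom (ms ! 0))) (nat_of (ms ! 1) a))) (Ar PP),
     MulD = (\<lambda>i us u'.
       if i = 0 \<and> us \<in> Ob PP \<and> u' \<in> Ob (perm_hom B C)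
       then perm_id A C (comp (perm_sum B C (us ! 0) u') (us ! 1))
       else if i = 1 \<and> us \<in> Ob PP \<and> u' \<in> Ob (perm_hom A B)
       then nat_code A
         (perm_sum A C (comp (us ! 0) (us ! 1)) (comp (us ! 0) u'))
         (comp (us ! 0) (perm_sum A B (us ! 1) u'))
         (\<lambda>a. FunD (fun_of (us ! 0)) (FunO (fun_of (us ! 1)) a) (FunO (fun_of u') a))
       else undefined) \<rparr>)"

definition perm_enr :: "('u permcat, 'u permcat, ('u, 'u) mulfun) enr" where
  "perm_enr = \<lparr>
     EOb = Collect small_permcat,
     EHom = perm_hom,
     EComp = perm_comp,
     EId = (\<lambda>A. mul_ob (perm_hom A A) (fun_code A (fun_id A))) \<rparr>"

end


section \<open>Change of enrichment along a multifunctor\<close>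

text \<open>\<open>K\<^sub>\<bullet>(E)\<close> for a multifunctor \<open>K = (KO, KM)\<close> and a category \<open>E\<close> enriched in its domain.\<close>

definition change_enr :: "('o \<Rightarrow> 'p) \<Rightarrow> ('o list \<Rightarrow> 'o \<Rightarrow> 'm \<Rightarrow> 'n) \<Rightarrow>
    ('e, 'o, 'm) enr \<Rightarrow> ('e, 'p, 'n) enr" where
  "change_enr KO KM E = \<lparr>
     EOb = EOb E,
     EHom = (\<lambda>x y. KO (EHom E x y)),
     EComp = (\<lambda>x y z. KM [EHom E y z, EHom E x y] (EHom E x z) (EComp E x y z)),
     EId = (\<lambda>x. KM [] (EHom E x x) (EId E x)) \<rparr>"

end

theory Submission
  imports Defs
begin

text \<open>Evaluation \<open>Perm(A, B) \<times> A \<rightarrow> B\<close> is a bilinear functor, strict in the first variable and with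
  the structure morphism of a functor as its constraint in the second. It is compatible with the
  composition and the identities of \<open>Perm\<close>, as an equation between composites in the multicategory.
  Applying the multifunctor yields maps \<open>K(Perm(A, B)) \<and> K(A) \<rightarrow> K(B)\<close> with the same compatibility,
  and their adjoints \<open>K(Perm(A, B)) \<rightarrow> F(K(A), K(B))\<close> form the required enriched functor.
  Composition \<open>Perm(B, C) \<times> Perm(A, B) \<rightarrow> Perm(A, C)\<close> is evaluation applied pointwise, so its
  bilinearity and associativity reduce to statements about evaluation.\<close>

text \<open>Two obstacles shape the development. Spectra are associative and unital only up to
  coherent isomorphism, while the laws among multilinear functors are strict: each such law becomes
  an equation of maps of spectra that contains the inverse of an associator or unitor, which has to
  be moved across. One unit law of the self-enrichment even needs a coherence law that is not among
  the axioms. Moreover, Perm(A, B) must again be a permutative category over the type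
  \<open>'u\<close>. Functors and transformations are therefore coded by their graphs, and
  extensionality of the codes turns agreement on the carriers into equality. The compatibility of
  the two constraints of evaluation is built into the pointwise sum: the structure morphism of f + g
  contains the interchange of the middle two of four summands, which is the symmetry in the axiom
  for bilinear functors. In return, the structure morphism of g can be a constraint of composition
  only if it is itself a monoidal transformation gf + gf' -> g(f + f'), and this uses the symmetry
  condition on g.\<close>

section \<open>Monoidal categories\<close>

context category
begin

lemma Hom_iff: "f \<in> Hom C x y \<longleftrightarrow> f \<in> Ar C \<and> Dom C f = x \<and> Cod C f = y"
  by (auto simp: Hom_def)

lemma Dom_Ob [simp]: "f \<in> Ar C \<Longrightarrow> Dom C f \<in> Ob C"
  by (rule dom_in_Ob)

lemma Cod_Ob [simp]: "f \<in> Ar C \<Longrightarrow> Cod C f \<in> Ob C"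
  by (rule cod_in_Ob)

lemma Id_simps [simp]:
  assumes "x \<in> Ob C"
  shows "Id C x \<in> Ar C" "Dom C (Id C x) = x" "Cod C (Id C x) = x"
  using Id_in_Hom[OF assms] by (auto simp: Hom_iff)

lemma Cmp_simps [simp]:
  assumes "f \<in> Ar C" "g \<in> Ar C" "Cod C f = Dom C g"
  shows "g \<cdot> f \<in> Ar C" "Dom C (g \<cdot> f) = Dom C f" "Cod C (g \<cdot> f) = Cod C g"
  using Cmp_in_Hom[of f "Dom C f" "Dom C g" g "Cod C g"] assms by (auto simp: Hom_iff)

lemma Id_Cmp [simp]: "f \<in> Ar C \<Longrightarrow> Cod C f = y \<Longrightarrow> Id C y \<cdot> f = f"
  by (rule Id_left[of f "Dom C f"]) (simp add: Hom_iff)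

lemma Cmp_Id [simp]: "f \<in> Ar C \<Longrightarrow> Dom C f = x \<Longrightarrow> f \<cdot> Id C x = f"
  by (rule Id_right[of f _ "Cod C f"]) (simp add: Hom_iff)

lemma Cmp_Cmp:
  "f \<in> Ar C \<Longrightarrow> g \<in> Ar C \<Longrightarrow> h \<in> Ar C \<Longrightarrow> Cod C f = Dom C g \<Longrightarrow> Cod C g = Dom C h \<Longrightarrow>
    (h \<cdot> g) \<cdot> f = h \<cdot> (g \<cdot> f)"
  by (rule Cmp_assoc[symmetric, of f "Dom C f" "Dom C g" g "Dom C h" h "Cod C h"])
    (simp_all add: Hom_iff)

text \<open>\<open>inverse_of\<close> is a definite description, so everything rests on uniqueness
  of a two-sided inverse: any \<open>h\<close> inverse to \<open>f\<close> equals
  \<open>h \<cdot> f \<cdot> g\<close>, hence \<open>g\<close>.\<close>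

lemma inverse_of_simps:
  assumes "is_iso C f"
  shows "f \<in> Ar C" "inverse_of C f \<in> Ar C"
    "Dom C (inverse_of C f) = Cod C f" "Cod C (inverse_of C f) = Dom C f"
    "inverse_of C f \<cdot> f = Id C (Dom C f)" "f \<cdot> inverse_of C f = Id C (Cod C f)"
proof -
  obtain g where f: "f \<in> Ar C" and g: "is_inverse C f g"
    using assms by (auto simp: is_iso_def)
  have "h = g" if "is_inverse C f h" for h
  proof -
    have "h = h \<cdot> (f \<cdot> g)"
      using that g by (simp add: is_inverse_def Hom_iff)
    also have "\<dots> = (h \<cdot> f) \<cdot> g"
      using that g f by (subst Cmp_Cmp) (auto simp: is_inverse_def Hom_iff)
    also have "\<dots> = g"
      using that g by (simp add: is_inverse_def Hom_iff)
    finally show ?thesis .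
  qed
  then have "is_inverse C f (inverse_of C f)"
    unfolding inverse_of_def using g by (rule theI[rotated])
  then show "f \<in> Ar C" "inverse_of C f \<in> Ar C"
    "Dom C (inverse_of C f) = Cod C f" "Cod C (inverse_of C f) = Dom C f"
    "inverse_of C f \<cdot> f = Id C (Dom C f)" "f \<cdot> inverse_of C f = Id C (Cod C f)"
    using f by (auto simp: is_inverse_def Hom_iff)
qed

text \<open>Precomposing with the section \<open>s\<close> removes \<open>e\<close>. Only a
  one-sided inverse has to be exhibited, which is convenient for composites of coherence
  maps.\<close>

lemma split_epi_cancel:
  assumes "e \<in> Ar C" "s \<in> Ar C" "Dom C e = Cod C s" "e \<cdot> s = Id C (Cod C e)"
    and "f \<in> Ar C" "g \<in> Ar C" "Dom C f = Cod C e" "Dom C g = Cod C e" "f \<cdot> e = g \<cdot> e"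
  shows "f = g"
proof -
  have "f = (f \<cdot> e) \<cdot> s"
    using assms by (subst Cmp_Cmp) auto
  also have "\<dots> = g"
    unfolding assms(9) using assms by (subst Cmp_Cmp) auto
  finally show ?thesis .
qed

end

context symmetric_monoidal
begin

declare Ten_Ob [simp] Unit_Ob [simp]

lemma TenA_simps [simp]:
  assumes "f \<in> Ar C" "g \<in> Ar C"
  shows "f \<boxtimes> g \<in> Ar C" "Dom C (f \<boxtimes> g) = Dom C f \<otimes> Dom C g"
    "Cod C (f \<boxtimes> g) = Cod C f \<otimes> Cod C g"
  using TenA_Hom[of f "Dom C f" "Cod C f" g "Dom C g" "Cod C g"] assms by (auto simp: Hom_iff)

lemma TenA_TenA_Cmp:
  "f \<in> Ar C \<Longrightarrow> g \<in> Ar C \<Longrightarrow> f' \<in> Ar C \<Longrightarrow> g' \<in> Ar C \<Longrightarrow> Cod C f = Dom C g \<Longrightarrow> Cod C f' = Dom C g' \<Longrightarrow>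
    (g \<boxtimes> g') \<cdot> (f \<boxtimes> f') = (g \<cdot> f) \<boxtimes> (g' \<cdot> f')"
  by (rule TenA_Cmp[symmetric, where x = "Dom C f" and y = "Dom C g" and z = "Cod C g"
        and x' = "Dom C f'" and y' = "Dom C g'" and z' = "Cod C g'"]) (simp_all add: Hom_iff)

text \<open>Composites are kept bracketed to the right, so two adjacent tensors usually have a
  further arrow \<open>k\<close> behind them; this is the interchange law in that position.\<close>

lemma TenA_TenA_Cmp':
  "f \<in> Ar C \<Longrightarrow> g \<in> Ar C \<Longrightarrow> f' \<in> Ar C \<Longrightarrow> g' \<in> Ar C \<Longrightarrow> Cod C f = Dom C g \<Longrightarrow> Cod C f' = Dom C g' \<Longrightarrow>
    k \<in> Ar C \<Longrightarrow> Cod C k = Dom C f \<otimes> Dom C f' \<Longrightarrow>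
    (g \<boxtimes> g') \<cdot> ((f \<boxtimes> f') \<cdot> k) = ((g \<cdot> f) \<boxtimes> (g' \<cdot> f')) \<cdot> k"
  by (subst Cmp_Cmp[symmetric]) (simp_all add: TenA_TenA_Cmp)

lemmas TenA_fuse = TenA_TenA_Cmp TenA_TenA_Cmp'

lemma structure_simps [simp]:
  assumes "x \<in> Ob C"
  shows "LUnit C x \<in> Ar C" "Dom C (LUnit C x) = Unit C \<otimes> x" "Cod C (LUnit C x) = x"
    "RUnit C x \<in> Ar C" "Dom C (RUnit C x) = x \<otimes> Unit C" "Cod C (RUnit C x) = x"
    "y \<in> Ob C \<Longrightarrow> Sym C x y \<in> Ar C"
    "y \<in> Ob C \<Longrightarrow> Dom C (Sym C x y) = x \<otimes> y"
    "y \<in> Ob C \<Longrightarrow> Cod C (Sym C x y) = y \<otimes> x"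
    "y \<in> Ob C \<Longrightarrow> z \<in> Ob C \<Longrightarrow> Assoc C x y z \<in> Ar C"
    "y \<in> Ob C \<Longrightarrow> z \<in> Ob C \<Longrightarrow> Dom C (Assoc C x y z) = (x \<otimes> y) \<otimes> z"
    "y \<in> Ob C \<Longrightarrow> z \<in> Ob C \<Longrightarrow> Cod C (Assoc C x y z) = x \<otimes> (y \<otimes> z)"
  using LUnit_Hom[of x] RUnit_Hom[of x] Sym_Hom[of x y] Assoc_Hom[of x y z] assms
  by (auto simp: Hom_iff)

lemma Assoc_nat:
  "f \<in> Ar C \<Longrightarrow> g \<in> Ar C \<Longrightarrow> h \<in> Ar C \<Longrightarrow>
    Assoc C (Cod C f) (Cod C g) (Cod C h) \<cdot> ((f \<boxtimes> g) \<boxtimes> h)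
      = (f \<boxtimes> (g \<boxtimes> h)) \<cdot> Assoc C (Dom C f) (Dom C g) (Dom C h)"
  by (rule Assoc_natural) (simp_all add: Hom_iff)

lemma LUnit_nat: "f \<in> Ar C \<Longrightarrow> LUnit C (Cod C f) \<cdot> (Id C (Unit C) \<boxtimes> f) = f \<cdot> LUnit C (Dom C f)"
  by (rule LUnit_natural) (simp add: Hom_iff)

lemma RUnit_nat: "f \<in> Ar C \<Longrightarrow> RUnit C (Cod C f) \<cdot> (f \<boxtimes> Id C (Unit C)) = f \<cdot> RUnit C (Dom C f)"
  by (rule RUnit_natural) (simp add: Hom_iff)

lemma Sym_nat:
  "f \<in> Ar C \<Longrightarrow> g \<in> Ar C \<Longrightarrow>
    Sym C (Cod C f) (Cod C g) \<cdot> (f \<boxtimes> g) = (g \<boxtimes> f) \<cdot> Sym C (Dom C f) (Dom C g)"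
  by (rule Sym_natural) (simp_all add: Hom_iff)

text \<open>By naturality of the left unitor, tensoring with the identity of the unit is conjugation
  by an isomorphism, which cancels.\<close>

lemma Unit_TenA_cancel:
  assumes "f \<in> Ar C" "g \<in> Ar C" "Dom C f = Dom C g" "Cod C f = Cod C g"
    and "Id C (Unit C) \<boxtimes> f = Id C (Unit C) \<boxtimes> g"
  shows "f = g"
proof -
  have "f \<cdot> LUnit C (Dom C f) = g \<cdot> LUnit C (Dom C f)"
    using LUnit_nat[of f] LUnit_nat[of g] assms by simp
  then show ?thesis
    using inverse_of_simps[OF LUnit_iso, of "Dom C f"] assms
    by - (rule split_epi_cancel[where e = "LUnit C (Dom C f)" and s = "inverse_of C (LUnit C (Dom C f))"], auto)
qed

text \<open>Kelly's argument: this coherence law is not an axiom, but it follows from the pentagon and the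
  triangle after tensoring with the unit.\<close>

lemma LUnit_Ten:
  assumes x [simp]: "x \<in> Ob C" and y [simp]: "y \<in> Ob C"
  shows "LUnit C (x \<otimes> y) \<cdot> Assoc C (Unit C) x y = LUnit C x \<boxtimes> Id C y"
proof (rule Unit_TenA_cancel)
  let ?U = "Unit C"
  \<comment> \<open>\<open>?e\<close> is the isomorphism from ((I I) x) y to I ((I x) y), with I the
    unit, along two sides of the pentagon. The two arrows agree after precomposition with it, and
    the section \<open>?s\<close> permits its cancellation.\<close>
  let ?e = "Assoc C ?U (?U \<otimes> x) y \<cdot> (Assoc C ?U ?U x \<boxtimes> Id C y)"
  let ?s = "(inverse_of C (Assoc C ?U ?U x) \<boxtimes> Id C y) \<cdot> inverse_of C (Assoc C ?U (?U \<otimes> x) y)"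
  note inv [simp] = inverse_of_simps[OF Assoc_iso]
  have "?e \<cdot> ?s = Assoc C ?U (?U \<otimes> x) y \<cdot> (((Assoc C ?U ?U x \<boxtimes> Id C y) \<cdot>
      (inverse_of C (Assoc C ?U ?U x) \<boxtimes> Id C y)) \<cdot> inverse_of C (Assoc C ?U (?U \<otimes> x) y))"
    by (simp add: Cmp_Cmp)
  also have "\<dots> = Id C (Cod C ?e)"
    by (simp add: TenA_TenA_Cmp TenA_Id)
  finally have es: "?e \<cdot> ?s = Id C (Cod C ?e)" .
  have "(Id C ?U \<boxtimes> (LUnit C (x \<otimes> y) \<cdot> Assoc C ?U x y)) \<cdot> ?e
      = (Id C ?U \<boxtimes> LUnit C (x \<otimes> y)) \<cdot> ((Id C ?U \<boxtimes> Assoc C ?U x y) \<cdot> ?e)"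
    by (simp add: TenA_fuse)
  also have "\<dots> = (Id C ?U \<boxtimes> LUnit C (x \<otimes> y)) \<cdot> (Assoc C ?U ?U (x \<otimes> y) \<cdot> Assoc C (?U \<otimes> ?U) x y)"
    by (simp add: pentagon)
  also have "\<dots> = ((Id C ?U \<boxtimes> LUnit C (x \<otimes> y)) \<cdot> Assoc C ?U ?U (x \<otimes> y)) \<cdot> Assoc C (?U \<otimes> ?U) x y"
    by (simp add: Cmp_Cmp)
  also have "\<dots> = (RUnit C ?U \<boxtimes> (Id C x \<boxtimes> Id C y)) \<cdot> Assoc C (?U \<otimes> ?U) x y"
    by (simp add: triangle TenA_Id)
  also have "\<dots> = Assoc C ?U x y \<cdot> ((RUnit C ?U \<boxtimes> Id C x) \<boxtimes> Id C y)"
    using Assoc_nat[of "RUnit C ?U" "Id C x" "Id C y"] by simp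
  also have "\<dots> = Assoc C ?U x y \<cdot> (((Id C ?U \<boxtimes> LUnit C x) \<boxtimes> Id C y) \<cdot> (Assoc C ?U ?U x \<boxtimes> Id C y))"
    by (simp add: triangle[symmetric] TenA_TenA_Cmp)
  also have "\<dots> = (Assoc C ?U x y \<cdot> ((Id C ?U \<boxtimes> LUnit C x) \<boxtimes> Id C y)) \<cdot> (Assoc C ?U ?U x \<boxtimes> Id C y)"
    by (simp add: Cmp_Cmp)
  also have "\<dots> = ((Id C ?U \<boxtimes> (LUnit C x \<boxtimes> Id C y)) \<cdot> Assoc C ?U (?U \<otimes> x) y) \<cdot> (Assoc C ?U ?U x \<boxtimes> Id C y)"
    using Assoc_nat[of "Id C ?U" "LUnit C x" "Id C y"] by simp
  also have "\<dots> = (Id C ?U \<boxtimes> (LUnit C x \<boxtimes> Id C y)) \<cdot> ?e"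
    by (simp add: Cmp_Cmp)
  finally show "Id C ?U \<boxtimes> (LUnit C (x \<otimes> y) \<cdot> Assoc C ?U x y) = Id C ?U \<boxtimes> (LUnit C x \<boxtimes> Id C y)"
    using es by - (rule split_epi_cancel[where e = ?e and s = ?s], auto)
qed auto

end

section \<open>The self-enrichment of a closed symmetric monoidal category\<close>

context closed_symmetric_monoidal
begin

declare IHom_Ob [simp]

lemma Ev_simps [simp]:
  assumes "y \<in> Ob C" "z \<in> Ob C"
  shows "Ev C y z \<in> Ar C" "Dom C (Ev C y z) = IHom C y z \<otimes> y" "Cod C (Ev C y z) = z"
  using Ev_Hom[OF assms] by (auto simp: Hom_iff)

lemma adjunct_simps:
  assumes "x \<in> Ob C" "y \<in> Ob C" "f \<in> Ar C" "Dom C f = x \<otimes> y" "Cod C f = z"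
  shows "adjunct C x y z f \<in> Ar C" "Dom C (adjunct C x y z f) = x"
    "Cod C (adjunct C x y z f) = IHom C y z"
    "Ev C y z \<cdot> (adjunct C x y z f \<boxtimes> Id C y) = f"
proof -
  have "z \<in> Ob C"
    using assms by auto
  from theI'[OF Ev_universal[OF assms(1,2) this, of f]] assms
  show "adjunct C x y z f \<in> Ar C" "Dom C (adjunct C x y z f) = x"
    "Cod C (adjunct C x y z f) = IHom C y z"
    "Ev C y z \<cdot> (adjunct C x y z f \<boxtimes> Id C y) = f"
    by (auto simp: adjunct_def Hom_iff)
qed

text \<open>Uniqueness in the universal property of \<open>Ev\<close>: an arrow into a function
  object is determined by its uncurried form. The laws of the self-enrichment are all checked in
  that form.\<close>

lemma IHom_eqI:
  assumes "f \<in> Ar C" "g \<in> Ar C" "Dom C f = Dom C g" "Cod C f = IHom C y z" "Cod C g = IHom C y z"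
    and "y \<in> Ob C" "z \<in> Ob C"
    and "Ev C y z \<cdot> (f \<boxtimes> Id C y) = Ev C y z \<cdot> (g \<boxtimes> Id C y)"
  shows "f = g"
proof -
  have "\<exists>!h. h \<in> Hom C (Dom C f) (IHom C y z) \<and> Ev C y z \<cdot> (h \<boxtimes> Id C y) = Ev C y z \<cdot> (f \<boxtimes> Id C y)"
    using assms by (intro Ev_universal) (auto simp: Hom_iff)
  with assms show ?thesis
    by (auto simp: Hom_iff)
qed

abbreviation "icomp \<equiv> EComp (self_enriched C)"

lemma icomp_simps [simp]:
  assumes "x \<in> Ob C" "y \<in> Ob C" "z \<in> Ob C"
  shows "icomp x y z \<in> Ar C" "Dom C (icomp x y z) = IHom C y z \<otimes> IHom C x y"
    "Cod C (icomp x y z) = IHom C x z"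
    "Ev C x z \<cdot> (icomp x y z \<boxtimes> Id C x)
      = Ev C y z \<cdot> (Id C (IHom C y z) \<boxtimes> Ev C x y) \<cdot> Assoc C (IHom C y z) (IHom C x y) x"
  using assms by (simp_all add: self_enriched_def adjunct_simps)

text \<open>The defining equation of \<open>icomp\<close>, with \<open>f\<close> and
  \<open>g\<close> moved past the associator by naturality. The result says to evaluate
  \<open>g\<close> first and \<open>f\<close> afterwards.\<close>

lemma Ev_icomp:
  assumes [simp]: "x \<in> Ob C" "y \<in> Ob C" "z \<in> Ob C" "f \<in> Ar C" "g \<in> Ar C"
    "Cod C f = IHom C y z" "Cod C g = IHom C x y"
  shows "Ev C x z \<cdot> ((icomp x y z \<cdot> (f \<boxtimes> g)) \<boxtimes> Id C x)
    = Ev C y z \<cdot> (f \<boxtimes> (Ev C x y \<cdot> (g \<boxtimes> Id C x))) \<cdot> Assoc C (Dom C f) (Dom C g) x"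
proof -
  have "Ev C x z \<cdot> ((icomp x y z \<cdot> (f \<boxtimes> g)) \<boxtimes> Id C x)
      = (Ev C x z \<cdot> (icomp x y z \<boxtimes> Id C x)) \<cdot> ((f \<boxtimes> g) \<boxtimes> Id C x)"
    by (simp add: Cmp_Cmp TenA_fuse del: icomp_simps(4))
  also have "\<dots> = Ev C y z \<cdot> (Id C (IHom C y z) \<boxtimes> Ev C x y)
      \<cdot> (Assoc C (IHom C y z) (IHom C x y) x \<cdot> ((f \<boxtimes> g) \<boxtimes> Id C x))"
    by (simp add: Cmp_Cmp)
  also have "\<dots> = Ev C y z \<cdot> (Id C (IHom C y z) \<boxtimes> Ev C x y)
      \<cdot> ((f \<boxtimes> (g \<boxtimes> Id C x)) \<cdot> Assoc C (Dom C f) (Dom C g) x)"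
    using Assoc_nat[of f g "Id C x"] by simp
  also have "\<dots> = Ev C y z \<cdot> (f \<boxtimes> (Ev C x y \<cdot> (g \<boxtimes> Id C x))) \<cdot> Assoc C (Dom C f) (Dom C g) x"
    by (simp add: TenA_fuse)
  finally show ?thesis .
qed

lemma self_enriched_EId [simp]:
  assumes "x \<in> Ob C"
  shows "EId (self_enriched C) x \<in> Ar C" "Dom C (EId (self_enriched C) x) = Unit C"
    "Cod C (EId (self_enriched C) x) = IHom C x x"
    "Ev C x x \<cdot> (EId (self_enriched C) x \<boxtimes> Id C x) = LUnit C x"
  using assms by (simp_all add: self_enriched_def adjunct_simps)

lemma self_enriched_simps [simp]:
  "EOb (self_enriched C) = Ob C" "EHom (self_enriched C) = IHom C"
  by (simp_all add: self_enriched_def)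

text \<open>Uncurried at \<open>w\<close>, both sides evaluate three maps in succession. They differ
  in the bracketing of the four factors, and the pentagon compares the bracketings.\<close>

lemma icomp_assoc:
  assumes [simp]: "w \<in> Ob C" "x \<in> Ob C" "y \<in> Ob C" "z \<in> Ob C"
  shows "icomp w x z \<cdot> (icomp x y z \<boxtimes> Id C (IHom C w x))
    = icomp w y z \<cdot> (Id C (IHom C y z) \<boxtimes> icomp w x y) \<cdot> Assoc C (IHom C y z) (IHom C x y) (IHom C w x)"
proof (rule IHom_eqI[where y = w and z = z])
  let ?F = "IHom C"
  note icomp_simps(4) [simp del]
  have "Ev C w z \<cdot> ((icomp w x z \<cdot> (icomp x y z \<boxtimes> Id C (?F w x))) \<boxtimes> Id C w)
      = Ev C x z \<cdot> (icomp x y z \<boxtimes> Ev C w x) \<cdot> Assoc C (?F y z \<otimes> ?F x y) (?F w x) w"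
    by (subst Ev_icomp) (simp_all add: TenA_Id)
  also have "\<dots> = Ev C x z \<cdot> ((icomp x y z \<boxtimes> Id C x) \<cdot> (Id C (?F y z \<otimes> ?F x y) \<boxtimes> Ev C w x))
      \<cdot> Assoc C (?F y z \<otimes> ?F x y) (?F w x) w"
    by (subst TenA_TenA_Cmp) simp_all
  also have "\<dots> = (Ev C x z \<cdot> (icomp x y z \<boxtimes> Id C x)) \<cdot> (Id C (?F y z \<otimes> ?F x y) \<boxtimes> Ev C w x)
      \<cdot> Assoc C (?F y z \<otimes> ?F x y) (?F w x) w"
    by (simp add: Cmp_Cmp)
  also have "\<dots> = Ev C y z \<cdot> (Id C (?F y z) \<boxtimes> Ev C x y) \<cdot>
      (Assoc C (?F y z) (?F x y) x \<cdot> ((Id C (?F y z) \<boxtimes> Id C (?F x y)) \<boxtimes> Ev C w x))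
      \<cdot> Assoc C (?F y z \<otimes> ?F x y) (?F w x) w"
    by (subst icomp_simps(4)) (simp_all add: Cmp_Cmp TenA_Id)
  also have "\<dots> = Ev C y z \<cdot> (Id C (?F y z) \<boxtimes> Ev C x y) \<cdot>
      ((Id C (?F y z) \<boxtimes> (Id C (?F x y) \<boxtimes> Ev C w x)) \<cdot> Assoc C (?F y z) (?F x y) (?F w x \<otimes> w))
      \<cdot> Assoc C (?F y z \<otimes> ?F x y) (?F w x) w"
    using Assoc_nat[of "Id C (?F y z)" "Id C (?F x y)" "Ev C w x"] by simp
  also have "\<dots> = Ev C y z \<cdot> (Id C (?F y z) \<boxtimes> (Ev C x y \<cdot> (Id C (?F x y) \<boxtimes> Ev C w x))) \<cdot>
      (Assoc C (?F y z) (?F x y) (?F w x \<otimes> w) \<cdot> Assoc C (?F y z \<otimes> ?F x y) (?F w x) w)"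
    by (simp add: Cmp_Cmp TenA_fuse)
  also have "\<dots> = Ev C y z \<cdot> (Id C (?F y z) \<boxtimes> (Ev C x y \<cdot> (Id C (?F x y) \<boxtimes> Ev C w x))) \<cdot>
      ((Id C (?F y z) \<boxtimes> Assoc C (?F x y) (?F w x) w) \<cdot> Assoc C (?F y z) (?F x y \<otimes> ?F w x) w
        \<cdot> (Assoc C (?F y z) (?F x y) (?F w x) \<boxtimes> Id C w))"
    by (simp add: pentagon)
  also have "\<dots> = (Ev C y z \<cdot> (Id C (?F y z) \<boxtimes> (Ev C w y \<cdot> (icomp w x y \<boxtimes> Id C w)))
      \<cdot> Assoc C (?F y z) (?F x y \<otimes> ?F w x) w) \<cdot> (Assoc C (?F y z) (?F x y) (?F w x) \<boxtimes> Id C w)"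
    by (subst icomp_simps(4)) (simp_all add: Cmp_Cmp TenA_fuse)
  also have "\<dots> = (Ev C w z \<cdot> ((icomp w y z \<cdot> (Id C (?F y z) \<boxtimes> icomp w x y)) \<boxtimes> Id C w))
      \<cdot> (Assoc C (?F y z) (?F x y) (?F w x) \<boxtimes> Id C w)"
    by (subst Ev_icomp) simp_all
  also have "\<dots> = Ev C w z \<cdot> ((icomp w y z \<cdot> (Id C (?F y z) \<boxtimes> icomp w x y)
      \<cdot> Assoc C (?F y z) (?F x y) (?F w x)) \<boxtimes> Id C w)"
    by (simp add: Cmp_Cmp TenA_fuse)
  finally show "Ev C w z \<cdot> ((icomp w x z \<cdot> (icomp x y z \<boxtimes> Id C (?F w x))) \<boxtimes> Id C w)
    = Ev C w z \<cdot> ((icomp w y z \<cdot> (Id C (?F y z) \<boxtimes> icomp w x y)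
      \<cdot> Assoc C (?F y z) (?F x y) (?F w x)) \<boxtimes> Id C w)" .
qed simp_all

text \<open>Uncurrying produces the left unitor of a tensor product composed with an associator, so
  this law rests on \<open>LUnit_Ten\<close>; for the right unit law the triangle axiom
  suffices.\<close>

lemma icomp_EId_left:
  assumes [simp]: "x \<in> Ob C" "y \<in> Ob C"
  shows "icomp x y y \<cdot> (EId (self_enriched C) y \<boxtimes> Id C (IHom C x y)) = LUnit C (IHom C x y)"
proof (rule IHom_eqI[where y = x and z = y])
  let ?E = "EId (self_enriched C) y"
  let ?F = "IHom C x y"
  have "Ev C x y \<cdot> ((icomp x y y \<cdot> (?E \<boxtimes> Id C ?F)) \<boxtimes> Id C x)
      = Ev C y y \<cdot> (?E \<boxtimes> Ev C x y) \<cdot> Assoc C (Unit C) ?F x"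
    by (subst Ev_icomp) (simp_all add: TenA_Id)
  also have "\<dots> = Ev C y y \<cdot> ((?E \<boxtimes> Id C y) \<cdot> (Id C (Unit C) \<boxtimes> Ev C x y)) \<cdot> Assoc C (Unit C) ?F x"
    by (simp add: TenA_TenA_Cmp)
  also have "\<dots> = (Ev C y y \<cdot> (?E \<boxtimes> Id C y)) \<cdot> (Id C (Unit C) \<boxtimes> Ev C x y) \<cdot> Assoc C (Unit C) ?F x"
    by (simp add: Cmp_Cmp del: self_enriched_EId(4))
  also have "\<dots> = (LUnit C y \<cdot> (Id C (Unit C) \<boxtimes> Ev C x y)) \<cdot> Assoc C (Unit C) ?F x"
    by (simp add: Cmp_Cmp)
  also have "\<dots> = (Ev C x y \<cdot> LUnit C (?F \<otimes> x)) \<cdot> Assoc C (Unit C) ?F x"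
    using LUnit_nat[of "Ev C x y"] by simp
  also have "\<dots> = Ev C x y \<cdot> (LUnit C ?F \<boxtimes> Id C x)"
    by (simp add: Cmp_Cmp LUnit_Ten)
  finally show "Ev C x y \<cdot> ((icomp x y y \<cdot> (?E \<boxtimes> Id C ?F)) \<boxtimes> Id C x) = Ev C x y \<cdot> (LUnit C ?F \<boxtimes> Id C x)" .
qed simp_all

lemma icomp_EId_right:
  assumes [simp]: "x \<in> Ob C" "y \<in> Ob C"
  shows "icomp x x y \<cdot> (Id C (IHom C x y) \<boxtimes> EId (self_enriched C) x) = RUnit C (IHom C x y)"
proof (rule IHom_eqI[where y = x and z = y])
  show "Ev C x y \<cdot> ((icomp x x y \<cdot> (Id C (IHom C x y) \<boxtimes> EId (self_enriched C) x)) \<boxtimes> Id C x)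
      = Ev C x y \<cdot> (RUnit C (IHom C x y) \<boxtimes> Id C x)"
    by (subst Ev_icomp) (simp_all add: triangle)
qed simp_all

lemma enriched_category_self_enriched: "enriched_category C (self_enriched C)"
proof unfold_locales
qed (simp_all add: Hom_iff icomp_assoc icomp_EId_left icomp_EId_right del: icomp_simps(4))

text \<open>A family of maps \<open>EHom E x y \<otimes> ob x \<rightarrow> ob y\<close> compatible with composition and units amounts to
  an enriched functor into \<open>C\<close>; its action on morphism objects is the adjoint family.\<close>

lemma enriched_functor_self_enrichedI:
  fixes E :: "('e, 'o, 'm) enr"
  assumes E: "enriched_category C E"
    and ob: "\<And>x. x \<in> EOb E \<Longrightarrow> ob x \<in> Ob C"
    and act: "\<And>x y. x \<in> EOb E \<Longrightarrow> y \<in> EOb E \<Longrightarrow> act x y \<in> Hom C (EHom E x y \<otimes> ob x) (ob y)"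
    and act_comp: "\<And>x y z. x \<in> EOb E \<Longrightarrow> y \<in> EOb E \<Longrightarrow> z \<in> EOb E \<Longrightarrow>
      act x z \<cdot> (EComp E x y z \<boxtimes> Id C (ob x))
        = act y z \<cdot> (Id C (EHom E y z) \<boxtimes> act x y) \<cdot> Assoc C (EHom E y z) (EHom E x y) (ob x)"
    and act_id: "\<And>x. x \<in> EOb E \<Longrightarrow> act x x \<cdot> (EId E x \<boxtimes> Id C (ob x)) = LUnit C (ob x)"
  shows "enriched_functor C E (self_enriched C) ob
    (\<lambda>x y. adjunct C (EHom E x y) (ob x) (ob y) (act x y))"
proof -
  interpret E: enriched_category C E by fact
  interpret S: enriched_category C "self_enriched C" by (rule enriched_category_self_enriched)
  define \<Phi> where "\<Phi> x y = adjunct C (EHom E x y) (ob x) (ob y) (act x y)" for x y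
  note [simp] = ob E.EHom_Ob
  have act' [simp]: "act x y \<in> Ar C" "Dom C (act x y) = EHom E x y \<otimes> ob x" "Cod C (act x y) = ob y"
    if "x \<in> EOb E" "y \<in> EOb E" for x y
    using act[OF that] by (auto simp: Hom_iff)
  have \<Phi> [simp]: "\<Phi> x y \<in> Ar C" "Dom C (\<Phi> x y) = EHom E x y" "Cod C (\<Phi> x y) = IHom C (ob x) (ob y)"
    "Ev C (ob x) (ob y) \<cdot> (\<Phi> x y \<boxtimes> Id C (ob x)) = act x y" if "x \<in> EOb E" "y \<in> EOb E" for x y
    using that unfolding \<Phi>_def by (simp_all add: adjunct_simps)
  have comp [simp]: "EComp E x y z \<in> Ar C" "Dom C (EComp E x y z) = EHom E y z \<otimes> EHom E x y"
    "Cod C (EComp E x y z) = EHom E x z" if "x \<in> EOb E" "y \<in> EOb E" "z \<in> EOb E" for x y z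
    using E.EComp_Hom[OF that] by (auto simp: Hom_iff)
  have id [simp]: "EId E x \<in> Ar C" "Dom C (EId E x) = Unit C"
    "Cod C (EId E x) = EHom E x x" if "x \<in> EOb E" for x
    using E.EId_Hom[OF that] by (auto simp: Hom_iff)
  \<comment> \<open>Naturality of the adjunction: precomposing \<open>\<Phi> x y\<close> with
    \<open>f\<close> precomposes the action with \<open>f\<close>.\<close>
  have Ev_\<Phi>: "Ev C (ob x) (ob y) \<cdot> ((\<Phi> x y \<cdot> f) \<boxtimes> Id C (ob x)) = act x y \<cdot> (f \<boxtimes> Id C (ob x))"
    if [simp]: "x \<in> EOb E" "y \<in> EOb E" and [simp]: "f \<in> Ar C" "Cod C f = EHom E x y" for x y f
  proof -
    have "Ev C (ob x) (ob y) \<cdot> ((\<Phi> x y \<cdot> f) \<boxtimes> Id C (ob x))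
        = (Ev C (ob x) (ob y) \<cdot> (\<Phi> x y \<boxtimes> Id C (ob x))) \<cdot> (f \<boxtimes> Id C (ob x))"
      by (simp add: Cmp_Cmp TenA_fuse del: \<Phi>(4))
    then show ?thesis
      by simp
  qed
  have "\<Phi> x z \<cdot> EComp E x y z = icomp (ob x) (ob y) (ob z) \<cdot> (\<Phi> y z \<boxtimes> \<Phi> x y)"
    if [simp]: "x \<in> EOb E" "y \<in> EOb E" "z \<in> EOb E" for x y z
  proof (rule IHom_eqI[where y = "ob x" and z = "ob z"])
    have "Ev C (ob x) (ob z) \<cdot> ((icomp (ob x) (ob y) (ob z) \<cdot> (\<Phi> y z \<boxtimes> \<Phi> x y)) \<boxtimes> Id C (ob x))
        = Ev C (ob y) (ob z) \<cdot> (\<Phi> y z \<boxtimes> act x y) \<cdot> Assoc C (EHom E y z) (EHom E x y) (ob x)"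
      by (subst Ev_icomp) simp_all
    also have "\<dots> = Ev C (ob y) (ob z) \<cdot> ((\<Phi> y z \<boxtimes> Id C (ob y)) \<cdot> (Id C (EHom E y z) \<boxtimes> act x y))
        \<cdot> Assoc C (EHom E y z) (EHom E x y) (ob x)"
      by (simp add: TenA_TenA_Cmp)
    also have "\<dots> = (Ev C (ob y) (ob z) \<cdot> (\<Phi> y z \<boxtimes> Id C (ob y))) \<cdot> (Id C (EHom E y z) \<boxtimes> act x y)
        \<cdot> Assoc C (EHom E y z) (EHom E x y) (ob x)"
      by (simp add: Cmp_Cmp del: \<Phi>(4))
    also have "\<dots> = act x z \<cdot> (EComp E x y z \<boxtimes> Id C (ob x))"
      by (simp add: act_comp)
    finally show "Ev C (ob x) (ob z) \<cdot> ((\<Phi> x z \<cdot> EComp E x y z) \<boxtimes> Id C (ob x))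
        = Ev C (ob x) (ob z) \<cdot> ((icomp (ob x) (ob y) (ob z) \<cdot> (\<Phi> y z \<boxtimes> \<Phi> x y)) \<boxtimes> Id C (ob x))"
      by (simp add: Ev_\<Phi>)
  qed simp_all
  moreover have "\<Phi> x x \<cdot> EId E x = EId (self_enriched C) (ob x)" if [simp]: "x \<in> EOb E" for x
    by (rule IHom_eqI[where y = "ob x" and z = "ob x"]) (simp_all add: Ev_\<Phi> act_id)
  ultimately have "enriched_functor C E (self_enriched C) ob \<Phi>"
    by unfold_locales (simp_all add: Hom_iff)
  then show ?thesis
    unfolding \<Phi>_def .
qed

end

section \<open>Composites in the underlying multicategory\<close>

context symmetric_monoidal
begin

text \<open>\<open>ten_regroup\<close> is computed for the four groupings that occur in
  associativity and unit laws. One factor followed by a pair is already bracketed to the right and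
  contributes an identity; each of the other groupings contributes an inverse structure map.\<close>

lemma
  assumes [simp]: "x \<in> Ob C"
  shows MCmp_2_1: "y \<in> Ob C \<Longrightarrow> z \<in> Ob C \<Longrightarrow> f \<in> Hom C (x \<otimes> y) u \<Longrightarrow>
      MCmp (underlying_multicat C) [[x, y], [z]] ys t g [f, Id C z]
        = g \<cdot> (f \<boxtimes> Id C z) \<cdot> inverse_of C (Assoc C x y z)"
    and MCmp_1_2: "y \<in> Ob C \<Longrightarrow> z \<in> Ob C \<Longrightarrow> f \<in> Hom C (y \<otimes> z) u \<Longrightarrow>
      MCmp (underlying_multicat C) [[x], [y, z]] ys t g [Id C x, f] = g \<cdot> (Id C x \<boxtimes> f)"
    and MCmp_0_1: "f \<in> Hom C (Unit C) u \<Longrightarrow>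
      MCmp (underlying_multicat C) [[], [x]] ys t g [f, Id C x]
        = g \<cdot> (f \<boxtimes> Id C x) \<cdot> inverse_of C (LUnit C x)"
    and MCmp_1_0: "f \<in> Hom C (Unit C) u \<Longrightarrow>
      MCmp (underlying_multicat C) [[x], []] ys t g [Id C x, f]
        = g \<cdot> (Id C x \<boxtimes> f) \<cdot> inverse_of C (RUnit C x)"
  using inverse_of_simps[OF Assoc_iso[of x y z]] inverse_of_simps[OF LUnit_iso[of x]]
    inverse_of_simps[OF RUnit_iso[of x]]
  by (simp_all add: underlying_multicat_def Hom_iff TenA_Id)

end

section \<open>Permutative categories\<close>

text \<open>The middle four interchange a b c d -> a c b d. No associators occur in it, so the
  formula is meant for permutative categories. The same symmetry appears in the structure morphism
  of a pointwise sum and in the compatibility of two linearity constraints.\<close>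

definition midswap :: "('o, 'm, 'z) moncat_scheme \<Rightarrow> 'o \<Rightarrow> 'o \<Rightarrow> 'o \<Rightarrow> 'o \<Rightarrow> 'm" where
  "midswap C a b c d = Id C a \<boxtimes>\<^bsub>C\<^esub> Sym C b c \<boxtimes>\<^bsub>C\<^esub> Id C d"

context permutative_category
begin

text \<open>The domain of \<open>Assoc\<close> is one bracketing by its typing, and the other one
  because \<open>Assoc\<close> is an identity.\<close>

lemma Ten_assoc [simp]:
  assumes "x \<in> Ob A" "y \<in> Ob A" "z \<in> Ob A"
  shows "(x \<otimes> y) \<otimes> z = x \<otimes> y \<otimes> z"
proof -
  have "Dom A (Assoc A x y z) = (x \<otimes> y) \<otimes> z"
    using assms by simp
  then show ?thesis
    unfolding Assoc_is_Id[OF assms] using assms by simp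
qed

lemma Unit_Ten [simp]:
  assumes "x \<in> Ob A"
  shows "Unit A \<otimes> x = x" "x \<otimes> Unit A = x"
proof -
  have "Dom A (LUnit A x) = Unit A \<otimes> x" "Dom A (RUnit A x) = x \<otimes> Unit A"
    using assms by simp_all
  then show "Unit A \<otimes> x = x" "x \<otimes> Unit A = x"
    unfolding LUnit_is_Id[OF assms] RUnit_is_Id[OF assms] using assms by simp_all
qed

text \<open>The naturality square of an associator that is an identity.\<close>

lemma TenA_assoc:
  assumes "f \<in> Ar A" "g \<in> Ar A" "h \<in> Ar A"
  shows "(f \<boxtimes> g) \<boxtimes> h = f \<boxtimes> g \<boxtimes> h"
  using Assoc_nat[OF assms] assms by (simp add: Assoc_is_Id)

lemma Unit_TenA [simp]:
  assumes "f \<in> Ar A"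
  shows "Id A (Unit A) \<boxtimes> f = f" "f \<boxtimes> Id A (Unit A) = f"
  using LUnit_nat[OF assms] RUnit_nat[OF assms] assms by (simp_all add: LUnit_is_Id RUnit_is_Id)

lemma Id_Ten: "x \<in> Ob A \<Longrightarrow> y \<in> Ob A \<Longrightarrow> Id A (x \<otimes> y) = Id A x \<boxtimes> Id A y"
  by (simp add: TenA_Id)

lemma Sym_Ten_right:
  assumes "x \<in> Ob A" "y \<in> Ob A" "z \<in> Ob A"
  shows "Sym A x (y \<otimes> z) = (Id A y \<boxtimes> Sym A x z) \<cdot> (Sym A x y \<boxtimes> Id A z)"
  using hexagon[OF assms] assms by (simp add: Assoc_is_Id)

lemma Sym_inv [simp]: "x \<in> Ob A \<Longrightarrow> y \<in> Ob A \<Longrightarrow> Sym A y x \<cdot> Sym A x y = Id A (x \<otimes> y)"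
  by (rule Sym_Sym)

text \<open>The second hexagon, by inverting the first: composed with
  \<open>Sym A z (x \<otimes> y)\<close>, expanded by \<open>Sym_Ten_right\<close>, either side
  gives an identity.\<close>

lemma Sym_Ten_left:
  assumes [simp]: "x \<in> Ob A" "y \<in> Ob A" "z \<in> Ob A"
  shows "Sym A (x \<otimes> y) z = (Sym A x z \<boxtimes> Id A y) \<cdot> (Id A x \<boxtimes> Sym A y z)"
proof (rule split_epi_cancel[where e = "Sym A z (x \<otimes> y)" and s = "Sym A (x \<otimes> y) z"])
  have "((Sym A x z \<boxtimes> Id A y) \<cdot> (Id A x \<boxtimes> Sym A y z)) \<cdot> Sym A z (x \<otimes> y)
      = (Sym A x z \<boxtimes> Id A y) \<cdot> ((Id A x \<boxtimes> Sym A y z) \<cdot> (Id A x \<boxtimes> Sym A z y)) \<cdot> (Sym A z x \<boxtimes> Id A y)"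
    by (simp add: Sym_Ten_right Cmp_Cmp)
  also have "\<dots> = (Sym A x z \<boxtimes> Id A y) \<cdot> (Sym A z x \<boxtimes> Id A y)"
    by (simp add: TenA_TenA_Cmp TenA_Id)
  also have "\<dots> = Sym A (x \<otimes> y) z \<cdot> Sym A z (x \<otimes> y)"
    by (simp add: TenA_TenA_Cmp TenA_Id)
  finally show "Sym A (x \<otimes> y) z \<cdot> Sym A z (x \<otimes> y)
      = ((Sym A x z \<boxtimes> Id A y) \<cdot> (Id A x \<boxtimes> Sym A y z)) \<cdot> Sym A z (x \<otimes> y)" ..
qed simp_all

text \<open>By the hexagon at two units, the symmetry of \<open>x\<close> with the unit is
  idempotent; being invertible, it is an identity.\<close>

lemma Sym_Unit [simp]:
  assumes [simp]: "x \<in> Ob A"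
  shows "Sym A x (Unit A) = Id A x" "Sym A (Unit A) x = Id A x"
proof -
  have "Sym A x (Unit A) \<cdot> Sym A x (Unit A) = Id A x \<cdot> Sym A x (Unit A)"
    using Sym_Ten_right[of x "Unit A" "Unit A"] by simp
  then show x: "Sym A x (Unit A) = Id A x"
    by - (rule split_epi_cancel[where e = "Sym A x (Unit A)" and s = "Sym A (Unit A) x"], simp_all)
  show "Sym A (Unit A) x = Id A x"
    using Sym_inv[of "Unit A" x] by (simp add: x)
qed

lemma TenA_exchange:
  "f \<in> Ar A \<Longrightarrow> g \<in> Ar A \<Longrightarrow>
    (Id A (Cod A f) \<boxtimes> g) \<cdot> (f \<boxtimes> Id A (Dom A g)) = (f \<boxtimes> Id A (Cod A g)) \<cdot> (Id A (Dom A f) \<boxtimes> g)"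
  by (simp add: TenA_TenA_Cmp)

section \<open>Coherence of the middle four interchange\<close>

lemma midswap_simps [simp]:
  assumes "a \<in> Ob A" "b \<in> Ob A" "c \<in> Ob A" "d \<in> Ob A"
  shows "midswap A a b c d \<in> Ar A"
    "Dom A (midswap A a b c d) = a \<otimes> b \<otimes> c \<otimes> d" "Cod A (midswap A a b c d) = a \<otimes> c \<otimes> b \<otimes> d"
  using assms by (simp_all add: midswap_def)

lemma midswap_inv [simp]:
  assumes [simp]: "a \<in> Ob A" "b \<in> Ob A" "c \<in> Ob A" "d \<in> Ob A"
  shows "midswap A a c b d \<cdot> midswap A a b c d = Id A (a \<otimes> b \<otimes> c \<otimes> d)"
  by (simp add: midswap_def TenA_TenA_Cmp TenA_Id)

lemma midswap_Unit [simp]: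
  assumes "a \<in> Ob A" "b \<in> Ob A"
  shows "midswap A a (Unit A) b (Unit A) = Id A (a \<otimes> b)"
    "midswap A (Unit A) a (Unit A) b = Id A (a \<otimes> b)"
    "midswap A a b (Unit A) (Unit A) = Id A (a \<otimes> b)"
    "midswap A (Unit A) (Unit A) a b = Id A (a \<otimes> b)"
  using assms by (simp_all add: midswap_def TenA_Id)

text \<open>Regrouped as \<open>f\<close>, (\<open>g\<close>, \<open>h\<close>), \<open>k\<close>,
  the square is naturality of the symmetry of the middle pair.\<close>

lemma midswap_nat:
  assumes [simp]: "f \<in> Ar A" "g \<in> Ar A" "h \<in> Ar A" "k \<in> Ar A"
  shows "midswap A (Cod A f) (Cod A g) (Cod A h) (Cod A k) \<cdot> ((f \<boxtimes> g) \<boxtimes> (h \<boxtimes> k))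
    = ((f \<boxtimes> h) \<boxtimes> (g \<boxtimes> k)) \<cdot> midswap A (Dom A f) (Dom A g) (Dom A h) (Dom A k)"
proof -
  have "midswap A (Cod A f) (Cod A g) (Cod A h) (Cod A k) \<cdot> (f \<boxtimes> (g \<boxtimes> h) \<boxtimes> k)
      = f \<boxtimes> (Sym A (Cod A g) (Cod A h) \<cdot> (g \<boxtimes> h)) \<boxtimes> k"
    by (simp add: midswap_def TenA_TenA_Cmp)
  also have "\<dots> = (f \<boxtimes> (h \<boxtimes> g) \<boxtimes> k) \<cdot> midswap A (Dom A f) (Dom A g) (Dom A h) (Dom A k)"
    by (simp add: midswap_def TenA_TenA_Cmp Sym_nat)
  finally show ?thesis
    by (simp add: TenA_assoc)
qed

text \<open>The two hexagons split the block symmetry into swaps of single summands, and the swap of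
  \<open>c\<close> past \<open>b\<close> among them undoes the interchange with which it is
  composed. This square makes the pointwise symmetry of two functors a monoidal
  transformation.\<close>

lemma Sym_midswap:
  assumes [simp]: "a \<in> Ob A" "b \<in> Ob A" "c \<in> Ob A" "d \<in> Ob A"
  shows "Sym A (a \<otimes> c) (b \<otimes> d) \<cdot> midswap A a b c d = midswap A b a d c \<cdot> (Sym A a b \<boxtimes> Sym A c d)"
proof -
  have mid: "midswap A a b c d = (Id A a \<boxtimes> Sym A b c) \<boxtimes> Id A d"
    by (simp add: midswap_def TenA_assoc)
  have "(Sym A (a \<otimes> c) b \<boxtimes> Id A d) \<cdot> midswap A a b c d
      = ((Sym A a b \<boxtimes> Id A c) \<cdot> ((Id A a \<boxtimes> Sym A c b) \<cdot> (Id A a \<boxtimes> Sym A b c))) \<boxtimes> Id A d"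
    by (simp add: mid TenA_TenA_Cmp Sym_Ten_left Cmp_Cmp)
  also have "\<dots> = Sym A a b \<boxtimes> (Id A c \<boxtimes> Id A d)"
    by (simp add: TenA_TenA_Cmp TenA_Id TenA_assoc)
  finally have 1: "(Sym A (a \<otimes> c) b \<boxtimes> Id A d) \<cdot> midswap A a b c d = Sym A a b \<boxtimes> Id A (c \<otimes> d)"
    by (simp add: TenA_Id)
  have "Id A b \<boxtimes> Sym A (a \<otimes> c) d = midswap A b a d c \<cdot> ((Id A b \<boxtimes> Id A a) \<boxtimes> Sym A c d)"
    by (simp add: Sym_Ten_left midswap_def TenA_TenA_Cmp TenA_assoc)
  then have 2: "Id A b \<boxtimes> Sym A (a \<otimes> c) d = midswap A b a d c \<cdot> (Id A (b \<otimes> a) \<boxtimes> Sym A c d)"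
    by (simp add: TenA_Id)
  have "Sym A (a \<otimes> c) (b \<otimes> d) \<cdot> midswap A a b c d
      = (Id A b \<boxtimes> Sym A (a \<otimes> c) d) \<cdot> (Sym A (a \<otimes> c) b \<boxtimes> Id A d) \<cdot> midswap A a b c d"
    by (subst Sym_Ten_right) (simp_all add: Cmp_Cmp)
  also have "\<dots> = midswap A b a d c \<cdot> (Id A (b \<otimes> a) \<boxtimes> Sym A c d) \<cdot> (Sym A a b \<boxtimes> Id A (c \<otimes> d))"
    unfolding 1 2 by (simp add: Cmp_Cmp)
  also have "\<dots> = midswap A b a d c \<cdot> (Sym A a b \<boxtimes> Sym A c d)"
    by (simp add: TenA_TenA_Cmp)
  finally show ?thesis .
qed

text \<open>\<open>Sym_midswap\<close> with the interchanges carried to the other sides, an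
  interchange being inverted by another interchange. It yields the symmetry condition for the
  structure morphism of a sum.\<close>

lemma midswap_Sym_Ten:
  assumes [simp]: "a \<in> Ob A" "b \<in> Ob A" "c \<in> Ob A" "d \<in> Ob A"
  shows "midswap A c d a b \<cdot> Sym A (a \<otimes> b) (c \<otimes> d) = (Sym A a c \<boxtimes> Sym A b d) \<cdot> midswap A a b c d"
proof -
  have "midswap A c d a b \<cdot> Sym A (a \<otimes> b) (c \<otimes> d)
      = midswap A c d a b \<cdot> (Sym A (a \<otimes> b) (c \<otimes> d) \<cdot> midswap A a c b d) \<cdot> midswap A a b c d"
    by (simp add: Cmp_Cmp)
  also have "\<dots> = (midswap A c d a b \<cdot> midswap A c a d b) \<cdot> (Sym A a c \<boxtimes> Sym A b d) \<cdot> midswap A a b c d"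
    by (simp add: Sym_midswap Cmp_Cmp del: midswap_inv)
  finally show ?thesis
    by simp
qed

lemma TenA_Cmp_Id:
  "f \<in> Ar A \<Longrightarrow> g \<in> Ar A \<Longrightarrow> Cod A f = Dom A g \<Longrightarrow> x \<in> Ob A \<Longrightarrow>
    Id A x \<boxtimes> (g \<cdot> f) = (Id A x \<boxtimes> g) \<cdot> (Id A x \<boxtimes> f)"
  "f \<in> Ar A \<Longrightarrow> g \<in> Ar A \<Longrightarrow> Cod A f = Dom A g \<Longrightarrow> x \<in> Ob A \<Longrightarrow>
    (g \<cdot> f) \<boxtimes> Id A x = (g \<boxtimes> Id A x) \<cdot> (f \<boxtimes> Id A x)"
  "f \<in> Ar A \<Longrightarrow> g \<in> Ar A \<Longrightarrow> Cod A f = Dom A g \<Longrightarrow> x \<in> Ob A \<Longrightarrow> y \<in> Ob A \<Longrightarrow>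
    (g \<cdot> f) \<boxtimes> Id A x \<boxtimes> Id A y = (g \<boxtimes> Id A x \<boxtimes> Id A y) \<cdot> (f \<boxtimes> Id A x \<boxtimes> Id A y)"
  by (simp_all add: TenA_TenA_Cmp)

text \<open>Rewriting to a normal form: a composite, bracketed to the right, of symmetries of single
  summands tensored with identities of single objects.\<close>

lemmas whisker = midswap_def Id_Ten TenA_assoc TenA_Cmp_Id Cmp_Cmp Sym_Ten_left Sym_Ten_right

text \<open>In the next two lemmas both sides expand into the same three whiskered symmetries, up to one
  application of the interchange law.\<close>

lemma midswap_Ten:
  assumes [simp]: "a \<in> Ob A" "b \<in> Ob A" "a' \<in> Ob A" "b' \<in> Ob A" "a'' \<in> Ob A" "b'' \<in> Ob A"
  shows "midswap A (a \<otimes> a') (b \<otimes> b') a'' b'' \<cdot> (midswap A a b a' b' \<boxtimes> Id A (a'' \<otimes> b''))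
    = midswap A a b (a' \<otimes> a'') (b' \<otimes> b'') \<cdot> (Id A (a \<otimes> b) \<boxtimes> midswap A a' b' a'' b'')"
  using TenA_exchange[of "Id A a \<boxtimes> Sym A b a'" "Sym A b' a'' \<boxtimes> Id A b''"]
  by (simp add: whisker)

lemma midswap_assoc:
  assumes [simp]: "a \<in> Ob A" "b \<in> Ob A" "c \<in> Ob A" "a' \<in> Ob A" "b' \<in> Ob A" "c' \<in> Ob A"
  shows "(midswap A a b a' b' \<boxtimes> Id A (c \<otimes> c')) \<cdot> midswap A (a \<otimes> b) c (a' \<otimes> b') c'
    = (Id A (a \<otimes> a') \<boxtimes> midswap A b c b' c') \<cdot> midswap A a (b \<otimes> c) a' (b' \<otimes> c')"
proof -
  \<comment> \<open>Both sides first swap \<open>c\<close> past \<open>a'\<close>, which is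
    \<open>?k\<close>. Then \<open>c\<close> passes \<open>b'\<close> and \<open>b\<close> passes
    \<open>a'\<close>, in opposite orders on the two sides; these swaps touch disjoint summands and
    commute.\<close>
  let ?p = "Sym A c b' \<boxtimes> Id A c'" and ?q = "Id A a \<boxtimes> Sym A b a'"
    and ?k = "Id A (a \<otimes> b) \<boxtimes> Sym A c a' \<boxtimes> Id A (b' \<otimes> c')"
  have "((Id A (Cod A ?q) \<boxtimes> ?p) \<cdot> (?q \<boxtimes> Id A (Dom A ?p))) \<cdot> ?k
      = ((?q \<boxtimes> Id A (Cod A ?p)) \<cdot> (Id A (Dom A ?q) \<boxtimes> ?p)) \<cdot> ?k"
    by (subst TenA_exchange) simp_all
  then show ?thesis
    by (simp add: whisker)
qed

end

section \<open>Lax symmetric monoidal functors and monoidal transformations\<close>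

lemma fun_sum_simps:
  "FunO (fun_sum B f g) a = FunO f a \<otimes>\<^bsub>B\<^esub> FunO g a"
  "FunA (fun_sum B f g) \<phi> = FunA f \<phi> \<boxtimes>\<^bsub>B\<^esub> FunA g \<phi>"
  "FunD (fun_sum B f g) a a' = (FunD f a a' \<boxtimes>\<^bsub>B\<^esub> FunD g a a')
    \<cdot>\<^bsub>B\<^esub> midswap B (FunO f a) (FunO g a) (FunO f a') (FunO g a')"
  by (simp_all add: fun_sum_def midswap_def)

locale permutative_pair = A: permutative_category A + B: permutative_category B
  for A B :: "('o, 'm) topmoncat"
begin

lemma lax_functor_simps [simp]:
  assumes "lax_functor A B f"
  shows "a \<in> Ob A \<Longrightarrow> FunO f a \<in> Ob B"
    "\<phi> \<in> Ar A \<Longrightarrow> FunA f \<phi> \<in> Ar B"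
    "\<phi> \<in> Ar A \<Longrightarrow> Dom B (FunA f \<phi>) = FunO f (Dom A \<phi>)"
    "\<phi> \<in> Ar A \<Longrightarrow> Cod B (FunA f \<phi>) = FunO f (Cod A \<phi>)"
    "a \<in> Ob A \<Longrightarrow> FunA f (Id A a) = Id B (FunO f a)"
    "\<phi> \<in> Ar A \<Longrightarrow> \<psi> \<in> Ar A \<Longrightarrow> Cod A \<phi> = Dom A \<psi> \<Longrightarrow>
      FunA f (\<psi> \<cdot>\<^bsub>A\<^esub> \<phi>) = FunA f \<psi> \<cdot>\<^bsub>B\<^esub> FunA f \<phi>"
    "FunO f (Unit A) = Unit B"
    "a \<in> Ob A \<Longrightarrow> a' \<in> Ob A \<Longrightarrow> FunD f a a' \<in> Ar B"
    "a \<in> Ob A \<Longrightarrow> a' \<in> Ob A \<Longrightarrow> Dom B (FunD f a a') = FunO f a \<otimes>\<^bsub>B\<^esub> FunO f a'"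
    "a \<in> Ob A \<Longrightarrow> a' \<in> Ob A \<Longrightarrow> Cod B (FunD f a a') = FunO f (a \<otimes>\<^bsub>A\<^esub> a')"
    "a \<in> Ob A \<Longrightarrow> FunD f (Unit A) a = Id B (FunO f a)"
    "a \<in> Ob A \<Longrightarrow> FunD f a (Unit A) = Id B (FunO f a)"
proof -
  interpret f: lax_functor A B f by fact
  show "a \<in> Ob A \<Longrightarrow> FunO f a \<in> Ob B"
    by (rule f.functor_Ob)
  show "\<phi> \<in> Ar A \<Longrightarrow> FunA f \<phi> \<in> Ar B" "\<phi> \<in> Ar A \<Longrightarrow> Dom B (FunA f \<phi>) = FunO f (Dom A \<phi>)"
    "\<phi> \<in> Ar A \<Longrightarrow> Cod B (FunA f \<phi>) = FunO f (Cod A \<phi>)"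
    using f.functor_Hom[of "Dom A \<phi>" "Cod A \<phi>" \<phi>] by (auto simp: A.Hom_iff B.Hom_iff)
  show "a \<in> Ob A \<Longrightarrow> FunA f (Id A a) = Id B (FunO f a)"
    by (rule f.functor_Id)
  show "\<phi> \<in> Ar A \<Longrightarrow> \<psi> \<in> Ar A \<Longrightarrow> Cod A \<phi> = Dom A \<psi> \<Longrightarrow>
      FunA f (\<psi> \<cdot>\<^bsub>A\<^esub> \<phi>) = FunA f \<psi> \<cdot>\<^bsub>B\<^esub> FunA f \<phi>"
    using f.functor_Cmp[of \<phi> "Dom A \<phi>" "Dom A \<psi>" \<psi> "Cod A \<psi>"] by (simp add: A.Hom_iff)
  show "FunO f (Unit A) = Unit B"
    by (rule f.FunO_Unit)
  show "a \<in> Ob A \<Longrightarrow> a' \<in> Ob A \<Longrightarrow> FunD f a a' \<in> Ar B"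
    "a \<in> Ob A \<Longrightarrow> a' \<in> Ob A \<Longrightarrow> Dom B (FunD f a a') = FunO f a \<otimes>\<^bsub>B\<^esub> FunO f a'"
    "a \<in> Ob A \<Longrightarrow> a' \<in> Ob A \<Longrightarrow> Cod B (FunD f a a') = FunO f (a \<otimes>\<^bsub>A\<^esub> a')"
    using f.FunD_Hom[of a a'] by (auto simp: B.Hom_iff)
  show "a \<in> Ob A \<Longrightarrow> FunD f (Unit A) a = Id B (FunO f a)"
    "a \<in> Ob A \<Longrightarrow> FunD f a (Unit A) = Id B (FunO f a)"
    using f.FunD_Unit[of a "Unit A"] f.FunD_Unit[of "Unit A" a] by simp_all
qed

lemma lax_functor_laws:
  assumes "lax_functor A B f"
  shows FunD_nat: "\<phi> \<in> Ar A \<Longrightarrow> \<phi>' \<in> Ar A \<Longrightarrow>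
      FunA f (\<phi> \<boxtimes>\<^bsub>A\<^esub> \<phi>') \<cdot>\<^bsub>B\<^esub> FunD f (Dom A \<phi>) (Dom A \<phi>')
        = FunD f (Cod A \<phi>) (Cod A \<phi>') \<cdot>\<^bsub>B\<^esub> (FunA f \<phi> \<boxtimes>\<^bsub>B\<^esub> FunA f \<phi>')"
    and FunD_Ten: "a \<in> Ob A \<Longrightarrow> a' \<in> Ob A \<Longrightarrow> a'' \<in> Ob A \<Longrightarrow>
      FunD f a (a' \<otimes>\<^bsub>A\<^esub> a'') \<cdot>\<^bsub>B\<^esub> (Id B (FunO f a) \<boxtimes>\<^bsub>B\<^esub> FunD f a' a'')
        = FunD f (a \<otimes>\<^bsub>A\<^esub> a') a'' \<cdot>\<^bsub>B\<^esub> (FunD f a a' \<boxtimes>\<^bsub>B\<^esub> Id B (FunO f a''))"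
    and FunA_Sym: "a \<in> Ob A \<Longrightarrow> a' \<in> Ob A \<Longrightarrow>
      FunA f (Sym A a a') \<cdot>\<^bsub>B\<^esub> FunD f a a' = FunD f a' a \<cdot>\<^bsub>B\<^esub> Sym B (FunO f a) (FunO f a')"
    and FunA_continuous: "a \<in> Ob A \<Longrightarrow> a' \<in> Ob A \<Longrightarrow>
      continuous_map (HomT A a a') (HomT B (FunO f a) (FunO f a')) (FunA f)"
proof -
  interpret f: lax_functor A B f by fact
  show "\<phi> \<in> Ar A \<Longrightarrow> \<phi>' \<in> Ar A \<Longrightarrow>
      FunA f (\<phi> \<boxtimes>\<^bsub>A\<^esub> \<phi>') \<cdot>\<^bsub>B\<^esub> FunD f (Dom A \<phi>) (Dom A \<phi>')
        = FunD f (Cod A \<phi>) (Cod A \<phi>') \<cdot>\<^bsub>B\<^esub> (FunA f \<phi> \<boxtimes>\<^bsub>B\<^esub> FunA f \<phi>')"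
    by (rule f.FunD_natural) (simp_all add: A.Hom_iff)
qed (rule lax_functor.FunD_assoc[OF assms] lax_functor.FunD_Sym[OF assms]
      lax_functor.FunA_continuous[OF assms]; assumption)+

lemma lax_functorI:
  assumes ob: "\<And>a. a \<in> Ob A \<Longrightarrow> FunO f a \<in> Ob B"
    and ar: "\<And>\<phi>. \<phi> \<in> Ar A \<Longrightarrow> FunA f \<phi> \<in> Ar B"
      "\<And>\<phi>. \<phi> \<in> Ar A \<Longrightarrow> Dom B (FunA f \<phi>) = FunO f (Dom A \<phi>)"
      "\<And>\<phi>. \<phi> \<in> Ar A \<Longrightarrow> Cod B (FunA f \<phi>) = FunO f (Cod A \<phi>)"
    and Id: "\<And>a. a \<in> Ob A \<Longrightarrow> FunA f (Id A a) = Id B (FunO f a)"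
    and Cmp: "\<And>\<phi> \<psi>. \<phi> \<in> Ar A \<Longrightarrow> \<psi> \<in> Ar A \<Longrightarrow> Cod A \<phi> = Dom A \<psi> \<Longrightarrow>
      FunA f (\<psi> \<cdot>\<^bsub>A\<^esub> \<phi>) = FunA f \<psi> \<cdot>\<^bsub>B\<^esub> FunA f \<phi>"
    and cont: "\<And>a a'. a \<in> Ob A \<Longrightarrow> a' \<in> Ob A \<Longrightarrow>
      continuous_map (HomT A a a') (HomT B (FunO f a) (FunO f a')) (FunA f)"
    and unit: "FunO f (Unit A) = Unit B"
    and D: "\<And>a a'. a \<in> Ob A \<Longrightarrow> a' \<in> Ob A \<Longrightarrow> FunD f a a' \<in> Ar B"
      "\<And>a a'. a \<in> Ob A \<Longrightarrow> a' \<in> Ob A \<Longrightarrow> Dom B (FunD f a a') = FunO f a \<otimes>\<^bsub>B\<^esub> FunO f a'"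
      "\<And>a a'. a \<in> Ob A \<Longrightarrow> a' \<in> Ob A \<Longrightarrow> Cod B (FunD f a a') = FunO f (a \<otimes>\<^bsub>A\<^esub> a')"
    and D_unit: "\<And>a. a \<in> Ob A \<Longrightarrow> FunD f (Unit A) a = Id B (FunO f a)"
      "\<And>a. a \<in> Ob A \<Longrightarrow> FunD f a (Unit A) = Id B (FunO f a)"
    and D_nat: "\<And>\<phi> \<phi>'. \<phi> \<in> Ar A \<Longrightarrow> \<phi>' \<in> Ar A \<Longrightarrow>
      FunA f (\<phi> \<boxtimes>\<^bsub>A\<^esub> \<phi>') \<cdot>\<^bsub>B\<^esub> FunD f (Dom A \<phi>) (Dom A \<phi>')
        = FunD f (Cod A \<phi>) (Cod A \<phi>') \<cdot>\<^bsub>B\<^esub> (FunA f \<phi> \<boxtimes>\<^bsub>B\<^esub> FunA f \<phi>')"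
    and D_assoc: "\<And>a a' a''. a \<in> Ob A \<Longrightarrow> a' \<in> Ob A \<Longrightarrow> a'' \<in> Ob A \<Longrightarrow>
      FunD f a (a' \<otimes>\<^bsub>A\<^esub> a'') \<cdot>\<^bsub>B\<^esub> (Id B (FunO f a) \<boxtimes>\<^bsub>B\<^esub> FunD f a' a'')
        = FunD f (a \<otimes>\<^bsub>A\<^esub> a') a'' \<cdot>\<^bsub>B\<^esub> (FunD f a a' \<boxtimes>\<^bsub>B\<^esub> Id B (FunO f a''))"
    and D_Sym: "\<And>a a'. a \<in> Ob A \<Longrightarrow> a' \<in> Ob A \<Longrightarrow>
      FunA f (Sym A a a') \<cdot>\<^bsub>B\<^esub> FunD f a a' = FunD f a' a \<cdot>\<^bsub>B\<^esub> Sym B (FunO f a) (FunO f a')"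
  shows "lax_functor A B f"
proof unfold_locales
  fix \<phi> \<phi>' a b a' b'
  assume "\<phi> \<in> Hom A a b" "\<phi>' \<in> Hom A a' b'"
  then show "FunA f (\<phi> \<boxtimes>\<^bsub>A\<^esub> \<phi>') \<cdot>\<^bsub>B\<^esub> FunD f a a' = FunD f b b' \<cdot>\<^bsub>B\<^esub> (FunA f \<phi> \<boxtimes>\<^bsub>B\<^esub> FunA f \<phi>')"
    using D_nat[of \<phi> \<phi>'] by (auto simp: A.Hom_iff)
next
  fix a a'
  assume "a \<in> Ob A" "a' \<in> Ob A" "a = Unit A \<or> a' = Unit A"
  then show "FunD f a a' = Id B (FunO f (a \<otimes>\<^bsub>A\<^esub> a'))"
    using D_unit by auto
qed ((rule D_assoc D_Sym cont ob Id unit; assumption) | (force simp: A.Hom_iff B.Hom_iff ar D intro: Cmp))+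

text \<open>Decoding the code of a functor gives back its values on the carriers only, so the
  property has to be invariant under agreement there. For continuity, the carrier in question is the
  topspace of a hom space.\<close>

lemma lax_functor_cong:
  assumes "lax_functor A B f"
    and "\<And>a. a \<in> Ob A \<Longrightarrow> FunO g a = FunO f a" "\<And>\<phi>. \<phi> \<in> Ar A \<Longrightarrow> FunA g \<phi> = FunA f \<phi>"
    and "\<And>a a'. a \<in> Ob A \<Longrightarrow> a' \<in> Ob A \<Longrightarrow> FunD g a a' = FunD f a a'"
  shows "lax_functor A B g"
proof (rule lax_functorI)
  fix a a'
  assume [simp]: "a \<in> Ob A" "a' \<in> Ob A"
  show "continuous_map (HomT A a a') (HomT B (FunO g a) (FunO g a')) (FunA g)"
    by (rule continuous_map_eq[where f = "FunA f"])
      (simp_all add: assms FunA_continuous[OF assms(1)] A.topspace_HomT A.Hom_iff)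
qed (simp_all add: assms FunD_nat[OF assms(1)] FunD_Ten[OF assms(1)] FunA_Sym[OF assms(1)])


lemma lax_functor_zero: "lax_functor A B (fun_zero B)"
  by (rule lax_functorI) (simp_all add: fun_zero_def B.topspace_HomT B.Hom_iff)

text \<open>Each law splits into the laws for \<open>f\<close> and for \<open>g\<close> once the
  interchanges are out of the way: \<open>midswap_nat\<close> serves naturality,
  \<open>midswap_Sym_Ten\<close> symmetry and \<open>midswap_Ten\<close> associativity.\<close>

lemma lax_functor_sum:
  assumes f [simp]: "lax_functor A B f" and g [simp]: "lax_functor A B g"
  shows "lax_functor A B (fun_sum B f g)"
proof (rule lax_functorI)
  fix a a'
  assume [simp]: "a \<in> Ob A" "a' \<in> Ob A"
  have "continuous_map (HomT A a a')
      (prod_topology (HomT B (FunO f a) (FunO f a')) (HomT B (FunO g a) (FunO g a')))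
      (\<lambda>\<phi>. (FunA f \<phi>, FunA g \<phi>))"
    by (intro continuous_map_pairedI FunA_continuous) simp_all
  from continuous_map_compose[OF this B.continuous_TenA]
  show "continuous_map (HomT A a a')
      (HomT B (FunO (fun_sum B f g) a) (FunO (fun_sum B f g) a')) (FunA (fun_sum B f g))"
    by (simp add: fun_sum_def o_def)
  show "FunA (fun_sum B f g) (Sym A a a') \<cdot>\<^bsub>B\<^esub> FunD (fun_sum B f g) a a'
    = FunD (fun_sum B f g) a' a \<cdot>\<^bsub>B\<^esub> Sym B (FunO (fun_sum B f g) a) (FunO (fun_sum B f g) a')"
    by (simp add: fun_sum_simps B.TenA_fuse FunA_Sym B.Cmp_Cmp B.midswap_Sym_Ten)
  fix a''
  assume [simp]: "a'' \<in> Ob A"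
  let ?D = "FunD f a (a' \<otimes>\<^bsub>A\<^esub> a'') \<boxtimes>\<^bsub>B\<^esub> FunD g a (a' \<otimes>\<^bsub>A\<^esub> a'')"
    and ?D' = "FunD f (a \<otimes>\<^bsub>A\<^esub> a') a'' \<boxtimes>\<^bsub>B\<^esub> FunD g (a \<otimes>\<^bsub>A\<^esub> a') a''"
  let ?X = "\<lambda>x y. midswap B (FunO f x) (FunO g x) (FunO f y) (FunO g y)"
  have *: "x \<boxtimes>\<^bsub>B\<^esub> (y \<cdot>\<^bsub>B\<^esub> z) = (x \<boxtimes>\<^bsub>B\<^esub> y) \<cdot>\<^bsub>B\<^esub> (Id B (Dom B x) \<boxtimes>\<^bsub>B\<^esub> z)"
    "(y \<cdot>\<^bsub>B\<^esub> z) \<boxtimes>\<^bsub>B\<^esub> x = (y \<boxtimes>\<^bsub>B\<^esub> x) \<cdot>\<^bsub>B\<^esub> (z \<boxtimes>\<^bsub>B\<^esub> Id B (Dom B x))"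
    if "x \<in> Ar B" "y \<in> Ar B" "z \<in> Ar B" "Dom B y = Cod B z" for x y z
    using that by (simp_all add: B.TenA_TenA_Cmp)
  have "FunD (fun_sum B f g) a (a' \<otimes>\<^bsub>A\<^esub> a'') \<cdot>\<^bsub>B\<^esub>
      (Id B (FunO (fun_sum B f g) a) \<boxtimes>\<^bsub>B\<^esub> FunD (fun_sum B f g) a' a'')
    = ?D \<cdot>\<^bsub>B\<^esub> (?X a (a' \<otimes>\<^bsub>A\<^esub> a'') \<cdot>\<^bsub>B\<^esub>
        ((Id B (FunO f a) \<boxtimes>\<^bsub>B\<^esub> Id B (FunO g a)) \<boxtimes>\<^bsub>B\<^esub> FunD f a' a'' \<boxtimes>\<^bsub>B\<^esub> FunD g a' a''))
      \<cdot>\<^bsub>B\<^esub> (Id B (FunO f a \<otimes>\<^bsub>B\<^esub> FunO g a) \<boxtimes>\<^bsub>B\<^esub> ?X a' a'')"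
    by (simp add: fun_sum_simps * B.Cmp_Cmp B.TenA_Id)
  also have "\<dots> = ?D \<cdot>\<^bsub>B\<^esub> (((Id B (FunO f a) \<boxtimes>\<^bsub>B\<^esub> FunD f a' a'') \<boxtimes>\<^bsub>B\<^esub> (Id B (FunO g a) \<boxtimes>\<^bsub>B\<^esub> FunD g a' a''))
      \<cdot>\<^bsub>B\<^esub> midswap B (FunO f a) (FunO g a) (FunO f a' \<otimes>\<^bsub>B\<^esub> FunO f a'') (FunO g a' \<otimes>\<^bsub>B\<^esub> FunO g a''))
      \<cdot>\<^bsub>B\<^esub> (Id B (FunO f a \<otimes>\<^bsub>B\<^esub> FunO g a) \<boxtimes>\<^bsub>B\<^esub> ?X a' a'')"
    using B.midswap_nat[of "Id B (FunO f a)" "Id B (FunO g a)" "FunD f a' a''" "FunD g a' a''"] by simp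
  also have "\<dots> = ((FunD f a (a' \<otimes>\<^bsub>A\<^esub> a'') \<cdot>\<^bsub>B\<^esub> (Id B (FunO f a) \<boxtimes>\<^bsub>B\<^esub> FunD f a' a''))
        \<boxtimes>\<^bsub>B\<^esub> (FunD g a (a' \<otimes>\<^bsub>A\<^esub> a'') \<cdot>\<^bsub>B\<^esub> (Id B (FunO g a) \<boxtimes>\<^bsub>B\<^esub> FunD g a' a'')))
      \<cdot>\<^bsub>B\<^esub> (midswap B (FunO f a) (FunO g a) (FunO f a' \<otimes>\<^bsub>B\<^esub> FunO f a'') (FunO g a' \<otimes>\<^bsub>B\<^esub> FunO g a'')
      \<cdot>\<^bsub>B\<^esub> (Id B (FunO f a \<otimes>\<^bsub>B\<^esub> FunO g a) \<boxtimes>\<^bsub>B\<^esub> ?X a' a''))"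
    by (simp add: B.Cmp_Cmp B.TenA_fuse)
  \<comment> \<open>\<open>midswap_Ten\<close> regroups the interchanges, while the associativity
    laws of \<open>f\<close> and \<open>g\<close> apply separately in the two tensor
    factors.\<close>
  also have "\<dots> = ((FunD f (a \<otimes>\<^bsub>A\<^esub> a') a'' \<cdot>\<^bsub>B\<^esub> (FunD f a a' \<boxtimes>\<^bsub>B\<^esub> Id B (FunO f a'')))
        \<boxtimes>\<^bsub>B\<^esub> (FunD g (a \<otimes>\<^bsub>A\<^esub> a') a'' \<cdot>\<^bsub>B\<^esub> (FunD g a a' \<boxtimes>\<^bsub>B\<^esub> Id B (FunO g a''))))
      \<cdot>\<^bsub>B\<^esub> (midswap B (FunO f a \<otimes>\<^bsub>B\<^esub> FunO f a') (FunO g a \<otimes>\<^bsub>B\<^esub> FunO g a') (FunO f a'') (FunO g a'')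
      \<cdot>\<^bsub>B\<^esub> (?X a a' \<boxtimes>\<^bsub>B\<^esub> Id B (FunO f a'' \<otimes>\<^bsub>B\<^esub> FunO g a'')))"
    by (simp add: B.midswap_Ten FunD_Ten)
  also have "\<dots> = ?D' \<cdot>\<^bsub>B\<^esub> (((FunD f a a' \<boxtimes>\<^bsub>B\<^esub> Id B (FunO f a'')) \<boxtimes>\<^bsub>B\<^esub> (FunD g a a' \<boxtimes>\<^bsub>B\<^esub> Id B (FunO g a'')))
      \<cdot>\<^bsub>B\<^esub> midswap B (FunO f a \<otimes>\<^bsub>B\<^esub> FunO f a') (FunO g a \<otimes>\<^bsub>B\<^esub> FunO g a') (FunO f a'') (FunO g a''))
      \<cdot>\<^bsub>B\<^esub> (?X a a' \<boxtimes>\<^bsub>B\<^esub> Id B (FunO f a'' \<otimes>\<^bsub>B\<^esub> FunO g a''))"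
    by (simp add: B.Cmp_Cmp B.TenA_fuse)
  also have "\<dots> = ?D' \<cdot>\<^bsub>B\<^esub> (?X (a \<otimes>\<^bsub>A\<^esub> a') a'' \<cdot>\<^bsub>B\<^esub>
        ((FunD f a a' \<boxtimes>\<^bsub>B\<^esub> FunD g a a') \<boxtimes>\<^bsub>B\<^esub> Id B (FunO f a'') \<boxtimes>\<^bsub>B\<^esub> Id B (FunO g a'')))
      \<cdot>\<^bsub>B\<^esub> (?X a a' \<boxtimes>\<^bsub>B\<^esub> Id B (FunO f a'' \<otimes>\<^bsub>B\<^esub> FunO g a''))"
    using B.midswap_nat[of "FunD f a a'" "FunD g a a'" "Id B (FunO f a'')" "Id B (FunO g a'')"] by simp
  also have "\<dots> = FunD (fun_sum B f g) (a \<otimes>\<^bsub>A\<^esub> a') a'' \<cdot>\<^bsub>B\<^esub>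
      (FunD (fun_sum B f g) a a' \<boxtimes>\<^bsub>B\<^esub> Id B (FunO (fun_sum B f g) a''))"
    by (simp add: fun_sum_simps * B.Cmp_Cmp B.TenA_Id)
  finally show "FunD (fun_sum B f g) a (a' \<otimes>\<^bsub>A\<^esub> a'') \<cdot>\<^bsub>B\<^esub>
      (Id B (FunO (fun_sum B f g) a) \<boxtimes>\<^bsub>B\<^esub> FunD (fun_sum B f g) a' a'')
    = FunD (fun_sum B f g) (a \<otimes>\<^bsub>A\<^esub> a') a'' \<cdot>\<^bsub>B\<^esub>
      (FunD (fun_sum B f g) a a' \<boxtimes>\<^bsub>B\<^esub> Id B (FunO (fun_sum B f g) a''))" .
next
  fix \<phi> \<phi>'
  assume [simp]: "\<phi> \<in> Ar A" "\<phi>' \<in> Ar A"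
  have "FunA (fun_sum B f g) (\<phi> \<boxtimes>\<^bsub>A\<^esub> \<phi>') \<cdot>\<^bsub>B\<^esub> FunD (fun_sum B f g) (Dom A \<phi>) (Dom A \<phi>')
      = ((FunD f (Cod A \<phi>) (Cod A \<phi>') \<boxtimes>\<^bsub>B\<^esub> FunD g (Cod A \<phi>) (Cod A \<phi>'))
        \<cdot>\<^bsub>B\<^esub> ((FunA f \<phi> \<boxtimes>\<^bsub>B\<^esub> FunA f \<phi>') \<boxtimes>\<^bsub>B\<^esub> (FunA g \<phi> \<boxtimes>\<^bsub>B\<^esub> FunA g \<phi>')))
        \<cdot>\<^bsub>B\<^esub> midswap B (FunO f (Dom A \<phi>)) (FunO g (Dom A \<phi>)) (FunO f (Dom A \<phi>')) (FunO g (Dom A \<phi>'))"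
    by (simp add: fun_sum_simps B.TenA_fuse FunD_nat)
  also have "\<dots> = (FunD f (Cod A \<phi>) (Cod A \<phi>') \<boxtimes>\<^bsub>B\<^esub> FunD g (Cod A \<phi>) (Cod A \<phi>'))
        \<cdot>\<^bsub>B\<^esub> (((FunA f \<phi> \<boxtimes>\<^bsub>B\<^esub> FunA f \<phi>') \<boxtimes>\<^bsub>B\<^esub> (FunA g \<phi> \<boxtimes>\<^bsub>B\<^esub> FunA g \<phi>'))
        \<cdot>\<^bsub>B\<^esub> midswap B (FunO f (Dom A \<phi>)) (FunO g (Dom A \<phi>)) (FunO f (Dom A \<phi>')) (FunO g (Dom A \<phi>')))"
    by (simp add: B.Cmp_Cmp)
  also have "\<dots> = FunD (fun_sum B f g) (Cod A \<phi>) (Cod A \<phi>') \<cdot>\<^bsub>B\<^esub>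
      (FunA (fun_sum B f g) \<phi> \<boxtimes>\<^bsub>B\<^esub> FunA (fun_sum B f g) \<phi>')"
    using B.midswap_nat[of "FunA f \<phi>" "FunA g \<phi>" "FunA f \<phi>'" "FunA g \<phi>'"]
    by (simp add: fun_sum_simps B.Cmp_Cmp)
  finally show "FunA (fun_sum B f g) (\<phi> \<boxtimes>\<^bsub>A\<^esub> \<phi>') \<cdot>\<^bsub>B\<^esub> FunD (fun_sum B f g) (Dom A \<phi>) (Dom A \<phi>')
      = FunD (fun_sum B f g) (Cod A \<phi>) (Cod A \<phi>') \<cdot>\<^bsub>B\<^esub>
        (FunA (fun_sum B f g) \<phi> \<boxtimes>\<^bsub>B\<^esub> FunA (fun_sum B f g) \<phi>')" .
qed (simp_all add: fun_sum_simps B.TenA_Id B.TenA_TenA_Cmp)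

text \<open>This makes the pointwise sum associative on the nose. The constraints separate from the
  interchanges, and the latter agree by \<open>midswap_assoc\<close>.\<close>

lemma FunD_fun_sum_assoc:
  assumes [simp]: "lax_functor A B f" "lax_functor A B g" "lax_functor A B h" "a \<in> Ob A" "a' \<in> Ob A"
  shows "FunD (fun_sum B (fun_sum B f g) h) a a' = FunD (fun_sum B f (fun_sum B g h)) a a'"
proof -
  let ?x = "FunO f a" and ?y = "FunO g a" and ?z = "FunO h a"
  let ?x' = "FunO f a'" and ?y' = "FunO g a'" and ?z' = "FunO h a'"
  let ?D = "FunD f a a' \<boxtimes>\<^bsub>B\<^esub> FunD g a a' \<boxtimes>\<^bsub>B\<^esub> FunD h a a'"
  have "FunD (fun_sum B (fun_sum B f g) h) a a'
      = (((FunD f a a' \<boxtimes>\<^bsub>B\<^esub> FunD g a a') \<boxtimes>\<^bsub>B\<^esub> FunD h a a')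
        \<cdot>\<^bsub>B\<^esub> (midswap B ?x ?y ?x' ?y' \<boxtimes>\<^bsub>B\<^esub> Id B (?z \<otimes>\<^bsub>B\<^esub> ?z')))
        \<cdot>\<^bsub>B\<^esub> midswap B (?x \<otimes>\<^bsub>B\<^esub> ?y) ?z (?x' \<otimes>\<^bsub>B\<^esub> ?y') ?z'"
    by (simp add: fun_sum_simps B.TenA_TenA_Cmp)
  also have "\<dots> = ?D \<cdot>\<^bsub>B\<^esub> (midswap B ?x ?y ?x' ?y' \<boxtimes>\<^bsub>B\<^esub> Id B (?z \<otimes>\<^bsub>B\<^esub> ?z'))
        \<cdot>\<^bsub>B\<^esub> midswap B (?x \<otimes>\<^bsub>B\<^esub> ?y) ?z (?x' \<otimes>\<^bsub>B\<^esub> ?y') ?z'"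
    by (simp add: B.Cmp_Cmp B.TenA_assoc)
  also have "\<dots> = (?D \<cdot>\<^bsub>B\<^esub> (Id B (?x \<otimes>\<^bsub>B\<^esub> ?x') \<boxtimes>\<^bsub>B\<^esub> midswap B ?y ?z ?y' ?z'))
        \<cdot>\<^bsub>B\<^esub> midswap B ?x (?y \<otimes>\<^bsub>B\<^esub> ?z) ?x' (?y' \<otimes>\<^bsub>B\<^esub> ?z')"
    by (simp add: B.midswap_assoc B.Cmp_Cmp)
  also have "\<dots> = FunD (fun_sum B f (fun_sum B g h)) a a'"
    by (simp add: fun_sum_simps B.TenA_TenA_Cmp)
  finally show ?thesis .
qed

text \<open>Associativity used three times so that the two middle summands \<open>q\<close> and
  \<open>r\<close> are combined first; only then can the symmetry condition be applied to
  them.\<close>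

lemma FunD_four:
  assumes [simp]: "lax_functor A B f" "p \<in> Ob A" "q \<in> Ob A" "r \<in> Ob A" "s \<in> Ob A"
  shows "FunD f (p \<otimes>\<^bsub>A\<^esub> q) (r \<otimes>\<^bsub>A\<^esub> s) \<cdot>\<^bsub>B\<^esub> (FunD f p q \<boxtimes>\<^bsub>B\<^esub> FunD f r s)
    = FunD f p (q \<otimes>\<^bsub>A\<^esub> r \<otimes>\<^bsub>A\<^esub> s) \<cdot>\<^bsub>B\<^esub> (Id B (FunO f p) \<boxtimes>\<^bsub>B\<^esub>
        (FunD f (q \<otimes>\<^bsub>A\<^esub> r) s \<cdot>\<^bsub>B\<^esub> (FunD f q r \<boxtimes>\<^bsub>B\<^esub> Id B (FunO f s))))"
proof -
  have "FunD f (p \<otimes>\<^bsub>A\<^esub> q) (r \<otimes>\<^bsub>A\<^esub> s) \<cdot>\<^bsub>B\<^esub> (FunD f p q \<boxtimes>\<^bsub>B\<^esub> FunD f r s)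
      = (FunD f (p \<otimes>\<^bsub>A\<^esub> q) (r \<otimes>\<^bsub>A\<^esub> s) \<cdot>\<^bsub>B\<^esub> (FunD f p q \<boxtimes>\<^bsub>B\<^esub> Id B (FunO f (r \<otimes>\<^bsub>A\<^esub> s))))
        \<cdot>\<^bsub>B\<^esub> (Id B (FunO f p \<otimes>\<^bsub>B\<^esub> FunO f q) \<boxtimes>\<^bsub>B\<^esub> FunD f r s)"
    by (simp add: B.Cmp_Cmp B.TenA_TenA_Cmp)
  also have "\<dots> = (FunD f p (q \<otimes>\<^bsub>A\<^esub> r \<otimes>\<^bsub>A\<^esub> s) \<cdot>\<^bsub>B\<^esub> (Id B (FunO f p) \<boxtimes>\<^bsub>B\<^esub> FunD f q (r \<otimes>\<^bsub>A\<^esub> s)))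
        \<cdot>\<^bsub>B\<^esub> (Id B (FunO f p) \<boxtimes>\<^bsub>B\<^esub> Id B (FunO f q) \<boxtimes>\<^bsub>B\<^esub> FunD f r s)"
    by (simp add: FunD_Ten B.Id_Ten B.TenA_assoc)
  also have "\<dots> = FunD f p (q \<otimes>\<^bsub>A\<^esub> r \<otimes>\<^bsub>A\<^esub> s) \<cdot>\<^bsub>B\<^esub> (Id B (FunO f p) \<boxtimes>\<^bsub>B\<^esub>
        (FunD f q (r \<otimes>\<^bsub>A\<^esub> s) \<cdot>\<^bsub>B\<^esub> (Id B (FunO f q) \<boxtimes>\<^bsub>B\<^esub> FunD f r s)))"
    by (simp add: B.Cmp_Cmp B.TenA_fuse)
  finally show ?thesis
    by (simp add: FunD_Ten)
qed

text \<open>The interchange moves the middle pair only. In the grouping of \<open>FunD_four\<close>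
  the symmetry condition applies to that pair, naturality carries the resulting
  \<open>FunA f\<close> outwards, and \<open>FunD_four\<close> restores the grouping in
  pairs.\<close>

lemma FunD_midswap:
  assumes [simp]: "lax_functor A B f" "p \<in> Ob A" "q \<in> Ob A" "r \<in> Ob A" "s \<in> Ob A"
  shows "FunD f (p \<otimes>\<^bsub>A\<^esub> q) (r \<otimes>\<^bsub>A\<^esub> s) \<cdot>\<^bsub>B\<^esub> (FunD f p q \<boxtimes>\<^bsub>B\<^esub> FunD f r s)
      \<cdot>\<^bsub>B\<^esub> midswap B (FunO f p) (FunO f r) (FunO f q) (FunO f s)
    = FunA f (midswap A p r q s) \<cdot>\<^bsub>B\<^esub> FunD f (p \<otimes>\<^bsub>A\<^esub> r) (q \<otimes>\<^bsub>A\<^esub> s)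
      \<cdot>\<^bsub>B\<^esub> (FunD f p r \<boxtimes>\<^bsub>B\<^esub> FunD f q s)"
proof -
  have "FunD f (p \<otimes>\<^bsub>A\<^esub> q) (r \<otimes>\<^bsub>A\<^esub> s) \<cdot>\<^bsub>B\<^esub> (FunD f p q \<boxtimes>\<^bsub>B\<^esub> FunD f r s)
      \<cdot>\<^bsub>B\<^esub> midswap B (FunO f p) (FunO f r) (FunO f q) (FunO f s)
    = (FunD f p (q \<otimes>\<^bsub>A\<^esub> r \<otimes>\<^bsub>A\<^esub> s) \<cdot>\<^bsub>B\<^esub> (Id B (FunO f p) \<boxtimes>\<^bsub>B\<^esub>
        (FunD f (q \<otimes>\<^bsub>A\<^esub> r) s \<cdot>\<^bsub>B\<^esub> (FunD f q r \<boxtimes>\<^bsub>B\<^esub> Id B (FunO f s)))))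
      \<cdot>\<^bsub>B\<^esub> midswap B (FunO f p) (FunO f r) (FunO f q) (FunO f s)"
    by (simp add: FunD_four[symmetric] B.Cmp_Cmp)
  also have "\<dots> = FunD f p (q \<otimes>\<^bsub>A\<^esub> r \<otimes>\<^bsub>A\<^esub> s) \<cdot>\<^bsub>B\<^esub> (Id B (FunO f p) \<boxtimes>\<^bsub>B\<^esub>
        (FunD f (q \<otimes>\<^bsub>A\<^esub> r) s \<cdot>\<^bsub>B\<^esub>
          ((FunD f q r \<cdot>\<^bsub>B\<^esub> Sym B (FunO f r) (FunO f q)) \<boxtimes>\<^bsub>B\<^esub> Id B (FunO f s))))"
    by (simp add: midswap_def B.Cmp_Cmp B.TenA_fuse)
  also have "\<dots> = FunD f p (q \<otimes>\<^bsub>A\<^esub> r \<otimes>\<^bsub>A\<^esub> s) \<cdot>\<^bsub>B\<^esub> (Id B (FunO f p) \<boxtimes>\<^bsub>B\<^esub>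
        ((FunD f (q \<otimes>\<^bsub>A\<^esub> r) s \<cdot>\<^bsub>B\<^esub> (FunA f (Sym A r q) \<boxtimes>\<^bsub>B\<^esub> FunA f (Id A s)))
          \<cdot>\<^bsub>B\<^esub> (FunD f r q \<boxtimes>\<^bsub>B\<^esub> Id B (FunO f s))))"
    by (simp add: B.Cmp_Cmp B.TenA_fuse FunA_Sym)
  also have "\<dots> = FunD f p (q \<otimes>\<^bsub>A\<^esub> r \<otimes>\<^bsub>A\<^esub> s) \<cdot>\<^bsub>B\<^esub> (Id B (FunO f p) \<boxtimes>\<^bsub>B\<^esub>
        ((FunA f (Sym A r q \<boxtimes>\<^bsub>A\<^esub> Id A s) \<cdot>\<^bsub>B\<^esub> FunD f (r \<otimes>\<^bsub>A\<^esub> q) s)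
          \<cdot>\<^bsub>B\<^esub> (FunD f r q \<boxtimes>\<^bsub>B\<^esub> Id B (FunO f s))))"
    using FunD_nat[of f "Sym A r q" "Id A s"] by simp
  also have "\<dots> = (FunD f p (q \<otimes>\<^bsub>A\<^esub> r \<otimes>\<^bsub>A\<^esub> s)
        \<cdot>\<^bsub>B\<^esub> (FunA f (Id A p) \<boxtimes>\<^bsub>B\<^esub> FunA f (Sym A r q \<boxtimes>\<^bsub>A\<^esub> Id A s)))
      \<cdot>\<^bsub>B\<^esub> (Id B (FunO f p) \<boxtimes>\<^bsub>B\<^esub> (FunD f (r \<otimes>\<^bsub>A\<^esub> q) s
          \<cdot>\<^bsub>B\<^esub> (FunD f r q \<boxtimes>\<^bsub>B\<^esub> Id B (FunO f s))))"
    by (simp add: B.Cmp_Cmp B.TenA_fuse)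
  also have "\<dots> = (FunA f (midswap A p r q s) \<cdot>\<^bsub>B\<^esub> FunD f p (r \<otimes>\<^bsub>A\<^esub> q \<otimes>\<^bsub>A\<^esub> s))
      \<cdot>\<^bsub>B\<^esub> (Id B (FunO f p) \<boxtimes>\<^bsub>B\<^esub> (FunD f (r \<otimes>\<^bsub>A\<^esub> q) s
          \<cdot>\<^bsub>B\<^esub> (FunD f r q \<boxtimes>\<^bsub>B\<^esub> Id B (FunO f s))))"
    using FunD_nat[of f "Id A p" "Sym A r q \<boxtimes>\<^bsub>A\<^esub> Id A s"] by (simp add: midswap_def)
  also have "\<dots> = FunA f (midswap A p r q s) \<cdot>\<^bsub>B\<^esub> FunD f (p \<otimes>\<^bsub>A\<^esub> r) (q \<otimes>\<^bsub>A\<^esub> s)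
      \<cdot>\<^bsub>B\<^esub> (FunD f p r \<boxtimes>\<^bsub>B\<^esub> FunD f q s)"
    by (simp add: FunD_four B.Cmp_Cmp)
  finally show ?thesis .
qed

section \<open>Monoidal transformations and their sums\<close>

lemma monoidal_nat_simps:
  assumes "monoidal_nat A B f g \<tau>"
  shows "a \<in> Ob A \<Longrightarrow> \<tau> a \<in> Ar B" "a \<in> Ob A \<Longrightarrow> Dom B (\<tau> a) = FunO f a"
    "a \<in> Ob A \<Longrightarrow> Cod B (\<tau> a) = FunO g a" "\<tau> (Unit A) = Id B (Unit B)"
  using assms by (auto simp: monoidal_nat_def B.Hom_iff)

lemma monoidal_nat_laws:
  assumes "monoidal_nat A B f g \<tau>"
  shows nat_nat: "\<phi> \<in> Ar A \<Longrightarrow> FunA g \<phi> \<cdot>\<^bsub>B\<^esub> \<tau> (Dom A \<phi>) = \<tau> (Cod A \<phi>) \<cdot>\<^bsub>B\<^esub> FunA f \<phi>"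
    and nat_FunD: "a \<in> Ob A \<Longrightarrow> a' \<in> Ob A \<Longrightarrow>
      \<tau> (a \<otimes>\<^bsub>A\<^esub> a') \<cdot>\<^bsub>B\<^esub> FunD f a a' = FunD g a a' \<cdot>\<^bsub>B\<^esub> (\<tau> a \<boxtimes>\<^bsub>B\<^esub> \<tau> a')"
  using assms by (simp_all add: monoidal_nat_def A.Hom_iff)

lemma monoidal_natI:
  assumes "\<And>a. a \<in> Ob A \<Longrightarrow> \<tau> a \<in> Ar B" "\<And>a. a \<in> Ob A \<Longrightarrow> Dom B (\<tau> a) = FunO f a"
    "\<And>a. a \<in> Ob A \<Longrightarrow> Cod B (\<tau> a) = FunO g a" "\<tau> (Unit A) = Id B (Unit B)"
    and "\<And>\<phi>. \<phi> \<in> Ar A \<Longrightarrow> FunA g \<phi> \<cdot>\<^bsub>B\<^esub> \<tau> (Dom A \<phi>) = \<tau> (Cod A \<phi>) \<cdot>\<^bsub>B\<^esub> FunA f \<phi>"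
    and "\<And>a a'. a \<in> Ob A \<Longrightarrow> a' \<in> Ob A \<Longrightarrow>
      \<tau> (a \<otimes>\<^bsub>A\<^esub> a') \<cdot>\<^bsub>B\<^esub> FunD f a a' = FunD g a a' \<cdot>\<^bsub>B\<^esub> (\<tau> a \<boxtimes>\<^bsub>B\<^esub> \<tau> a')"
  shows "monoidal_nat A B f g \<tau>"
  using assms by (auto simp: monoidal_nat_def A.Hom_iff B.Hom_iff)

text \<open>The counterpart of \<open>lax_functor_cong\<close>: it passes from sums and composites
  of functors to their decoded codes.\<close>

lemma monoidal_nat_cong:
  assumes "monoidal_nat A B f g \<tau>"
    and "\<And>a. a \<in> Ob A \<Longrightarrow> FunO f' a = FunO f a" "\<And>\<phi>. \<phi> \<in> Ar A \<Longrightarrow> FunA f' \<phi> = FunA f \<phi>"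
      "\<And>a a'. a \<in> Ob A \<Longrightarrow> a' \<in> Ob A \<Longrightarrow> FunD f' a a' = FunD f a a'"
    and "\<And>a. a \<in> Ob A \<Longrightarrow> FunO g' a = FunO g a" "\<And>\<phi>. \<phi> \<in> Ar A \<Longrightarrow> FunA g' \<phi> = FunA g \<phi>"
      "\<And>a a'. a \<in> Ob A \<Longrightarrow> a' \<in> Ob A \<Longrightarrow> FunD g' a a' = FunD g a a'"
    and "\<And>a. a \<in> Ob A \<Longrightarrow> \<sigma> a = \<tau> a"
  shows "monoidal_nat A B f' g' \<sigma>"
  by (rule monoidal_natI)
    (simp_all add: assms(2-) monoidal_nat_simps[OF assms(1)] nat_nat[OF assms(1)] nat_FunD[OF assms(1)])

lemma monoidal_nat_Id:
  assumes "lax_functor A B f"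
  shows "monoidal_nat A B f f (\<lambda>a. Id B (FunO f a))"
  using assms by (intro monoidal_natI) (simp_all add: B.TenA_Id)

lemma monoidal_nat_Cmp:
  assumes f [simp]: "lax_functor A B f" and g [simp]: "lax_functor A B g" and h [simp]: "lax_functor A B h"
    and \<tau>: "monoidal_nat A B f g \<tau>" and \<sigma>: "monoidal_nat A B g h \<sigma>"
  shows "monoidal_nat A B f h (\<lambda>a. \<sigma> a \<cdot>\<^bsub>B\<^esub> \<tau> a)"
proof (rule monoidal_natI)
  note [simp] = monoidal_nat_simps[OF \<tau>] monoidal_nat_simps[OF \<sigma>]
  fix \<phi>
  assume [simp]: "\<phi> \<in> Ar A"
  have "FunA h \<phi> \<cdot>\<^bsub>B\<^esub> \<sigma> (Dom A \<phi>) \<cdot>\<^bsub>B\<^esub> \<tau> (Dom A \<phi>) = (\<sigma> (Cod A \<phi>) \<cdot>\<^bsub>B\<^esub> FunA g \<phi>) \<cdot>\<^bsub>B\<^esub> \<tau> (Dom A \<phi>)"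
    by (simp add: nat_nat[OF \<sigma>, symmetric] B.Cmp_Cmp)
  also have "\<dots> = (\<sigma> (Cod A \<phi>) \<cdot>\<^bsub>B\<^esub> \<tau> (Cod A \<phi>)) \<cdot>\<^bsub>B\<^esub> FunA f \<phi>"
    by (simp add: nat_nat[OF \<tau>] B.Cmp_Cmp)
  finally show "FunA h \<phi> \<cdot>\<^bsub>B\<^esub> \<sigma> (Dom A \<phi>) \<cdot>\<^bsub>B\<^esub> \<tau> (Dom A \<phi>)
    = (\<sigma> (Cod A \<phi>) \<cdot>\<^bsub>B\<^esub> \<tau> (Cod A \<phi>)) \<cdot>\<^bsub>B\<^esub> FunA f \<phi>" .
next
  note [simp] = monoidal_nat_simps[OF \<tau>] monoidal_nat_simps[OF \<sigma>]
  fix a a'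
  assume [simp]: "a \<in> Ob A" "a' \<in> Ob A"
  have "(\<sigma> (a \<otimes>\<^bsub>A\<^esub> a') \<cdot>\<^bsub>B\<^esub> \<tau> (a \<otimes>\<^bsub>A\<^esub> a')) \<cdot>\<^bsub>B\<^esub> FunD f a a'
      = (\<sigma> (a \<otimes>\<^bsub>A\<^esub> a') \<cdot>\<^bsub>B\<^esub> FunD g a a') \<cdot>\<^bsub>B\<^esub> (\<tau> a \<boxtimes>\<^bsub>B\<^esub> \<tau> a')"
    by (simp add: nat_FunD[OF \<tau>] B.Cmp_Cmp)
  also have "\<dots> = FunD h a a' \<cdot>\<^bsub>B\<^esub> ((\<sigma> a \<cdot>\<^bsub>B\<^esub> \<tau> a) \<boxtimes>\<^bsub>B\<^esub> (\<sigma> a' \<cdot>\<^bsub>B\<^esub> \<tau> a'))"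
    by (simp add: nat_FunD[OF \<sigma>] B.Cmp_Cmp B.TenA_fuse)
  finally show "(\<sigma> (a \<otimes>\<^bsub>A\<^esub> a') \<cdot>\<^bsub>B\<^esub> \<tau> (a \<otimes>\<^bsub>A\<^esub> a')) \<cdot>\<^bsub>B\<^esub> FunD f a a'
    = FunD h a a' \<cdot>\<^bsub>B\<^esub> ((\<sigma> a \<cdot>\<^bsub>B\<^esub> \<tau> a) \<boxtimes>\<^bsub>B\<^esub> (\<sigma> a' \<cdot>\<^bsub>B\<^esub> \<tau> a'))" .
qed (simp_all add: monoidal_nat_simps[OF \<tau>] monoidal_nat_simps[OF \<sigma>])

lemma monoidal_nat_TenA:
  assumes [simp]: "lax_functor A B f" "lax_functor A B f'" "lax_functor A B g" "lax_functor A B g'"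
    and \<tau>: "monoidal_nat A B f f' \<tau>" and \<sigma>: "monoidal_nat A B g g' \<sigma>"
  shows "monoidal_nat A B (fun_sum B f g) (fun_sum B f' g') (\<lambda>a. \<tau> a \<boxtimes>\<^bsub>B\<^esub> \<sigma> a)"
proof (rule monoidal_natI)
  note [simp] = monoidal_nat_simps[OF \<tau>] monoidal_nat_simps[OF \<sigma>]
  fix a a'
  assume [simp]: "a \<in> Ob A" "a' \<in> Ob A"
  let ?X = "midswap B (FunO f a) (FunO g a) (FunO f a') (FunO g a')"
  have "(\<tau> (a \<otimes>\<^bsub>A\<^esub> a') \<boxtimes>\<^bsub>B\<^esub> \<sigma> (a \<otimes>\<^bsub>A\<^esub> a')) \<cdot>\<^bsub>B\<^esub> FunD (fun_sum B f g) a a'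
      = (FunD f' a a' \<boxtimes>\<^bsub>B\<^esub> FunD g' a a')
        \<cdot>\<^bsub>B\<^esub> (((\<tau> a \<boxtimes>\<^bsub>B\<^esub> \<tau> a') \<boxtimes>\<^bsub>B\<^esub> (\<sigma> a \<boxtimes>\<^bsub>B\<^esub> \<sigma> a')) \<cdot>\<^bsub>B\<^esub> ?X)"
    by (simp add: fun_sum_simps B.TenA_fuse nat_FunD[OF \<tau>] nat_FunD[OF \<sigma>])
  also have "\<dots> = FunD (fun_sum B f' g') a a' \<cdot>\<^bsub>B\<^esub> ((\<tau> a \<boxtimes>\<^bsub>B\<^esub> \<sigma> a) \<boxtimes>\<^bsub>B\<^esub> (\<tau> a' \<boxtimes>\<^bsub>B\<^esub> \<sigma> a'))"
    using B.midswap_nat[of "\<tau> a" "\<sigma> a" "\<tau> a'" "\<sigma> a'"] by (simp add: fun_sum_simps B.Cmp_Cmp)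
  finally show "(\<tau> (a \<otimes>\<^bsub>A\<^esub> a') \<boxtimes>\<^bsub>B\<^esub> \<sigma> (a \<otimes>\<^bsub>A\<^esub> a')) \<cdot>\<^bsub>B\<^esub> FunD (fun_sum B f g) a a'
    = FunD (fun_sum B f' g') a a' \<cdot>\<^bsub>B\<^esub> ((\<tau> a \<boxtimes>\<^bsub>B\<^esub> \<sigma> a) \<boxtimes>\<^bsub>B\<^esub> (\<tau> a' \<boxtimes>\<^bsub>B\<^esub> \<sigma> a'))" .
qed (simp_all add: monoidal_nat_simps[OF \<tau>] monoidal_nat_simps[OF \<sigma>] fun_sum_simps
    B.TenA_TenA_Cmp nat_nat[OF \<tau>] nat_nat[OF \<sigma>])

text \<open>The square for the structure morphisms is naturality of the symmetry pasted to
  \<open>Sym_midswap\<close>.\<close>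

lemma monoidal_nat_Sym:
  assumes [simp]: "lax_functor A B f" "lax_functor A B g"
  shows "monoidal_nat A B (fun_sum B f g) (fun_sum B g f) (\<lambda>a. Sym B (FunO f a) (FunO g a))"
proof (rule monoidal_natI)
  fix \<phi>
  assume "\<phi> \<in> Ar A"
  then show "FunA (fun_sum B g f) \<phi> \<cdot>\<^bsub>B\<^esub> Sym B (FunO f (Dom A \<phi>)) (FunO g (Dom A \<phi>))
      = Sym B (FunO f (Cod A \<phi>)) (FunO g (Cod A \<phi>)) \<cdot>\<^bsub>B\<^esub> FunA (fun_sum B f g) \<phi>"
    using B.Sym_nat[of "FunA f \<phi>" "FunA g \<phi>"] by (simp add: fun_sum_simps)
next
  fix a a'
  assume [simp]: "a \<in> Ob A" "a' \<in> Ob A"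
  let ?X = "midswap B (FunO f a) (FunO g a) (FunO f a') (FunO g a')"
  have "Sym B (FunO f (a \<otimes>\<^bsub>A\<^esub> a')) (FunO g (a \<otimes>\<^bsub>A\<^esub> a')) \<cdot>\<^bsub>B\<^esub> FunD (fun_sum B f g) a a'
      = (Sym B (FunO f (a \<otimes>\<^bsub>A\<^esub> a')) (FunO g (a \<otimes>\<^bsub>A\<^esub> a')) \<cdot>\<^bsub>B\<^esub> (FunD f a a' \<boxtimes>\<^bsub>B\<^esub> FunD g a a')) \<cdot>\<^bsub>B\<^esub> ?X"
    by (simp add: fun_sum_simps B.Cmp_Cmp)
  also have "\<dots> = (FunD g a a' \<boxtimes>\<^bsub>B\<^esub> FunD f a a')
      \<cdot>\<^bsub>B\<^esub> (Sym B (FunO f a \<otimes>\<^bsub>B\<^esub> FunO f a') (FunO g a \<otimes>\<^bsub>B\<^esub> FunO g a') \<cdot>\<^bsub>B\<^esub> ?X)"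
    using B.Sym_nat[of "FunD f a a'" "FunD g a a'"] by (simp add: B.Cmp_Cmp)
  also have "\<dots> = FunD (fun_sum B g f) a a'
      \<cdot>\<^bsub>B\<^esub> (Sym B (FunO f a) (FunO g a) \<boxtimes>\<^bsub>B\<^esub> Sym B (FunO f a') (FunO g a'))"
    by (simp add: fun_sum_simps B.Sym_midswap B.Cmp_Cmp)
  finally show "Sym B (FunO f (a \<otimes>\<^bsub>A\<^esub> a')) (FunO g (a \<otimes>\<^bsub>A\<^esub> a')) \<cdot>\<^bsub>B\<^esub> FunD (fun_sum B f g) a a'
    = FunD (fun_sum B g f) a a'
      \<cdot>\<^bsub>B\<^esub> (Sym B (FunO f a) (FunO g a) \<boxtimes>\<^bsub>B\<^esub> Sym B (FunO f a') (FunO g a'))" .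
qed (simp_all add: fun_sum_simps)

end

section \<open>Identities and composites of lax functors\<close>

lemma (in permutative_category) lax_functor_id: "lax_functor A A (fun_id A)"
proof -
  interpret AA: permutative_pair A A ..
  show ?thesis
    by (rule AA.lax_functorI) (simp_all add: fun_id_def TenA_Id)
qed

locale permutative_triple =
  A: permutative_category A + B: permutative_category B + C: permutative_category C
  for A B C :: "('o, 'm) topmoncat"

sublocale permutative_triple \<subseteq> AB: permutative_pair A B ..
sublocale permutative_triple \<subseteq> BC: permutative_pair B C ..
sublocale permutative_triple \<subseteq> AC: permutative_pair A C ..

context permutative_triple
begin

text \<open>Each law is the image under \<open>g\<close> of the law for \<open>f\<close>, pasted to
  the law for \<open>g\<close> along the naturality of its structure morphism.\<close>

lemma lax_functor_comp:
  assumes f [simp]: "lax_functor A B f" and g [simp]: "lax_functor B C g"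
  shows "lax_functor A C (fun_comp C g f)"
proof (rule AC.lax_functorI)
  fix a a'
  assume [simp]: "a \<in> Ob A" "a' \<in> Ob A"
  show "continuous_map (HomT A a a')
      (HomT C (FunO (fun_comp C g f) a) (FunO (fun_comp C g f) a')) (FunA (fun_comp C g f))"
    using continuous_map_compose[OF AB.FunA_continuous[OF f, of a a']
        BC.FunA_continuous[OF g, of "FunO f a" "FunO f a'"]]
    by (simp add: fun_comp_def o_def)
  have "FunA (fun_comp C g f) (Sym A a a') \<cdot>\<^bsub>C\<^esub> FunD (fun_comp C g f) a a'
      = FunA g (FunA f (Sym A a a') \<cdot>\<^bsub>B\<^esub> FunD f a a') \<cdot>\<^bsub>C\<^esub> FunD g (FunO f a) (FunO f a')"
    by (simp add: fun_comp_def C.Cmp_Cmp)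
  also have "\<dots> = FunA g (FunD f a' a)
      \<cdot>\<^bsub>C\<^esub> FunA g (Sym B (FunO f a) (FunO f a')) \<cdot>\<^bsub>C\<^esub> FunD g (FunO f a) (FunO f a')"
    by (simp add: AB.FunA_Sym C.Cmp_Cmp)
  also have "\<dots> = FunD (fun_comp C g f) a' a
      \<cdot>\<^bsub>C\<^esub> Sym C (FunO (fun_comp C g f) a) (FunO (fun_comp C g f) a')"
    by (simp add: fun_comp_def BC.FunA_Sym C.Cmp_Cmp)
  finally show "FunA (fun_comp C g f) (Sym A a a') \<cdot>\<^bsub>C\<^esub> FunD (fun_comp C g f) a a'
    = FunD (fun_comp C g f) a' a
      \<cdot>\<^bsub>C\<^esub> Sym C (FunO (fun_comp C g f) a) (FunO (fun_comp C g f) a')" .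
  fix a''
  assume [simp]: "a'' \<in> Ob A"
  let ?x = "FunO f a" and ?y = "FunO f a'" and ?z = "FunO f a''"
  have "FunD (fun_comp C g f) a (a' \<otimes>\<^bsub>A\<^esub> a'')
      \<cdot>\<^bsub>C\<^esub> (Id C (FunO (fun_comp C g f) a) \<boxtimes>\<^bsub>C\<^esub> FunD (fun_comp C g f) a' a'')
    = FunA g (FunD f a (a' \<otimes>\<^bsub>A\<^esub> a'')) \<cdot>\<^bsub>C\<^esub> (FunD g ?x (FunO f (a' \<otimes>\<^bsub>A\<^esub> a''))
        \<cdot>\<^bsub>C\<^esub> (FunA g (Id B ?x) \<boxtimes>\<^bsub>C\<^esub> FunA g (FunD f a' a'')))
      \<cdot>\<^bsub>C\<^esub> (Id C (FunO g ?x) \<boxtimes>\<^bsub>C\<^esub> FunD g ?y ?z)"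
    by (simp add: fun_comp_def C.Cmp_Cmp C.TenA_fuse)
  also have "\<dots> = FunA g (FunD f a (a' \<otimes>\<^bsub>A\<^esub> a'')) \<cdot>\<^bsub>C\<^esub> (FunA g (Id B ?x \<boxtimes>\<^bsub>B\<^esub> FunD f a' a'')
        \<cdot>\<^bsub>C\<^esub> FunD g ?x (?y \<otimes>\<^bsub>B\<^esub> ?z)) \<cdot>\<^bsub>C\<^esub> (Id C (FunO g ?x) \<boxtimes>\<^bsub>C\<^esub> FunD g ?y ?z)"
    using BC.FunD_nat[OF g, of "Id B ?x" "FunD f a' a''"] by simp
  also have "\<dots> = FunA g (FunD f a (a' \<otimes>\<^bsub>A\<^esub> a'') \<cdot>\<^bsub>B\<^esub> (Id B ?x \<boxtimes>\<^bsub>B\<^esub> FunD f a' a''))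
        \<cdot>\<^bsub>C\<^esub> (FunD g ?x (?y \<otimes>\<^bsub>B\<^esub> ?z) \<cdot>\<^bsub>C\<^esub> (Id C (FunO g ?x) \<boxtimes>\<^bsub>C\<^esub> FunD g ?y ?z))"
    by (simp add: C.Cmp_Cmp)
  \<comment> \<open>Both associativity laws are applied at once, by \<open>simp only\<close> because
    the standing rules would split \<open>FunA g\<close> of a composite and thereby hide the law for
    \<open>f\<close>.\<close>
  also have "\<dots> = FunA g (FunD f (a \<otimes>\<^bsub>A\<^esub> a') a'' \<cdot>\<^bsub>B\<^esub> (FunD f a a' \<boxtimes>\<^bsub>B\<^esub> Id B ?z))
        \<cdot>\<^bsub>C\<^esub> (FunD g (?x \<otimes>\<^bsub>B\<^esub> ?y) ?z \<cdot>\<^bsub>C\<^esub> (FunD g ?x ?y \<boxtimes>\<^bsub>C\<^esub> Id C (FunO g ?z)))"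
    by (simp only: AB.FunD_Ten[OF f] BC.FunD_Ten[OF g] \<open>a \<in> Ob A\<close> \<open>a' \<in> Ob A\<close> \<open>a'' \<in> Ob A\<close>
        AB.lax_functor_simps(1)[OF f])
  also have "\<dots> = FunA g (FunD f (a \<otimes>\<^bsub>A\<^esub> a') a'') \<cdot>\<^bsub>C\<^esub> (FunA g (FunD f a a' \<boxtimes>\<^bsub>B\<^esub> Id B ?z)
        \<cdot>\<^bsub>C\<^esub> FunD g (?x \<otimes>\<^bsub>B\<^esub> ?y) ?z) \<cdot>\<^bsub>C\<^esub> (FunD g ?x ?y \<boxtimes>\<^bsub>C\<^esub> Id C (FunO g ?z))"
    by (simp add: C.Cmp_Cmp)
  also have "\<dots> = FunA g (FunD f (a \<otimes>\<^bsub>A\<^esub> a') a'') \<cdot>\<^bsub>C\<^esub> (FunD g (FunO f (a \<otimes>\<^bsub>A\<^esub> a')) ?z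
        \<cdot>\<^bsub>C\<^esub> (FunA g (FunD f a a') \<boxtimes>\<^bsub>C\<^esub> FunA g (Id B ?z)))
      \<cdot>\<^bsub>C\<^esub> (FunD g ?x ?y \<boxtimes>\<^bsub>C\<^esub> Id C (FunO g ?z))"
    using BC.FunD_nat[OF g, of "FunD f a a'" "Id B ?z"] by simp
  also have "\<dots> = FunD (fun_comp C g f) (a \<otimes>\<^bsub>A\<^esub> a') a''
      \<cdot>\<^bsub>C\<^esub> (FunD (fun_comp C g f) a a' \<boxtimes>\<^bsub>C\<^esub> Id C (FunO (fun_comp C g f) a''))"
    by (simp add: fun_comp_def C.Cmp_Cmp C.TenA_fuse)
  finally show "FunD (fun_comp C g f) a (a' \<otimes>\<^bsub>A\<^esub> a'')
      \<cdot>\<^bsub>C\<^esub> (Id C (FunO (fun_comp C g f) a) \<boxtimes>\<^bsub>C\<^esub> FunD (fun_comp C g f) a' a'')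
    = FunD (fun_comp C g f) (a \<otimes>\<^bsub>A\<^esub> a') a''
      \<cdot>\<^bsub>C\<^esub> (FunD (fun_comp C g f) a a' \<boxtimes>\<^bsub>C\<^esub> Id C (FunO (fun_comp C g f) a''))" .
next
  fix \<phi> \<phi>'
  assume [simp]: "\<phi> \<in> Ar A" "\<phi>' \<in> Ar A"
  have "FunA (fun_comp C g f) (\<phi> \<boxtimes>\<^bsub>A\<^esub> \<phi>') \<cdot>\<^bsub>C\<^esub> FunD (fun_comp C g f) (Dom A \<phi>) (Dom A \<phi>')
      = FunA g (FunA f (\<phi> \<boxtimes>\<^bsub>A\<^esub> \<phi>') \<cdot>\<^bsub>B\<^esub> FunD f (Dom A \<phi>) (Dom A \<phi>'))
        \<cdot>\<^bsub>C\<^esub> FunD g (FunO f (Dom A \<phi>)) (FunO f (Dom A \<phi>'))"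
    by (simp add: fun_comp_def C.Cmp_Cmp)
  also have "\<dots> = FunA g (FunD f (Cod A \<phi>) (Cod A \<phi>')) \<cdot>\<^bsub>C\<^esub> FunA g (FunA f \<phi> \<boxtimes>\<^bsub>B\<^esub> FunA f \<phi>')
        \<cdot>\<^bsub>C\<^esub> FunD g (FunO f (Dom A \<phi>)) (FunO f (Dom A \<phi>'))"
    by (simp add: AB.FunD_nat C.Cmp_Cmp)
  also have "\<dots> = FunD (fun_comp C g f) (Cod A \<phi>) (Cod A \<phi>')
      \<cdot>\<^bsub>C\<^esub> (FunA (fun_comp C g f) \<phi> \<boxtimes>\<^bsub>C\<^esub> FunA (fun_comp C g f) \<phi>')"
    using BC.FunD_nat[OF g, of "FunA f \<phi>" "FunA f \<phi>'"] by (simp add: fun_comp_def C.Cmp_Cmp)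
  finally show "FunA (fun_comp C g f) (\<phi> \<boxtimes>\<^bsub>A\<^esub> \<phi>') \<cdot>\<^bsub>C\<^esub> FunD (fun_comp C g f) (Dom A \<phi>) (Dom A \<phi>')
    = FunD (fun_comp C g f) (Cod A \<phi>) (Cod A \<phi>')
      \<cdot>\<^bsub>C\<^esub> (FunA (fun_comp C g f) \<phi> \<boxtimes>\<^bsub>C\<^esub> FunA (fun_comp C g f) \<phi>')" .
qed (simp_all add: fun_comp_def)

text \<open>The Godement product of \<open>\<sigma>\<close> and \<open>\<tau>\<close>. Its
  monoidality pastes the two given monoidality conditions to the naturality of the structure
  morphism of \<open>g\<close> and the naturality of \<open>\<sigma>\<close> at the structure
  morphism of \<open>f'\<close>.\<close>

lemma monoidal_nat_hcomp:
  assumes [simp]: "lax_functor A B f" "lax_functor A B f'" and g [simp]: "lax_functor B C g"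
    and g' [simp]: "lax_functor B C g'"
    and \<tau>: "monoidal_nat A B f f' \<tau>" and \<sigma>: "monoidal_nat B C g g' \<sigma>"
  shows "monoidal_nat A C (fun_comp C g f) (fun_comp C g' f') (\<lambda>a. \<sigma> (FunO f' a) \<cdot>\<^bsub>C\<^esub> FunA g (\<tau> a))"
proof (rule AC.monoidal_natI)
  note [simp] = AB.monoidal_nat_simps[OF \<tau>] BC.monoidal_nat_simps[OF \<sigma>]
  fix \<phi>
  assume [simp]: "\<phi> \<in> Ar A"
  have "FunA (fun_comp C g' f') \<phi> \<cdot>\<^bsub>C\<^esub> \<sigma> (FunO f' (Dom A \<phi>)) \<cdot>\<^bsub>C\<^esub> FunA g (\<tau> (Dom A \<phi>))
      = (FunA g' (FunA f' \<phi>) \<cdot>\<^bsub>C\<^esub> \<sigma> (FunO f' (Dom A \<phi>))) \<cdot>\<^bsub>C\<^esub> FunA g (\<tau> (Dom A \<phi>))"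
    by (simp add: fun_comp_def C.Cmp_Cmp)
  also have "\<dots> = \<sigma> (FunO f' (Cod A \<phi>)) \<cdot>\<^bsub>C\<^esub> FunA g (FunA f' \<phi> \<cdot>\<^bsub>B\<^esub> \<tau> (Dom A \<phi>))"
    using BC.nat_nat[OF \<sigma>, of "FunA f' \<phi>"] by (simp add: C.Cmp_Cmp)
  also have "\<dots> = (\<sigma> (FunO f' (Cod A \<phi>)) \<cdot>\<^bsub>C\<^esub> FunA g (\<tau> (Cod A \<phi>))) \<cdot>\<^bsub>C\<^esub> FunA (fun_comp C g f) \<phi>"
    unfolding AB.nat_nat[OF \<tau> \<open>\<phi> \<in> Ar A\<close>] by (simp add: fun_comp_def C.Cmp_Cmp)
  finally show "FunA (fun_comp C g' f') \<phi> \<cdot>\<^bsub>C\<^esub> \<sigma> (FunO f' (Dom A \<phi>)) \<cdot>\<^bsub>C\<^esub> FunA g (\<tau> (Dom A \<phi>))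
    = (\<sigma> (FunO f' (Cod A \<phi>)) \<cdot>\<^bsub>C\<^esub> FunA g (\<tau> (Cod A \<phi>))) \<cdot>\<^bsub>C\<^esub> FunA (fun_comp C g f) \<phi>" .
next
  note [simp] = AB.monoidal_nat_simps[OF \<tau>] BC.monoidal_nat_simps[OF \<sigma>]
  fix a a'
  assume [simp]: "a \<in> Ob A" "a' \<in> Ob A"
  let ?s = "\<sigma> (FunO f' (a \<otimes>\<^bsub>A\<^esub> a'))" and ?D = "FunD g (FunO f a) (FunO f a')"
  have "(?s \<cdot>\<^bsub>C\<^esub> FunA g (\<tau> (a \<otimes>\<^bsub>A\<^esub> a'))) \<cdot>\<^bsub>C\<^esub> FunD (fun_comp C g f) a a'
      = ?s \<cdot>\<^bsub>C\<^esub> FunA g (\<tau> (a \<otimes>\<^bsub>A\<^esub> a') \<cdot>\<^bsub>B\<^esub> FunD f a a') \<cdot>\<^bsub>C\<^esub> ?D"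
    by (simp add: fun_comp_def C.Cmp_Cmp)
  also have "\<dots> = ?s \<cdot>\<^bsub>C\<^esub> FunA g (FunD f' a a' \<cdot>\<^bsub>B\<^esub> (\<tau> a \<boxtimes>\<^bsub>B\<^esub> \<tau> a')) \<cdot>\<^bsub>C\<^esub> ?D"
    by (simp only: AB.nat_FunD[OF \<tau> \<open>a \<in> Ob A\<close> \<open>a' \<in> Ob A\<close>])
  also have "\<dots> = (?s \<cdot>\<^bsub>C\<^esub> FunA g (FunD f' a a')) \<cdot>\<^bsub>C\<^esub> (FunA g (\<tau> a \<boxtimes>\<^bsub>B\<^esub> \<tau> a') \<cdot>\<^bsub>C\<^esub> ?D)"
    by (simp add: C.Cmp_Cmp)
  also have "\<dots> = (FunA g' (FunD f' a a') \<cdot>\<^bsub>C\<^esub> \<sigma> (FunO f' a \<otimes>\<^bsub>B\<^esub> FunO f' a'))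
      \<cdot>\<^bsub>C\<^esub> (FunD g (FunO f' a) (FunO f' a') \<cdot>\<^bsub>C\<^esub> (FunA g (\<tau> a) \<boxtimes>\<^bsub>C\<^esub> FunA g (\<tau> a')))"
    using BC.FunD_nat[OF g, of "\<tau> a" "\<tau> a'"] BC.nat_nat[OF \<sigma>, of "FunD f' a a'"] by simp
  also have "\<dots> = FunA g' (FunD f' a a') \<cdot>\<^bsub>C\<^esub> (\<sigma> (FunO f' a \<otimes>\<^bsub>B\<^esub> FunO f' a')
      \<cdot>\<^bsub>C\<^esub> FunD g (FunO f' a) (FunO f' a')) \<cdot>\<^bsub>C\<^esub> (FunA g (\<tau> a) \<boxtimes>\<^bsub>C\<^esub> FunA g (\<tau> a'))"
    by (simp add: C.Cmp_Cmp)
  also have "\<dots> = FunD (fun_comp C g' f') a a' \<cdot>\<^bsub>C\<^esub>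
      ((\<sigma> (FunO f' a) \<cdot>\<^bsub>C\<^esub> FunA g (\<tau> a)) \<boxtimes>\<^bsub>C\<^esub> (\<sigma> (FunO f' a') \<cdot>\<^bsub>C\<^esub> FunA g (\<tau> a')))"
    by (simp add: fun_comp_def BC.nat_FunD[OF \<sigma>] C.Cmp_Cmp C.TenA_fuse)
  finally show "(?s \<cdot>\<^bsub>C\<^esub> FunA g (\<tau> (a \<otimes>\<^bsub>A\<^esub> a'))) \<cdot>\<^bsub>C\<^esub> FunD (fun_comp C g f) a a'
    = FunD (fun_comp C g' f') a a' \<cdot>\<^bsub>C\<^esub>
      ((\<sigma> (FunO f' a) \<cdot>\<^bsub>C\<^esub> FunA g (\<tau> a)) \<boxtimes>\<^bsub>C\<^esub> (\<sigma> (FunO f' a') \<cdot>\<^bsub>C\<^esub> FunA g (\<tau> a')))" .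
qed (simp_all add: fun_comp_def AB.monoidal_nat_simps[OF \<tau>] BC.monoidal_nat_simps[OF \<sigma>])

text \<open>These maps are the second linearity constraint of composition. The condition on
  structure morphisms compares two ways of adding four values of \<open>g\<close>, and
  \<open>FunD_midswap\<close> settles it.\<close>

lemma monoidal_nat_FunD:
  assumes [simp]: "lax_functor A B f" "lax_functor A B f'" and g [simp]: "lax_functor B C g"
  shows "monoidal_nat A C (fun_sum C (fun_comp C g f) (fun_comp C g f')) (fun_comp C g (fun_sum B f f'))
    (\<lambda>a. FunD g (FunO f a) (FunO f' a))"
proof (rule AC.monoidal_natI)
  note [simp] = fun_sum_simps
  fix \<phi>
  assume [simp]: "\<phi> \<in> Ar A"
  show "FunA (fun_comp C g (fun_sum B f f')) \<phi> \<cdot>\<^bsub>C\<^esub> FunD g (FunO f (Dom A \<phi>)) (FunO f' (Dom A \<phi>))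
      = FunD g (FunO f (Cod A \<phi>)) (FunO f' (Cod A \<phi>))
        \<cdot>\<^bsub>C\<^esub> FunA (fun_sum C (fun_comp C g f) (fun_comp C g f')) \<phi>"
    using BC.FunD_nat[OF g, of "FunA f \<phi>" "FunA f' \<phi>"] by (simp add: fun_comp_def)
next
  note [simp] = fun_sum_simps
  fix a a'
  assume [simp]: "a \<in> Ob A" "a' \<in> Ob A"
  let ?x = "FunO f a" and ?y = "FunO f' a" and ?x' = "FunO f a'" and ?y' = "FunO f' a'"
  have "FunD g (FunO f (a \<otimes>\<^bsub>A\<^esub> a')) (FunO f' (a \<otimes>\<^bsub>A\<^esub> a'))
        \<cdot>\<^bsub>C\<^esub> FunD (fun_sum C (fun_comp C g f) (fun_comp C g f')) a a'
      = (FunD g (FunO f (a \<otimes>\<^bsub>A\<^esub> a')) (FunO f' (a \<otimes>\<^bsub>A\<^esub> a'))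
          \<cdot>\<^bsub>C\<^esub> (FunA g (FunD f a a') \<boxtimes>\<^bsub>C\<^esub> FunA g (FunD f' a a')))
        \<cdot>\<^bsub>C\<^esub> (FunD g ?x ?x' \<boxtimes>\<^bsub>C\<^esub> FunD g ?y ?y')
        \<cdot>\<^bsub>C\<^esub> midswap C (FunO g ?x) (FunO g ?y) (FunO g ?x') (FunO g ?y')"
    by (simp add: fun_comp_def C.Cmp_Cmp C.TenA_fuse)
  also have "\<dots> = (FunA g (FunD f a a' \<boxtimes>\<^bsub>B\<^esub> FunD f' a a')
          \<cdot>\<^bsub>C\<^esub> FunD g (?x \<otimes>\<^bsub>B\<^esub> ?x') (?y \<otimes>\<^bsub>B\<^esub> ?y'))
        \<cdot>\<^bsub>C\<^esub> (FunD g ?x ?x' \<boxtimes>\<^bsub>C\<^esub> FunD g ?y ?y')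
        \<cdot>\<^bsub>C\<^esub> midswap C (FunO g ?x) (FunO g ?y) (FunO g ?x') (FunO g ?y')"
    using BC.FunD_nat[OF g, of "FunD f a a'" "FunD f' a a'"] by simp
  also have "\<dots> = FunA g (FunD f a a' \<boxtimes>\<^bsub>B\<^esub> FunD f' a a') \<cdot>\<^bsub>C\<^esub> FunA g (midswap B ?x ?y ?x' ?y')
        \<cdot>\<^bsub>C\<^esub> FunD g (?x \<otimes>\<^bsub>B\<^esub> ?y) (?x' \<otimes>\<^bsub>B\<^esub> ?y')
        \<cdot>\<^bsub>C\<^esub> (FunD g ?x ?y \<boxtimes>\<^bsub>C\<^esub> FunD g ?x' ?y')"
    using BC.FunD_midswap[OF g, of ?x ?x' ?y ?y'] by (simp add: C.Cmp_Cmp)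
  also have "\<dots> = FunD (fun_comp C g (fun_sum B f f')) a a' \<cdot>\<^bsub>C\<^esub> (FunD g ?x ?y \<boxtimes>\<^bsub>C\<^esub> FunD g ?x' ?y')"
    by (simp add: fun_comp_def C.Cmp_Cmp)
  finally show "FunD g (FunO f (a \<otimes>\<^bsub>A\<^esub> a')) (FunO f' (a \<otimes>\<^bsub>A\<^esub> a'))
        \<cdot>\<^bsub>C\<^esub> FunD (fun_sum C (fun_comp C g f) (fun_comp C g f')) a a'
    = FunD (fun_comp C g (fun_sum B f f')) a a' \<cdot>\<^bsub>C\<^esub> (FunD g ?x ?y \<boxtimes>\<^bsub>C\<^esub> FunD g ?x' ?y')" .
qed (simp_all add: fun_comp_def fun_sum_simps)

end

section \<open>Coding in a universe\<close>

context universe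
begin

lemma smallI: "elts x = X \<Longrightarrow> small X"
  unfolding small_def by blast

lemma elts_set_code:
  assumes "small X"
  shows "elts (set_code X) = X"
proof -
  obtain x where "elts x = X"
    using assms by (auto simp: small_def)
  then show ?thesis
    unfolding set_code_def by (rule theI) (metis elts_inj injD \<open>elts x = X\<close>)
qed

lemma small_subset: "small X \<Longrightarrow> Y \<subseteq> X \<Longrightarrow> small Y"
  using elts_subset[of Y "set_code X"] smallI by (auto simp: elts_set_code)

lemma small_doubleton: "small {x, y}"
  using elts_pair[of x y] smallI by blast

lemma small_singleton: "small {x}"
  using small_doubleton[of x x] by simp

lemma small_Pow: "small X \<Longrightarrow> small {y. elts y \<subseteq> X}"
  using elts_Pow[of "set_code X"] smallI[of _ "{y. elts y \<subseteq> X}"] by (auto simp: elts_set_code)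

lemma small_UN:
  assumes "small X" "\<And>x. x \<in> X \<Longrightarrow> small (F x)"
  shows "small (\<Union>x\<in>X. F x)"
proof -
  obtain u where "elts u = (\<Union>x \<in> elts (set_code X). elts (set_code (F x)))"
    using elts_Union[where x = "set_code X" and t = "\<lambda>x. set_code (F x)"] by blast
  then have "elts u = (\<Union>x\<in>X. F x)"
    using assms by (simp add: elts_set_code)
  then show ?thesis
    by (rule smallI)
qed

text \<open>Replacement follows from the union axiom applied to a family of singletons.\<close>

lemma small_image: "small X \<Longrightarrow> small (f ` X)"
  using small_UN[of X "\<lambda>x. {f x}"] small_singleton by (simp add: UNION_singleton_eq_range)

lemma set_code_eq_iff: "small X \<Longrightarrow> small Y \<Longrightarrow> set_code X = set_code Y \<longleftrightarrow> X = Y"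
  by (metis elts_set_code)

text \<open>These are Kuratowski pairs; the sets in them are small, so \<open>set_code\<close> is
  injective on them.\<close>

lemma pair_eq_iff [simp]: "pair x y = pair x' y' \<longleftrightarrow> x = x' \<and> y = y'"
  unfolding pair_def
  by (auto simp: set_code_eq_iff small_doubleton small_singleton doubleton_eq_iff)

lemma proj_pair [simp]: "proj1 (pair x y) = x" "proj2 (pair x y) = y"
  by (auto simp: proj1_def proj2_def)

lemma small_pairs:
  assumes "small X" "small Y"
  shows "small {pair x y | x y. x \<in> X \<and> y \<in> Y}"
proof -
  have "{pair x y | x y. x \<in> X \<and> y \<in> Y} = (\<Union>x\<in>X. pair x ` Y)"
    by auto
  then show ?thesis
    using assms by (simp add: small_UN small_image)
qed

lemma elts_graph: "small X \<Longrightarrow> elts (graph X f) = (\<lambda>x. pair x (f x)) ` X"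
  by (simp add: graph_def elts_set_code small_image)

lemma app_graph [simp]: "small X \<Longrightarrow> x \<in> X \<Longrightarrow> app (graph X f) x = f x"
  by (auto simp: app_def elts_graph)

lemma graph_cong: "(\<And>x. x \<in> X \<Longrightarrow> f x = g x) \<Longrightarrow> graph X f = graph X g"
  unfolding graph_def by (metis (mono_tags, lifting) image_cong)

text \<open>Every such graph is a subset of the small set of all pairs, so the power set axiom
  bounds the function space.\<close>

lemma small_graphs:
  assumes "small X" "small Y"
  shows "small {graph X f | f. f \<in> X \<rightarrow> Y}"
proof (rule small_subset)
  show "small {u. elts u \<subseteq> {pair x y | x y. x \<in> X \<and> y \<in> Y}}"
    using assms by (intro small_Pow small_pairs)
  show "{graph X f | f. f \<in> X \<rightarrow> Y} \<subseteq> {u. elts u \<subseteq> {pair x y | x y. x \<in> X \<and> y \<in> Y}}"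
    using assms by (fastforce simp: elts_graph)
qed

lemma nat_code_simps [simp]:
  "nat_dom (nat_code A u v \<tau>) = u" "nat_cod (nat_code A u v \<tau>) = v"
  "small (Ob A) \<Longrightarrow> a \<in> Ob A \<Longrightarrow> nat_of (nat_code A u v \<tau>) a = \<tau> a"
  by (simp_all add: nat_code_def nat_dom_def nat_cod_def nat_of_def)

lemma nat_code_cong: "(\<And>a. a \<in> Ob A \<Longrightarrow> \<tau> a = \<sigma> a) \<Longrightarrow> nat_code A u v \<tau> = nat_code A u v \<sigma>"
  unfolding nat_code_def by (metis (mono_tags, lifting) graph_cong)

text \<open>\<open>app\<close> recovers a function only on the set over which its graph was taken,
  hence the membership conditions.\<close>

lemma fun_of_fun_code [simp]:
  assumes "small (Ob A)" "small (Ar A)"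
  shows "a \<in> Ob A \<Longrightarrow> FunO (fun_of (fun_code A f)) a = FunO f a"
    "\<phi> \<in> Ar A \<Longrightarrow> FunA (fun_of (fun_code A f)) \<phi> = FunA f \<phi>"
    "a \<in> Ob A \<Longrightarrow> a' \<in> Ob A \<Longrightarrow> FunD (fun_of (fun_code A f)) a a' = FunD f a a'"
  using assms by (simp_all add: fun_of_def fun_code_def)

lemma fun_code_cong:
  assumes "\<And>a. a \<in> Ob A \<Longrightarrow> FunO f a = FunO g a" "\<And>\<phi>. \<phi> \<in> Ar A \<Longrightarrow> FunA f \<phi> = FunA g \<phi>"
    "\<And>a a'. a \<in> Ob A \<Longrightarrow> a' \<in> Ob A \<Longrightarrow> FunD f a a' = FunD g a a'"
  shows "fun_code A f = fun_code A g"
proof -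
  have "graph (Ob A) (FunD f a) = graph (Ob A) (FunD g a)" if "a \<in> Ob A" for a
    using that assms(3) by (intro graph_cong) auto
  then show ?thesis
    unfolding fun_code_def
    using graph_cong[OF assms(1)] graph_cong[OF assms(2)]
      graph_cong[of "Ob A" "\<lambda>a. graph (Ob A) (FunD f a)" "\<lambda>a. graph (Ob A) (FunD g a)"] by auto
qed

lemma fun_code_fun_of_fun_code:
  "small (Ob A) \<Longrightarrow> small (Ar A) \<Longrightarrow> fun_code A (fun_of (fun_code A f)) = fun_code A f"
  by (rule fun_code_cong) simp_all

end

section \<open>The permutative category of lax symmetric monoidal functors\<close>

locale perm_homs = universe elts + permutative_pair A B
  for elts :: "'u \<Rightarrow> 'u set" and A B :: "'u permcat" +
  assumes small_A [simp]: "small (Ob A)" "small (Ar A)"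
    and small_B: "small (Ob B)" "small (Ar B)"
begin

abbreviation "H \<equiv> perm_hom A B"

lemma perm_hom_sel [simp]:
  "Dom H = nat_dom" "Cod H = nat_cod" "Id H = perm_id A B" "Ten H = perm_sum A B"
  "LUnit H = perm_id A B" "RUnit H = perm_id A B"
  "Assoc H u v w = perm_id A B (perm_sum A B u (perm_sum A B v w))"
  by (simp_all add: perm_hom_def Let_def)

lemma Ob_H: "Ob H = {fun_code A f | f. lax_functor A B f}"
  by (simp add: perm_hom_def Let_def)

lemma Ar_H: "Ar H = {nat_code A u v \<tau> | u v \<tau>. u \<in> Ob H \<and> v \<in> Ob H \<and>
    monoidal_nat A B (fun_of u) (fun_of v) \<tau>}"
  by (simp add: perm_hom_def Let_def)

text \<open>Replaces the existential over functors by the canonical representative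
  \<open>fun_of u\<close>. It agrees on the carriers with the functor that was coded, and by
  \<open>lax_functor_cong\<close> this is enough.\<close>

lemma mem_Ob_iff: "u \<in> Ob H \<longleftrightarrow> lax_functor A B (fun_of u) \<and> fun_code A (fun_of u) = u"
proof
  assume "u \<in> Ob H"
  then obtain f where f: "lax_functor A B f" and u: "u = fun_code A f"
    by (auto simp: Ob_H)
  have "lax_functor A B (fun_of (fun_code A f))"
    by (rule lax_functor_cong[OF f]) simp_all
  then show "lax_functor A B (fun_of u) \<and> fun_code A (fun_of u) = u"
    by (simp add: u fun_code_fun_of_fun_code)
qed (metis (mono_tags, lifting) Ob_H mem_Collect_eq)

lemma lax_functor_fun_of [simp]: "u \<in> Ob H \<Longrightarrow> lax_functor A B (fun_of u)"
  by (simp add: mem_Ob_iff)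

lemma fun_code_Ob: "lax_functor A B f \<Longrightarrow> fun_code A f \<in> Ob H"
  by (auto simp: Ob_H)

text \<open>Codes record values on the carriers only, so agreement there is equality. In this way
  the laws between objects of \<open>H\<close> hold strictly.\<close>

lemma Ob_eqI:
  assumes "u \<in> Ob H" "v \<in> Ob H"
    and "\<And>a. a \<in> Ob A \<Longrightarrow> FunO (fun_of u) a = FunO (fun_of v) a"
      "\<And>\<phi>. \<phi> \<in> Ar A \<Longrightarrow> FunA (fun_of u) \<phi> = FunA (fun_of v) \<phi>"
      "\<And>a a'. a \<in> Ob A \<Longrightarrow> a' \<in> Ob A \<Longrightarrow> FunD (fun_of u) a a' = FunD (fun_of v) a a'"
  shows "u = v"
  using assms(1,2) fun_code_cong[OF assms(3-5)] by (simp add: mem_Ob_iff)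

lemma perm_sum_Ob [simp]: "u \<in> Ob H \<Longrightarrow> v \<in> Ob H \<Longrightarrow> perm_sum A B u v \<in> Ob H"
  unfolding perm_sum_def by (intro fun_code_Ob lax_functor_sum) simp_all

lemma perm_sum_simps [simp]:
  "a \<in> Ob A \<Longrightarrow> FunO (fun_of (perm_sum A B u v)) a = FunO (fun_of u) a \<otimes>\<^bsub>B\<^esub> FunO (fun_of v) a"
  "\<phi> \<in> Ar A \<Longrightarrow> FunA (fun_of (perm_sum A B u v)) \<phi> = FunA (fun_of u) \<phi> \<boxtimes>\<^bsub>B\<^esub> FunA (fun_of v) \<phi>"
  by (simp_all add: perm_sum_def fun_sum_simps)

lemma FunD_perm_sum:
  "a \<in> Ob A \<Longrightarrow> a' \<in> Ob A \<Longrightarrow>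
    FunD (fun_of (perm_sum A B u v)) a a' = FunD (fun_sum B (fun_of u) (fun_of v)) a a'"
  by (simp add: perm_sum_def)

lemma Unit_H: "Unit H = fun_code A (fun_zero B)"
  by (simp add: perm_hom_def Let_def)

lemma Unit_H_Ob [simp]: "Unit H \<in> Ob H"
  unfolding Unit_H by (rule fun_code_Ob) (rule lax_functor_zero)

lemma Unit_H_simps [simp]:
  "a \<in> Ob A \<Longrightarrow> FunO (fun_of (Unit H)) a = Unit B"
  "\<phi> \<in> Ar A \<Longrightarrow> FunA (fun_of (Unit H)) \<phi> = Id B (Unit B)"
  "a \<in> Ob A \<Longrightarrow> a' \<in> Ob A \<Longrightarrow> FunD (fun_of (Unit H)) a a' = Id B (Unit B)"
  unfolding Unit_H by (simp_all add: fun_zero_def)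

lemma perm_sum_assoc [simp]:
  assumes [simp]: "u \<in> Ob H" "v \<in> Ob H" "w \<in> Ob H"
  shows "perm_sum A B (perm_sum A B u v) w = perm_sum A B u (perm_sum A B v w)"
proof (rule Ob_eqI)
  \<comment> \<open>One summand is itself a decoded sum. On objects of \<open>A\<close> it may be
    replaced by the uncoded sum, to which \<open>FunD_fun_sum_assoc\<close> applies.\<close>
  have *: "FunD (fun_sum B (fun_of (perm_sum A B u v)) (fun_of w)) a a'
      = FunD (fun_sum B (fun_sum B (fun_of u) (fun_of v)) (fun_of w)) a a'"
    "FunD (fun_sum B (fun_of u) (fun_of (perm_sum A B v w))) a a'
      = FunD (fun_sum B (fun_of u) (fun_sum B (fun_of v) (fun_of w))) a a'"
    if "a \<in> Ob A" "a' \<in> Ob A" for a a'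
    using that by (simp_all add: fun_sum_simps FunD_perm_sum)
  show "FunD (fun_of (perm_sum A B (perm_sum A B u v) w)) a a'
      = FunD (fun_of (perm_sum A B u (perm_sum A B v w))) a a'" if "a \<in> Ob A" "a' \<in> Ob A" for a a'
    using that by (simp add: FunD_perm_sum * FunD_fun_sum_assoc)
qed (simp_all add: B.TenA_assoc)

lemma perm_sum_Unit [simp]:
  assumes [simp]: "u \<in> Ob H"
  shows "perm_sum A B u (Unit H) = u" "perm_sum A B (Unit H) u = u"
  by (rule Ob_eqI; simp add: FunD_perm_sum fun_sum_simps)+

lemma monoidal_nat_nat_code:
  assumes "monoidal_nat A B f g \<tau>"
  shows "monoidal_nat A B f g (nat_of (nat_code A u v \<tau>))"
  by (rule monoidal_nat_cong[OF assms]) simp_all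

lemma nat_code_Ar:
  "u \<in> Ob H \<Longrightarrow> v \<in> Ob H \<Longrightarrow> monoidal_nat A B (fun_of u) (fun_of v) \<tau> \<Longrightarrow> nat_code A u v \<tau> \<in> Ar H"
  by (auto simp: Ar_H)

lemma mem_Ar_iff:
  "m \<in> Ar H \<longleftrightarrow> nat_dom m \<in> Ob H \<and> nat_cod m \<in> Ob H \<and>
    monoidal_nat A B (fun_of (nat_dom m)) (fun_of (nat_cod m)) (nat_of m) \<and>
    nat_code A (nat_dom m) (nat_cod m) (nat_of m) = m" (is "_ \<longleftrightarrow> ?R m")
proof
  assume "m \<in> Ar H"
  then obtain u v \<tau> where uv: "u \<in> Ob H" "v \<in> Ob H" and \<tau>: "monoidal_nat A B (fun_of u) (fun_of v) \<tau>"
    and m: "m = nat_code A u v \<tau>"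
    by (auto simp: Ar_H)
  have "nat_code A u v (nat_of (nat_code A u v \<tau>)) = nat_code A u v \<tau>"
    by (rule nat_code_cong) simp
  then show "?R m"
    unfolding m using uv monoidal_nat_nat_code[OF \<tau>] by simp
next
  assume "?R m"
  then show "m \<in> Ar H"
    using nat_code_Ar[of "nat_dom m" "nat_cod m" "nat_of m"] by simp
qed

lemma Ar_simps [simp]:
  assumes "m \<in> Ar H"
  shows "nat_dom m \<in> Ob H" "nat_cod m \<in> Ob H"
    "monoidal_nat A B (fun_of (nat_dom m)) (fun_of (nat_cod m)) (nat_of m)"
    "a \<in> Ob A \<Longrightarrow> nat_of m a \<in> Ar B"
    "a \<in> Ob A \<Longrightarrow> Dom B (nat_of m a) = FunO (fun_of (nat_dom m)) a"
    "a \<in> Ob A \<Longrightarrow> Cod B (nat_of m a) = FunO (fun_of (nat_cod m)) a"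
    "nat_of m (Unit A) = Id B (Unit B)"
  using assms by (auto simp: mem_Ar_iff monoidal_nat_simps)

text \<open>Reduces an equation between transformations to equations in \<open>B\<close> at the
  objects of \<open>A\<close>; the laws of \<open>H\<close> are proved through it.\<close>

lemma Ar_eqI:
  assumes "m \<in> Ar H" "n \<in> Ar H" "nat_dom m = nat_dom n" "nat_cod m = nat_cod n"
    and "\<And>a. a \<in> Ob A \<Longrightarrow> nat_of m a = nat_of n a"
  shows "m = n"
proof -
  have "m = nat_code A (nat_dom m) (nat_cod m) (nat_of m)"
    using assms(1) unfolding mem_Ar_iff by (elim conjE) (rule sym)
  also have "\<dots> = nat_code A (nat_dom n) (nat_cod n) (nat_of n)"
    unfolding assms(3,4) by (rule nat_code_cong) (rule assms(5))
  also have "\<dots> = n"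
    using assms(2) unfolding mem_Ar_iff by (elim conjE)
  finally show ?thesis .
qed

lemma perm_id_simps [simp]:
  assumes "u \<in> Ob H"
  shows "perm_id A B u \<in> Ar H" "nat_dom (perm_id A B u) = u" "nat_cod (perm_id A B u) = u"
    "a \<in> Ob A \<Longrightarrow> nat_of (perm_id A B u) a = Id B (FunO (fun_of u) a)"
  using assms nat_code_Ar[OF assms assms monoidal_nat_Id] by (simp_all add: perm_id_def)

lemma Cmp_H_simps [simp]:
  assumes [simp]: "m \<in> Ar H" "n \<in> Ar H" "nat_cod m = nat_dom n"
  shows "n \<cdot>\<^bsub>H\<^esub> m \<in> Ar H" "nat_dom (n \<cdot>\<^bsub>H\<^esub> m) = nat_dom m" "nat_cod (n \<cdot>\<^bsub>H\<^esub> m) = nat_cod n"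
    "a \<in> Ob A \<Longrightarrow> nat_of (n \<cdot>\<^bsub>H\<^esub> m) a = nat_of n a \<cdot>\<^bsub>B\<^esub> nat_of m a"
proof -
  have H: "n \<cdot>\<^bsub>H\<^esub> m = nat_code A (nat_dom m) (nat_cod n) (\<lambda>a. nat_of n a \<cdot>\<^bsub>B\<^esub> nat_of m a)"
    by (simp add: perm_hom_def Let_def)
  have "monoidal_nat A B (fun_of (nat_dom m)) (fun_of (nat_dom n)) (nat_of m)"
    using Ar_simps(3)[of m] by simp
  from nat_code_Ar[OF _ _ monoidal_nat_Cmp[OF _ _ _ this Ar_simps(3)]]
  show "n \<cdot>\<^bsub>H\<^esub> m \<in> Ar H" "nat_dom (n \<cdot>\<^bsub>H\<^esub> m) = nat_dom m" "nat_cod (n \<cdot>\<^bsub>H\<^esub> m) = nat_cod n"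
    "a \<in> Ob A \<Longrightarrow> nat_of (n \<cdot>\<^bsub>H\<^esub> m) a = nat_of n a \<cdot>\<^bsub>B\<^esub> nat_of m a"
    unfolding H by simp_all
qed

lemma TenA_H_simps [simp]:
  assumes [simp]: "m \<in> Ar H" "n \<in> Ar H"
  shows "m \<boxtimes>\<^bsub>H\<^esub> n \<in> Ar H"
    "nat_dom (m \<boxtimes>\<^bsub>H\<^esub> n) = perm_sum A B (nat_dom m) (nat_dom n)"
    "nat_cod (m \<boxtimes>\<^bsub>H\<^esub> n) = perm_sum A B (nat_cod m) (nat_cod n)"
    "a \<in> Ob A \<Longrightarrow> nat_of (m \<boxtimes>\<^bsub>H\<^esub> n) a = nat_of m a \<boxtimes>\<^bsub>B\<^esub> nat_of n a"
proof -
  have H: "m \<boxtimes>\<^bsub>H\<^esub> n = nat_code A (perm_sum A B (nat_dom m) (nat_dom n))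
      (perm_sum A B (nat_cod m) (nat_cod n)) (\<lambda>a. nat_of m a \<boxtimes>\<^bsub>B\<^esub> nat_of n a)"
    by (simp add: perm_hom_def Let_def)
  have "monoidal_nat A B (fun_of (perm_sum A B (nat_dom m) (nat_dom n)))
      (fun_of (perm_sum A B (nat_cod m) (nat_cod n))) (\<lambda>a. nat_of m a \<boxtimes>\<^bsub>B\<^esub> nat_of n a)"
    by (rule monoidal_nat_cong[OF monoidal_nat_TenA[where f = "fun_of (nat_dom m)"
            and g = "fun_of (nat_dom n)" and f' = "fun_of (nat_cod m)" and g' = "fun_of (nat_cod n)"]])
      (simp_all add: fun_sum_simps FunD_perm_sum)
  from nat_code_Ar[OF _ _ this] show "m \<boxtimes>\<^bsub>H\<^esub> n \<in> Ar H"
    "nat_dom (m \<boxtimes>\<^bsub>H\<^esub> n) = perm_sum A B (nat_dom m) (nat_dom n)"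
    "nat_cod (m \<boxtimes>\<^bsub>H\<^esub> n) = perm_sum A B (nat_cod m) (nat_cod n)"
    "a \<in> Ob A \<Longrightarrow> nat_of (m \<boxtimes>\<^bsub>H\<^esub> n) a = nat_of m a \<boxtimes>\<^bsub>B\<^esub> nat_of n a"
    unfolding H by simp_all
qed

lemma Sym_H_simps [simp]:
  assumes [simp]: "u \<in> Ob H" "v \<in> Ob H"
  shows "Sym H u v \<in> Ar H"
    "nat_dom (Sym H u v) = perm_sum A B u v" "nat_cod (Sym H u v) = perm_sum A B v u"
    "a \<in> Ob A \<Longrightarrow> nat_of (Sym H u v) a = Sym B (FunO (fun_of u) a) (FunO (fun_of v) a)"
proof -
  have H: "Sym H u v = nat_code A (perm_sum A B u v) (perm_sum A B v u)
      (\<lambda>a. Sym B (FunO (fun_of u) a) (FunO (fun_of v) a))"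
    by (simp add: perm_hom_def Let_def)
  have "monoidal_nat A B (fun_of (perm_sum A B u v)) (fun_of (perm_sum A B v u))
      (\<lambda>a. Sym B (FunO (fun_of u) a) (FunO (fun_of v) a))"
    by (rule monoidal_nat_cong[OF monoidal_nat_Sym[where f = "fun_of u" and g = "fun_of v"]])
      (simp_all add: fun_sum_simps FunD_perm_sum)
  from nat_code_Ar[OF _ _ this] show "Sym H u v \<in> Ar H"
    "nat_dom (Sym H u v) = perm_sum A B u v" "nat_cod (Sym H u v) = perm_sum A B v u"
    "a \<in> Ob A \<Longrightarrow> nat_of (Sym H u v) a = Sym B (FunO (fun_of u) a) (FunO (fun_of v) a)"
    unfolding H by simp_all
qed

lemma mem_Hom_iff: "m \<in> Hom H u v \<longleftrightarrow> m \<in> Ar H \<and> nat_dom m = u \<and> nat_cod m = v"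
  by (simp add: Hom_def)

lemma HomT_H: "HomT H u v = pullback_topology (Hom H u v) (\<lambda>m. restrict (nat_of m) (Ob A))
    (product_topology (\<lambda>a. HomT B (FunO (fun_of u) a) (FunO (fun_of v) a)) (Ob A))"
  unfolding Hom_def by (simp add: perm_hom_def Let_def)

lemma topspace_HomT_H:
  "u \<in> Ob H \<Longrightarrow> v \<in> Ob H \<Longrightarrow> topspace (HomT H u v) = Hom H u v"
  unfolding HomT_H topspace_pullback_topology
  by (auto simp: PiE_iff B.topspace_HomT B.Hom_iff mem_Hom_iff)

lemma continuous_map_nat_of:
  assumes "u \<in> Ob H" "v \<in> Ob H" and a: "a \<in> Ob A"
  shows "continuous_map (HomT H u v) (HomT B (FunO (fun_of u) a) (FunO (fun_of v) a)) (\<lambda>m. nat_of m a)"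
  using continuous_map_pullback[OF continuous_map_product_projection[OF a],
      where f = "\<lambda>m. restrict (nat_of m) (Ob A)"] a
  unfolding HomT_H by (simp add: o_def)

text \<open>The universal property of the topology induced by the components: continuity is tested
  at each object of \<open>A\<close>.\<close>

lemma continuous_map_HomT_H:
  assumes "\<And>x. x \<in> topspace X \<Longrightarrow> F x \<in> Hom H u v"
    and "\<And>a. a \<in> Ob A \<Longrightarrow>
      continuous_map X (HomT B (FunO (fun_of u) a) (FunO (fun_of v) a)) (\<lambda>x. nat_of (F x) a)"
  shows "continuous_map X (HomT H u v) F"
  unfolding HomT_H
proof (rule continuous_map_pullback')
  show "continuous_map X (product_topology (\<lambda>a. HomT B (FunO (fun_of u) a) (FunO (fun_of v) a)) (Ob A))
    ((\<lambda>m. restrict (nat_of m) (Ob A)) \<circ> F)"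
    using assms(2) by (auto simp: continuous_map_componentwise)
  show "topspace X \<subseteq> F -` Hom H u v"
    using assms(1) by auto
qed

text \<open>The axioms hold because they hold in \<open>B\<close> at each object of
  \<open>A\<close>; strictness of the sum on codes gives the identity constraints their required
  types.\<close>

lemma permutative_category_perm_hom: "permutative_category H"
proof unfold_locales
  fix u v
  assume uv: "u \<in> Ob H" "v \<in> Ob H"
  then show "topspace (HomT H u v) = Hom H u v"
    by (rule topspace_HomT_H)
  fix w
  assume w: "w \<in> Ob H"
  show "continuous_map (prod_topology (HomT H v w) (HomT H u v)) (HomT H u w) (\<lambda>(g, f). g \<cdot>\<^bsub>H\<^esub> f)"
  proof (rule continuous_map_HomT_H)
    fix a
    assume a [simp]: "a \<in> Ob A"
    have "continuous_map (prod_topology (HomT H v w) (HomT H u v))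
        (prod_topology (HomT B (FunO (fun_of v) a) (FunO (fun_of w) a))
          (HomT B (FunO (fun_of u) a) (FunO (fun_of v) a)))
        (\<lambda>(g, f). (nat_of g a, nat_of f a))"
      using uv w a by (simp add: continuous_map_prod_top continuous_map_nat_of)
    from continuous_map_compose[OF this B.continuous_Cmp]
    show "continuous_map (prod_topology (HomT H v w) (HomT H u v))
        (HomT B (FunO (fun_of u) a) (FunO (fun_of w) a)) (\<lambda>x. nat_of (case x of (g, f) \<Rightarrow> g \<cdot>\<^bsub>H\<^esub> f) a)"
      by (rule continuous_map_eq) (use uv w in \<open>auto simp: topspace_HomT_H mem_Hom_iff\<close>)
  qed (use uv w in \<open>auto simp: topspace_HomT_H mem_Hom_iff\<close>)
next
  fix u v u' v'
  assume uv: "u \<in> Ob H" "v \<in> Ob H" "u' \<in> Ob H" "v' \<in> Ob H"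
  show "continuous_map (prod_topology (HomT H u v) (HomT H u' v'))
      (HomT H (u \<otimes>\<^bsub>H\<^esub> u') (v \<otimes>\<^bsub>H\<^esub> v')) (\<lambda>(f, f'). f \<boxtimes>\<^bsub>H\<^esub> f')"
  proof (rule continuous_map_HomT_H)
    fix a
    assume a [simp]: "a \<in> Ob A"
    have "continuous_map (prod_topology (HomT H u v) (HomT H u' v'))
        (prod_topology (HomT B (FunO (fun_of u) a) (FunO (fun_of v) a))
          (HomT B (FunO (fun_of u') a) (FunO (fun_of v') a)))
        (\<lambda>(f, f'). (nat_of f a, nat_of f' a))"
      using uv a by (simp add: continuous_map_prod_top continuous_map_nat_of)
    from continuous_map_compose[OF this B.continuous_TenA]
    show "continuous_map (prod_topology (HomT H u v) (HomT H u' v'))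
        (HomT B (FunO (fun_of (u \<otimes>\<^bsub>H\<^esub> u')) a) (FunO (fun_of (v \<otimes>\<^bsub>H\<^esub> v')) a))
        (\<lambda>x. nat_of (case x of (f, f') \<Rightarrow> f \<boxtimes>\<^bsub>H\<^esub> f') a)"
      unfolding perm_hom_sel perm_sum_simps(1)[OF a]
      by (rule continuous_map_eq) (use uv in \<open>auto simp: topspace_HomT_H mem_Hom_iff\<close>)
  qed (use uv in \<open>auto simp: topspace_HomT_H mem_Hom_iff\<close>)
next
  \<comment> \<open>The three constraints are identities, and an identity is its own
    inverse.\<close>
  have *: "is_iso H (perm_id A B u)" if "u \<in> Ob H" for u
    unfolding is_iso_def is_inverse_def using that
    by (intro conjI exI[of _ "perm_id A B u"]) (simp_all add: mem_Hom_iff, (rule Ar_eqI; simp)+)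
  show "is_iso H (LUnit H u)" "is_iso H (RUnit H u)" if "u \<in> Ob H" for u
    using * that by simp_all
  show "is_iso H (Assoc H u v w)" if "u \<in> Ob H" "v \<in> Ob H" "w \<in> Ob H" for u v w
    using * that by simp
next
  fix m n u u' v v'
  assume "m \<in> Hom H u u'" "n \<in> Hom H v v'"
  then have [simp]: "m \<in> Ar H" "n \<in> Ar H" and uv: "u = nat_dom m" "u' = nat_cod m" "v = nat_dom n" "v' = nat_cod n"
    by (simp_all add: mem_Hom_iff)
  show "Sym H u' v' \<cdot>\<^bsub>H\<^esub> (m \<boxtimes>\<^bsub>H\<^esub> n) = (n \<boxtimes>\<^bsub>H\<^esub> m) \<cdot>\<^bsub>H\<^esub> Sym H u v"
    unfolding uv
  proof (rule Ar_eqI)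
    fix a
    assume "a \<in> Ob A"
    then show "nat_of (Sym H (nat_cod m) (nat_cod n) \<cdot>\<^bsub>H\<^esub> (m \<boxtimes>\<^bsub>H\<^esub> n)) a
        = nat_of ((n \<boxtimes>\<^bsub>H\<^esub> m) \<cdot>\<^bsub>H\<^esub> Sym H (nat_dom m) (nat_dom n)) a"
      using B.Sym_nat[of "nat_of m a" "nat_of n a"] by simp
  qed simp_all
\<comment> \<open>Of the remaining axioms, the equations between arrows are reduced to components in
  \<open>B\<close>, and the typing conditions are read off from domains and codomains.\<close>
qed ((clarsimp simp: mem_Hom_iff;
  rule Ar_eqI; simp add: B.Cmp_Cmp B.TenA_Id B.TenA_TenA_Cmp B.TenA_assoc B.Sym_nat B.Sym_Ten_right; fail)
  | (auto simp: mem_Hom_iff; fail))+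

text \<open>Codes are nested pairs built from graphs between small sets. \<open>S\<close> consists
  of graphs whose values are graphs, because \<open>FunD\<close> takes two objects.\<close>

lemma small_perm_hom: "small (Ob H)" "small (Ar H)"
proof -
  define P where "P = {graph (Ob A) h | h. h \<in> Ob A \<rightarrow> Ob B}"
  define Q where "Q = {graph (Ar A) h | h. h \<in> Ar A \<rightarrow> Ar B}"
  define R where "R = {graph (Ob A) h | h. h \<in> Ob A \<rightarrow> Ar B}"
  define S where "S = {graph (Ob A) h | h. h \<in> Ob A \<rightarrow> R}"
  have small: "small P" "small Q" "small R" "small S"
    unfolding P_def Q_def R_def S_def by (intro small_graphs small_A small_B)+
  have "fun_code A f \<in> {pair p t | p t. p \<in> P \<and> t \<in> {pair q s | q s. q \<in> Q \<and> s \<in> S}}"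
    if [simp]: "lax_functor A B f" for f
  proof -
    have "graph (Ob A) (FunO f) \<in> P" "graph (Ar A) (FunA f) \<in> Q"
      unfolding P_def Q_def by auto
    moreover have "(\<lambda>a. graph (Ob A) (FunD f a)) \<in> Ob A \<rightarrow> R"
      unfolding R_def by auto
    then have "graph (Ob A) (\<lambda>a. graph (Ob A) (FunD f a)) \<in> S"
      unfolding S_def by auto
    ultimately show ?thesis
      unfolding fun_code_def by blast
  qed
  then have "Ob H \<subseteq> {pair p t | p t. p \<in> P \<and> t \<in> {pair q s | q s. q \<in> Q \<and> s \<in> S}}"
    by (auto simp: Ob_H simp del: pair_eq_iff)
  then show Ob: "small (Ob H)"
    using small by (elim small_subset[rotated]) (intro small_pairs)
  have "nat_code A u v \<tau> \<in> {pair u t | u t. u \<in> Ob H \<and> t \<in> {pair v r | v r. v \<in> Ob H \<and> r \<in> R}}"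
    if "u \<in> Ob H" "v \<in> Ob H" "monoidal_nat A B (fun_of u) (fun_of v) \<tau>" for u v \<tau>
  proof -
    have "graph (Ob A) \<tau> \<in> R"
      unfolding R_def using monoidal_nat_simps(1)[OF that(3)] by auto
    then show ?thesis
      unfolding nat_code_def using that by blast
  qed
  then have "Ar H \<subseteq> {pair u t | u t. u \<in> Ob H \<and> t \<in> {pair v r | v r. v \<in> Ob H \<and> r \<in> R}}"
    by (auto simp: Ar_H simp del: pair_eq_iff)
  then show "small (Ar H)"
    using small Ob by (elim small_subset[rotated]) (intro small_pairs)
qed

end

section \<open>Bilinear functors that are strict in the first variable\<close>

lemma Nil_prod_cat [simp]: "Ob (prod_cat []) = {[]}" "Ar (prod_cat []) = {[]}"
  by (simp_all add: prod_cat_def)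

lemma mem_prod_cat [simp]:
  "x # xs \<in> Ob (prod_cat (C # Cs)) \<longleftrightarrow> x \<in> Ob C \<and> xs \<in> Ob (prod_cat Cs)"
  "f # fs \<in> Ar (prod_cat (C # Cs)) \<longleftrightarrow> f \<in> Ar C \<and> fs \<in> Ar (prod_cat Cs)"
  by (simp_all add: prod_cat_def)

lemma prod_cat_Cons_iff:
  "xs \<in> Ob (prod_cat (C # Cs)) \<longleftrightarrow> (\<exists>y ys. xs = y # ys \<and> y \<in> Ob C \<and> ys \<in> Ob (prod_cat Cs))"
  "fs \<in> Ar (prod_cat (C # Cs)) \<longleftrightarrow> (\<exists>g gs. fs = g # gs \<and> g \<in> Ar C \<and> gs \<in> Ar (prod_cat Cs))"
  by (simp_all add: prod_cat_def list_all2_Cons1)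

lemma prod_cat_simps [simp]:
  "Dom (prod_cat []) fs = []" "Cod (prod_cat []) fs = []" "Id (prod_cat []) xs = []"
  "Cmp (prod_cat []) gs fs = []"
  "Dom (prod_cat (C # Cs)) (f # fs) = Dom C f # Dom (prod_cat Cs) fs"
  "Cod (prod_cat (C # Cs)) (f # fs) = Cod C f # Cod (prod_cat Cs) fs"
  "Id (prod_cat (C # Cs)) (x # xs) = Id C x # Id (prod_cat Cs) xs"
  "Cmp (prod_cat (C # Cs)) (g # gs) (f # fs) = Cmp C g f # Cmp (prod_cat Cs) gs fs"
  by (simp_all add: prod_cat_def map_upt_Suc del: upt_Suc)

text \<open>It follows the same \<open>restrict\<close> and \<open>undefined\<close> conventions as
  \<open>perm_comp\<close>, so that composition in Perm can be recognised as an instance, as an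
  equality of records.\<close>

definition bilin :: "('o, 'm) topmoncat \<Rightarrow> ('o, 'm) topmoncat \<Rightarrow> ('o \<Rightarrow> 'o \<Rightarrow> 'o) \<Rightarrow>
    ('m \<Rightarrow> 'm \<Rightarrow> 'm) \<Rightarrow> ('o \<Rightarrow> 'o \<Rightarrow> 'o \<Rightarrow> 'm) \<Rightarrow> ('o \<Rightarrow> 'o \<Rightarrow> 'o \<Rightarrow> 'm) \<Rightarrow> ('o, 'm) mulfun" where
  "bilin P Q FO FA D0 D1 = \<lparr>
     MulO = restrict (\<lambda>xs. FO (xs ! 0) (xs ! 1)) (Ob (prod_cat [P, Q])),
     MulA = restrict (\<lambda>\<phi>s. FA (\<phi>s ! 0) (\<phi>s ! 1)) (Ar (prod_cat [P, Q])),
     MulD = (\<lambda>i xs x'.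
       if i = 0 \<and> xs \<in> Ob (prod_cat [P, Q]) \<and> x' \<in> Ob P then D0 (xs ! 0) x' (xs ! 1)
       else if i = 1 \<and> xs \<in> Ob (prod_cat [P, Q]) \<and> x' \<in> Ob Q then D1 (xs ! 0) (xs ! 1) x'
       else undefined) \<rparr>"

lemma bilin_simps [simp]:
  "x \<in> Ob P \<Longrightarrow> y \<in> Ob Q \<Longrightarrow> MulO (bilin P Q FO FA D0 D1) [x, y] = FO x y"
  "p \<in> Ar P \<Longrightarrow> q \<in> Ar Q \<Longrightarrow> MulA (bilin P Q FO FA D0 D1) [p, q] = FA p q"
  "x \<in> Ob P \<Longrightarrow> y \<in> Ob Q \<Longrightarrow> x' \<in> Ob P \<Longrightarrow> MulD (bilin P Q FO FA D0 D1) 0 [x, y] x' = D0 x x' y"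
  "x \<in> Ob P \<Longrightarrow> y \<in> Ob Q \<Longrightarrow> y' \<in> Ob Q \<Longrightarrow> MulD (bilin P Q FO FA D0 D1) (Suc 0) [x, y] y' = D1 x y y'"
  by (simp_all add: bilin_def)

text \<open>The common shape of evaluation and composition. Sums of functors are pointwise, so
  additivity in the first variable is strict and its constraint is an identity; \<open>D\<close> is
  the constraint in the second variable. Under this strictness the compatibility of the two
  constraints becomes \<open>D_Ten\<close>.\<close>

locale left_strict_bilinear =
  P: permutative_category P + Q: permutative_category Q + R: permutative_category R
  for P Q R :: "('o, 'm) topmoncat" +
  fixes FO :: "'o \<Rightarrow> 'o \<Rightarrow> 'o" and FA :: "'m \<Rightarrow> 'm \<Rightarrow> 'm" and D :: "'o \<Rightarrow> 'o \<Rightarrow> 'o \<Rightarrow> 'm"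
  assumes FO_Ob [simp]: "x \<in> Ob P \<Longrightarrow> y \<in> Ob Q \<Longrightarrow> FO x y \<in> Ob R"
    and FA_Ar [simp]: "p \<in> Ar P \<Longrightarrow> q \<in> Ar Q \<Longrightarrow> FA p q \<in> Ar R"
      "p \<in> Ar P \<Longrightarrow> q \<in> Ar Q \<Longrightarrow> Dom R (FA p q) = FO (Dom P p) (Dom Q q)"
      "p \<in> Ar P \<Longrightarrow> q \<in> Ar Q \<Longrightarrow> Cod R (FA p q) = FO (Cod P p) (Cod Q q)"
    and FA_Id [simp]: "x \<in> Ob P \<Longrightarrow> y \<in> Ob Q \<Longrightarrow> FA (Id P x) (Id Q y) = Id R (FO x y)"
    and FA_Cmp: "p \<in> Ar P \<Longrightarrow> p' \<in> Ar P \<Longrightarrow> Cod P p = Dom P p' \<Longrightarrow>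
      q \<in> Ar Q \<Longrightarrow> q' \<in> Ar Q \<Longrightarrow> Cod Q q = Dom Q q' \<Longrightarrow>
      FA (p' \<cdot>\<^bsub>P\<^esub> p) (q' \<cdot>\<^bsub>Q\<^esub> q) = FA p' q' \<cdot>\<^bsub>R\<^esub> FA p q"
    and FA_continuous: "x \<in> Ob P \<Longrightarrow> x' \<in> Ob P \<Longrightarrow> y \<in> Ob Q \<Longrightarrow> y' \<in> Ob Q \<Longrightarrow>
      continuous_map (prod_topology (HomT P x x') (HomT Q y y')) (HomT R (FO x y) (FO x' y'))
        (\<lambda>(p, q). FA p q)"
    and FO_Unit [simp]: "y \<in> Ob Q \<Longrightarrow> FO (Unit P) y = Unit R" "x \<in> Ob P \<Longrightarrow> FO x (Unit Q) = Unit R"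
    and FA_Unit [simp]: "q \<in> Ar Q \<Longrightarrow> FA (Id P (Unit P)) q = Id R (Unit R)"
      "p \<in> Ar P \<Longrightarrow> FA p (Id Q (Unit Q)) = Id R (Unit R)"
    and FO_Ten [simp]: "x \<in> Ob P \<Longrightarrow> x' \<in> Ob P \<Longrightarrow> y \<in> Ob Q \<Longrightarrow>
      FO (x \<otimes>\<^bsub>P\<^esub> x') y = FO x y \<otimes>\<^bsub>R\<^esub> FO x' y"
    and FA_TenA [simp]: "p \<in> Ar P \<Longrightarrow> p' \<in> Ar P \<Longrightarrow> q \<in> Ar Q \<Longrightarrow>
      FA (p \<boxtimes>\<^bsub>P\<^esub> p') q = FA p q \<boxtimes>\<^bsub>R\<^esub> FA p' q"
    and FA_Sym [simp]: "x \<in> Ob P \<Longrightarrow> x' \<in> Ob P \<Longrightarrow> y \<in> Ob Q \<Longrightarrow>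
      FA (Sym P x x') (Id Q y) = Sym R (FO x y) (FO x' y)"
    and D_Ar [simp]: "x \<in> Ob P \<Longrightarrow> y \<in> Ob Q \<Longrightarrow> y' \<in> Ob Q \<Longrightarrow> D x y y' \<in> Ar R"
      "x \<in> Ob P \<Longrightarrow> y \<in> Ob Q \<Longrightarrow> y' \<in> Ob Q \<Longrightarrow> Dom R (D x y y') = FO x y \<otimes>\<^bsub>R\<^esub> FO x y'"
      "x \<in> Ob P \<Longrightarrow> y \<in> Ob Q \<Longrightarrow> y' \<in> Ob Q \<Longrightarrow> Cod R (D x y y') = FO x (y \<otimes>\<^bsub>Q\<^esub> y')"
    and D_nat: "p \<in> Ar P \<Longrightarrow> q \<in> Ar Q \<Longrightarrow> q' \<in> Ar Q \<Longrightarrow>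
      FA p (q \<boxtimes>\<^bsub>Q\<^esub> q') \<cdot>\<^bsub>R\<^esub> D (Dom P p) (Dom Q q) (Dom Q q')
        = D (Cod P p) (Cod Q q) (Cod Q q') \<cdot>\<^bsub>R\<^esub> (FA p q \<boxtimes>\<^bsub>R\<^esub> FA p q')"
    and D_Unit [simp]: "y \<in> Ob Q \<Longrightarrow> y' \<in> Ob Q \<Longrightarrow> D (Unit P) y y' = Id R (Unit R)"
      "x \<in> Ob P \<Longrightarrow> y \<in> Ob Q \<Longrightarrow> D x (Unit Q) y = Id R (FO x y)"
      "x \<in> Ob P \<Longrightarrow> y \<in> Ob Q \<Longrightarrow> D x y (Unit Q) = Id R (FO x y)"
    and D_assoc: "x \<in> Ob P \<Longrightarrow> y \<in> Ob Q \<Longrightarrow> y' \<in> Ob Q \<Longrightarrow> y'' \<in> Ob Q \<Longrightarrow>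
      D x y (y' \<otimes>\<^bsub>Q\<^esub> y'') \<cdot>\<^bsub>R\<^esub> (Id R (FO x y) \<boxtimes>\<^bsub>R\<^esub> D x y' y'')
        = D x (y \<otimes>\<^bsub>Q\<^esub> y') y'' \<cdot>\<^bsub>R\<^esub> (D x y y' \<boxtimes>\<^bsub>R\<^esub> Id R (FO x y''))"
    and D_Sym: "x \<in> Ob P \<Longrightarrow> y \<in> Ob Q \<Longrightarrow> y' \<in> Ob Q \<Longrightarrow>
      FA (Id P x) (Sym Q y y') \<cdot>\<^bsub>R\<^esub> D x y y' = D x y' y \<cdot>\<^bsub>R\<^esub> Sym R (FO x y) (FO x y')"
    and D_Ten: "x \<in> Ob P \<Longrightarrow> x' \<in> Ob P \<Longrightarrow> y \<in> Ob Q \<Longrightarrow> y' \<in> Ob Q \<Longrightarrow>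
      D (x \<otimes>\<^bsub>P\<^esub> x') y y' = (D x y y' \<boxtimes>\<^bsub>R\<^esub> D x' y y')
        \<cdot>\<^bsub>R\<^esub> midswap R (FO x y) (FO x' y) (FO x y') (FO x' y')"
begin

definition bilinear :: "('o, 'm) mulfun" where
  "bilinear = bilin P Q FO FA (\<lambda>x x' y. Id R (FO x y \<otimes>\<^bsub>R\<^esub> FO x' y)) D"

lemma bilinear_simps [simp]:
  "x \<in> Ob P \<Longrightarrow> y \<in> Ob Q \<Longrightarrow> MulO bilinear [x, y] = FO x y"
  "p \<in> Ar P \<Longrightarrow> q \<in> Ar Q \<Longrightarrow> MulA bilinear [p, q] = FA p q"
  "x \<in> Ob P \<Longrightarrow> y \<in> Ob Q \<Longrightarrow> x' \<in> Ob P \<Longrightarrow> MulD bilinear 0 [x, y] x' = Id R (FO x y \<otimes>\<^bsub>R\<^esub> FO x' y)"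
  "x \<in> Ob P \<Longrightarrow> y \<in> Ob Q \<Longrightarrow> y' \<in> Ob Q \<Longrightarrow> MulD bilinear (Suc 0) [x, y] y' = D x y y'"
  by (simp_all add: bilinear_def)

lemma multilinear_bilinear: "multilinear [P, Q] R bilinear"
proof unfold_locales
  fix xs ys
  assume "xs \<in> Ob (prod_cat [P, Q])" "ys \<in> Ob (prod_cat [P, Q])"
  then obtain x y x' y' where xs: "xs = [x, y]" "ys = [x', y']"
    and [simp]: "x \<in> Ob P" "y \<in> Ob Q" "x' \<in> Ob P" "y' \<in> Ob Q"
    by (auto simp: prod_cat_Cons_iff)
  \<comment> \<open>The axiom speaks of a product indexed by numbers; its two projections carry
    continuity over from the binary product.\<close>
  let ?T = "product_topology (\<lambda>i. HomT ([P, Q] ! i) (xs ! i) (ys ! i)) {..<length [P, Q]}"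
  have "continuous_map ?T (HomT P x x') (\<lambda>\<phi>. \<phi> 0)" "continuous_map ?T (HomT Q y y') (\<lambda>\<phi>. \<phi> 1)"
    using continuous_map_product_projection[of 0 "{..<length [P, Q]}" "\<lambda>i. HomT ([P, Q] ! i) (xs ! i) (ys ! i)"]
      continuous_map_product_projection[of 1 "{..<length [P, Q]}" "\<lambda>i. HomT ([P, Q] ! i) (xs ! i) (ys ! i)"]
    by (simp_all add: xs)
  then have "continuous_map ?T (prod_topology (HomT P x x') (HomT Q y y')) (\<lambda>\<phi>. (\<phi> 0, \<phi> 1))"
    by (rule continuous_map_pairedI)
  from continuous_map_compose[OF this FA_continuous]
  have "continuous_map ?T (HomT R (FO x y) (FO x' y')) (\<lambda>\<phi>. FA (\<phi> 0) (\<phi> 1))"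
    by (simp add: o_def)
  then have "continuous_map ?T (HomT R (FO x y) (FO x' y')) (\<lambda>\<phi>. MulA bilinear (map \<phi> [0..<length [P, Q]]))"
  proof (rule continuous_map_eq)
    fix \<phi>
    assume "\<phi> \<in> topspace ?T"
    then have "\<phi> 0 \<in> Hom P x x'" "\<phi> 1 \<in> Hom Q y y'"
      by (auto simp: PiE_iff xs P.topspace_HomT Q.topspace_HomT lessThan_Suc)
    then show "FA (\<phi> 0) (\<phi> 1) = MulA bilinear (map \<phi> [0..<length [P, Q]])"
      by (simp add: P.Hom_iff Q.Hom_iff upt_rec)
  qed
  then show "continuous_map ?T (HomT R (MulO bilinear xs) (MulO bilinear ys))
      (\<lambda>\<phi>. MulA bilinear (map \<phi> [0..<length [P, Q]]))"
    by (simp add: xs)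
next
  show "MulO bilinear \<in> extensional (Ob (prod_cat [P, Q]))"
    "MulA bilinear \<in> extensional (Ar (prod_cat [P, Q]))"
    by (simp_all add: bilinear_def bilin_def)
next
  fix i xs x'
  assume "\<not> (i < length [P, Q] \<and> xs \<in> Ob (prod_cat [P, Q]) \<and> x' \<in> Ob ([P, Q] ! i))"
  then show "MulD bilinear i xs x' = undefined"
    by (auto simp: bilinear_def bilin_def)
next
  fix i \<phi>s xs ys \<phi>' x' y'
  assume i: "i < length [P, Q]" and \<phi>: "\<phi>s \<in> Hom (prod_cat [P, Q]) xs ys" and \<phi>': "\<phi>' \<in> Hom ([P, Q] ! i) x' y'"
  obtain p q where p: "\<phi>s = [p, q]" and [simp]: "p \<in> Ar P" "q \<in> Ar Q"
    and xs: "xs = [Dom P p, Dom Q q]" "ys = [Cod P p, Cod Q q]"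
    using \<phi> by (auto simp: Hom_def prod_cat_Cons_iff)
  have x': "\<phi>' \<in> Ar ([P, Q] ! i)" "x' = Dom ([P, Q] ! i) \<phi>'" "y' = Cod ([P, Q] ! i) \<phi>'"
    using \<phi>' by (auto simp: Hom_def)
  consider "i = 0" | "i = Suc 0"
    using i by force
  then show "MulA bilinear (\<phi>s[i := \<phi>s ! i \<boxtimes>\<^bsub>[P, Q] ! i\<^esub> \<phi>']) \<cdot>\<^bsub>R\<^esub> MulD bilinear i xs x'
      = MulD bilinear i ys y' \<cdot>\<^bsub>R\<^esub> (MulA bilinear \<phi>s \<boxtimes>\<^bsub>R\<^esub> MulA bilinear (\<phi>s[i := \<phi>']))"
    by cases (use x' in \<open>simp_all add: p xs D_nat\<close>)
next
  fix i j xs x' y'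
  assume i: "i < length [P, Q]" "j < length [P, Q]" "i \<noteq> j" and xs: "xs \<in> Ob (prod_cat [P, Q])"
    and x': "x' \<in> Ob ([P, Q] ! i)" "y' \<in> Ob ([P, Q] ! j)"
  obtain x y where xy: "xs = [x, y]" and [simp]: "x \<in> Ob P" "y \<in> Ob Q"
    using xs by (auto simp: prod_cat_Cons_iff)
  \<comment> \<open>In the first order the equation is \<open>D_Ten\<close>. In the second,
    \<open>D_Ten\<close> produces an interchange that cancels against the one in the axiom.\<close>
  consider "i = 0" "j = Suc 0" | "i = Suc 0" "j = 0"
    using i by force
  then show "MulD bilinear j (xs[i := xs ! i \<otimes>\<^bsub>[P, Q] ! i\<^esub> x']) y'
        \<cdot>\<^bsub>R\<^esub> (MulD bilinear i xs x' \<boxtimes>\<^bsub>R\<^esub> MulD bilinear i (xs[j := y']) x')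
      = MulD bilinear i (xs[j := xs ! j \<otimes>\<^bsub>[P, Q] ! j\<^esub> y']) x'
        \<cdot>\<^bsub>R\<^esub> (MulD bilinear j xs y' \<boxtimes>\<^bsub>R\<^esub> MulD bilinear j (xs[i := x']) y')
        \<cdot>\<^bsub>R\<^esub> (Id R (MulO bilinear xs) \<boxtimes>\<^bsub>R\<^esub> Sym R (MulO bilinear (xs[i := x'])) (MulO bilinear (xs[j := y']))
             \<boxtimes>\<^bsub>R\<^esub> Id R (MulO bilinear (xs[i := x', j := y'])))"
    by cases (use x' in \<open>simp_all add: xy D_Ten midswap_def[symmetric] R.TenA_Id R.Cmp_Cmp\<close>)
qed (auto simp: Hom_def prod_cat_Cons_iff less_Suc_eq FA_Cmp D_assoc D_Sym R.TenA_Id R.Hom_iff)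

end

section \<open>Identities, objects and composites in the multicategory\<close>

lemma mul_id_simps [simp]:
  "x \<in> Ob A \<Longrightarrow> MulO (mul_id A) [x] = x" "\<phi> \<in> Ar A \<Longrightarrow> MulA (mul_id A) [\<phi>] = \<phi>"
  "x \<in> Ob A \<Longrightarrow> x' \<in> Ob A \<Longrightarrow> MulD (mul_id A) 0 [x] x' = Id A (x \<otimes>\<^bsub>A\<^esub> x')"
  by (simp_all add: mul_id_def)

lemma mul_ob_simps [simp]: "MulO (mul_ob A a) [] = a" "MulA (mul_ob A a) [] = Id A a"
  by (simp_all add: mul_ob_def)

lemma multilinear_mul_id:
  assumes "permutative_category A"
  shows "multilinear [A] A (mul_id A)"
proof -
  interpret A: permutative_category A by fact
  show ?thesis
  proof unfold_locales
    show "MulO (mul_id A) \<in> extensional (Ob (prod_cat [A]))"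
      "MulA (mul_id A) \<in> extensional (Ar (prod_cat [A]))"
      by (simp_all add: mul_id_def)
  next
    fix xs ys
    assume "xs \<in> Ob (prod_cat [A])" "ys \<in> Ob (prod_cat [A])"
    then obtain x y where xs: "xs = [x]" "ys = [y]" and [simp]: "x \<in> Ob A" "y \<in> Ob A"
      by (auto simp: prod_cat_Cons_iff)
    let ?T = "product_topology (\<lambda>i. HomT ([A] ! i) (xs ! i) (ys ! i)) {..<length [A]}"
    have "continuous_map ?T (HomT A x y) (\<lambda>\<phi>. \<phi> 0)"
      using continuous_map_product_projection[of 0 "{..<length [A]}" "\<lambda>i. HomT ([A] ! i) (xs ! i) (ys ! i)"]
      by (simp add: xs)
    then have "continuous_map ?T (HomT A x y) (\<lambda>\<phi>. MulA (mul_id A) (map \<phi> [0..<length [A]]))"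
      by (rule continuous_map_eq) (auto simp: PiE_iff xs A.topspace_HomT lessThan_Suc A.Hom_iff)
    then show "continuous_map ?T (HomT A (MulO (mul_id A) xs) (MulO (mul_id A) ys))
        (\<lambda>\<phi>. MulA (mul_id A) (map \<phi> [0..<length [A]]))"
      by (simp add: xs)
  next
    fix i xs x'
    assume "\<not> (i < length [A] \<and> xs \<in> Ob (prod_cat [A]) \<and> x' \<in> Ob ([A] ! i))"
    then show "MulD (mul_id A) i xs x' = undefined"
      by (auto simp: mul_id_def)
  qed (auto simp: Hom_def prod_cat_Cons_iff A.TenA_Id)
qed

lemma multilinear_mul_ob:
  assumes "permutative_category B" "b \<in> Ob B"
  shows "multilinear [] B (mul_ob B b)"
proof -
  interpret B: permutative_category B by fact
  show ?thesis
    by unfold_locales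
      (use assms(2) in \<open>auto simp: Hom_def mul_ob_def prod_cat_def B.topspace_HomT extensional_def\<close>)
qed

text \<open>Both composites are \<open>undefined\<close> off their domains, so only values on the
  carriers matter. In the first variable both constraints are identities. In the second,
  \<open>f\<close> contributes \<open>fD\<close> and \<open>h\<close> is strict, which gives
  \<open>D1\<close>; in the third, the constraint of \<open>h\<close> is pushed through
  \<open>k\<close>, which gives \<open>D2\<close>.\<close>

lemma mul_comp_assoc:
  assumes f: "left_strict_bilinear P Q R fO fA fD" and g: "left_strict_bilinear R S T gO gA gD"
    and h: "left_strict_bilinear Q S U hO hA hD" and k: "left_strict_bilinear P U T kO kA kD"
    and O: "\<And>x y z. x \<in> Ob P \<Longrightarrow> y \<in> Ob Q \<Longrightarrow> z \<in> Ob S \<Longrightarrow> gO (fO x y) z = kO x (hO y z)"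
    and A: "\<And>p q s. p \<in> Ar P \<Longrightarrow> q \<in> Ar Q \<Longrightarrow> s \<in> Ar S \<Longrightarrow> gA (fA p q) s = kA p (hA q s)"
    and D1: "\<And>x y y' z. x \<in> Ob P \<Longrightarrow> y \<in> Ob Q \<Longrightarrow> y' \<in> Ob Q \<Longrightarrow> z \<in> Ob S \<Longrightarrow>
      gA (fD x y y') (Id S z) = kD x (hO y z) (hO y' z)"
    and D2: "\<And>x y z z'. x \<in> Ob P \<Longrightarrow> y \<in> Ob Q \<Longrightarrow> z \<in> Ob S \<Longrightarrow> z' \<in> Ob S \<Longrightarrow>
      gD (fO x y) z z' = kA (Id P x) (hD y z z') \<cdot>\<^bsub>T\<^esub> kD x (hO y z) (hO y z')"
  shows "mul_comp [[P, Q], [S]] [R, S] T (left_strict_bilinear.bilinear R S T gO gA gD)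
      [left_strict_bilinear.bilinear P Q R fO fA fD, mul_id S]
    = mul_comp [[P], [Q, S]] [P, U] T (left_strict_bilinear.bilinear P U T kO kA kD)
      [mul_id P, left_strict_bilinear.bilinear Q S U hO hA hD]" (is "?l = ?r")
proof -
  interpret f: left_strict_bilinear P Q R fO fA fD by (rule f)
  interpret g: left_strict_bilinear R S T gO gA gD by (rule g)
  interpret h: left_strict_bilinear Q S U hO hA hD by (rule h)
  interpret k: left_strict_bilinear P U T kO kA kD by (rule k)
  show ?thesis
  proof (rule mulfun.equality)
    show "MulO ?l = MulO ?r"
      by (auto simp: mul_comp_def prod_cat_Cons_iff O intro!: restrict_ext)
    show "MulA ?l = MulA ?r"
      by (auto simp: mul_comp_def prod_cat_Cons_iff A intro!: restrict_ext)
    have "MulD ?l p xs x' = MulD ?r p xs x'" for p xs x'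
    proof (cases "p < 3 \<and> xs \<in> Ob (prod_cat [P, Q, S]) \<and> x' \<in> Ob ([P, Q, S] ! p)")
      case True
      then obtain x y z where xs: "xs = [x, y, z]" and [simp]: "x \<in> Ob P" "y \<in> Ob Q" "z \<in> Ob S"
        by (auto simp: prod_cat_Cons_iff)
      consider "p = 0" | "p = Suc 0" | "p = Suc (Suc 0)"
        using True by force
      then show ?thesis
        by cases (use True in \<open>simp_all add: mul_comp_def xs O D1 D2 g.R.Cmp_Cmp\<close>)
    next
      case False
      then show ?thesis
        by (auto simp: mul_comp_def numeral_3_eq_3)
    qed
    then show "MulD ?l = MulD ?r"
      by (intro ext)
  qed simp
qed

text \<open>The object \<open>e\<close> fills the first variable; the constraint that remains is
  \<open>gD e\<close>, and it has to be that of the identity.\<close>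

lemma mul_comp_mul_ob_left:
  assumes "left_strict_bilinear P Q Q gO gA gD" and e: "e \<in> Ob P"
    and O: "\<And>y. y \<in> Ob Q \<Longrightarrow> gO e y = y" and A: "\<And>q. q \<in> Ar Q \<Longrightarrow> gA (Id P e) q = q"
    and D: "\<And>y y'. y \<in> Ob Q \<Longrightarrow> y' \<in> Ob Q \<Longrightarrow> gD e y y' = Id Q (y \<otimes>\<^bsub>Q\<^esub> y')"
  shows "mul_comp [[], [Q]] [P, Q] Q (left_strict_bilinear.bilinear P Q Q gO gA gD) [mul_ob P e, mul_id Q]
    = mul_id Q" (is "?l = ?r")
proof -
  interpret g: left_strict_bilinear P Q Q gO gA gD by fact
  show ?thesis
  proof (rule mulfun.equality)
    show "MulO ?l = MulO ?r"
      by (auto simp: mul_comp_def prod_cat_Cons_iff mul_id_def O e intro!: restrict_ext)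
    show "MulA ?l = MulA ?r"
      by (auto simp: mul_comp_def prod_cat_Cons_iff mul_id_def A e intro!: restrict_ext)
    have "MulD ?l p xs x' = MulD ?r p xs x'" for p xs x'
    proof (cases "p = 0 \<and> xs \<in> Ob (prod_cat [Q]) \<and> x' \<in> Ob Q")
      case True
      then obtain x where "xs = [x]" "x \<in> Ob Q"
        by (auto simp: prod_cat_Cons_iff)
      with True show ?thesis
        by (simp add: mul_comp_def O A D e)
    next
      case False
      then show ?thesis
        by (auto simp: mul_comp_def mul_id_def)
    qed
    then show "MulD ?l = MulD ?r"
      by (intro ext)
  qed simp
qed

text \<open>The surviving variable is the first one, whose constraint is already an identity, so the
  values on objects and arrows decide.\<close>

lemma mul_comp_mul_ob_right:
  assumes "left_strict_bilinear P Q P gO gA gD" and e: "e \<in> Ob Q"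
    and O: "\<And>x. x \<in> Ob P \<Longrightarrow> gO x e = x" and A: "\<And>p. p \<in> Ar P \<Longrightarrow> gA p (Id Q e) = p"
  shows "mul_comp [[P], []] [P, Q] P (left_strict_bilinear.bilinear P Q P gO gA gD) [mul_id P, mul_ob Q e]
    = mul_id P" (is "?l = ?r")
proof -
  interpret g: left_strict_bilinear P Q P gO gA gD by fact
  show ?thesis
  proof (rule mulfun.equality)
    show "MulO ?l = MulO ?r"
      by (auto simp: mul_comp_def prod_cat_Cons_iff mul_id_def O e intro!: restrict_ext)
    show "MulA ?l = MulA ?r"
      by (auto simp: mul_comp_def prod_cat_Cons_iff mul_id_def A e intro!: restrict_ext)
    have "MulD ?l p xs x' = MulD ?r p xs x'" for p xs x'
    proof (cases "p = 0 \<and> xs \<in> Ob (prod_cat [P]) \<and> x' \<in> Ob P")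
      case True
      then obtain x where "xs = [x]" "x \<in> Ob P"
        by (auto simp: prod_cat_Cons_iff)
      with True show ?thesis
        by (simp add: mul_comp_def O A e)
    next
      case False
      then show ?thesis
        by (auto simp: mul_comp_def mul_id_def)
    qed
    then show "MulD ?l = MulD ?r"
      by (intro ext)
  qed simp
qed

section \<open>Evaluation and composition of lax symmetric monoidal functors\<close>

context perm_homs
begin

definition evO :: "'u \<Rightarrow> 'u \<Rightarrow> 'u" where
  "evO u a = FunO (fun_of u) a"

text \<open>The diagonal of the naturality square of \<open>m\<close> at \<open>\<phi>\<close>,
  written along the side that the arrow part of \<open>perm_comp\<close> uses.\<close>

definition evA :: "'u \<Rightarrow> 'u \<Rightarrow> 'u" where
  "evA m \<phi> = nat_of m (Cod A \<phi>) \<cdot>\<^bsub>B\<^esub> FunA (fun_of (nat_dom m)) \<phi>"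

definition evD :: "'u \<Rightarrow> 'u \<Rightarrow> 'u \<Rightarrow> 'u" where
  "evD u a a' = FunD (fun_of u) a a'"

lemmas ev_defs = evO_def evA_def evD_def

lemma nat_of_laws:
  assumes "m \<in> Ar H"
  shows nat_of_nat: "\<phi> \<in> Ar A \<Longrightarrow>
      FunA (fun_of (nat_cod m)) \<phi> \<cdot>\<^bsub>B\<^esub> nat_of m (Dom A \<phi>) = nat_of m (Cod A \<phi>) \<cdot>\<^bsub>B\<^esub> FunA (fun_of (nat_dom m)) \<phi>"
    and nat_of_FunD: "a \<in> Ob A \<Longrightarrow> a' \<in> Ob A \<Longrightarrow>
      nat_of m (a \<otimes>\<^bsub>A\<^esub> a') \<cdot>\<^bsub>B\<^esub> FunD (fun_of (nat_dom m)) a a'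
        = FunD (fun_of (nat_cod m)) a a' \<cdot>\<^bsub>B\<^esub> (nat_of m a \<boxtimes>\<^bsub>B\<^esub> nat_of m a')"
  using nat_nat[OF Ar_simps(3)[OF assms]] nat_FunD[OF Ar_simps(3)[OF assms]] by auto

text \<open>Functoriality comes from naturality of the transformations, naturality of
  \<open>evD\<close> from their monoidality, and \<open>D_Ten\<close> from the structure morphism of
  a sum. Associativity and symmetry in the second variable are those of a lax functor.\<close>

lemma left_strict_bilinear_ev: "left_strict_bilinear H A B evO evA evD"
proof -
  interpret H: permutative_category H by (rule permutative_category_perm_hom)
  show ?thesis
  proof unfold_locales
    fix p p' q q'
    assume [simp]: "p \<in> Ar H" "p' \<in> Ar H" "q \<in> Ar A" "q' \<in> Ar A"
      and pq: "Cod H p = Dom H p'" "Cod A q = Dom A q'"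
    have [simp]: "nat_cod p = nat_dom p'" "Cod A q = Dom A q'"
      using pq by simp_all
    have "evA (p' \<cdot>\<^bsub>H\<^esub> p) (q' \<cdot>\<^bsub>A\<^esub> q) = nat_of p' (Cod A q') \<cdot>\<^bsub>B\<^esub>
        (nat_of p (Cod A q') \<cdot>\<^bsub>B\<^esub> FunA (fun_of (nat_dom p)) q') \<cdot>\<^bsub>B\<^esub> FunA (fun_of (nat_dom p)) q"
      by (simp add: ev_defs B.Cmp_Cmp)
    also have "\<dots> = nat_of p' (Cod A q') \<cdot>\<^bsub>B\<^esub>
        (FunA (fun_of (nat_cod p)) q' \<cdot>\<^bsub>B\<^esub> nat_of p (Dom A q')) \<cdot>\<^bsub>B\<^esub> FunA (fun_of (nat_dom p)) q"
      by (subst nat_of_nat) simp_all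
    also have "\<dots> = evA p' q' \<cdot>\<^bsub>B\<^esub> evA p q"
      by (simp add: ev_defs B.Cmp_Cmp)
    finally show "evA (p' \<cdot>\<^bsub>H\<^esub> p) (q' \<cdot>\<^bsub>A\<^esub> q) = evA p' q' \<cdot>\<^bsub>B\<^esub> evA p q" .
  next
    fix u v a b
    assume [simp]: "u \<in> Ob H" "v \<in> Ob H" "a \<in> Ob A" "b \<in> Ob A"
    \<comment> \<open>On these hom spaces \<open>m\<close> has domain \<open>u\<close> and
      \<open>\<phi>\<close> has codomain \<open>b\<close>, so \<open>evA\<close> is the component at
      \<open>b\<close> composed with the action of the fixed functor \<open>u\<close>.\<close>
    have "continuous_map (prod_topology (HomT H u v) (HomT A a b))
        (prod_topology (HomT B (FunO (fun_of u) b) (FunO (fun_of v) b))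
          (HomT B (FunO (fun_of u) a) (FunO (fun_of u) b)))
        (\<lambda>(m, \<phi>). (nat_of m b, FunA (fun_of u) \<phi>))"
      by (simp add: continuous_map_prod_top continuous_map_nat_of FunA_continuous)
    from continuous_map_compose[OF this B.continuous_Cmp]
    show "continuous_map (prod_topology (HomT H u v) (HomT A a b)) (HomT B (evO u a) (evO v b))
        (\<lambda>(p, q). evA p q)"
      unfolding evO_def
      by (rule continuous_map_eq) (auto simp: evA_def topspace_HomT_H A.topspace_HomT mem_Hom_iff A.Hom_iff)
  next
    fix p q q'
    assume [simp]: "p \<in> Ar H" "q \<in> Ar A" "q' \<in> Ar A"
    let ?u = "fun_of (nat_dom p)"
    have "evA p (q \<boxtimes>\<^bsub>A\<^esub> q') \<cdot>\<^bsub>B\<^esub> evD (Dom H p) (Dom A q) (Dom A q')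
        = (nat_of p (Cod A q \<otimes>\<^bsub>A\<^esub> Cod A q') \<cdot>\<^bsub>B\<^esub> FunD ?u (Cod A q) (Cod A q'))
          \<cdot>\<^bsub>B\<^esub> (FunA ?u q \<boxtimes>\<^bsub>B\<^esub> FunA ?u q')"
      by (simp add: ev_defs B.Cmp_Cmp FunD_nat)
    also have "\<dots> = evD (Cod H p) (Cod A q) (Cod A q') \<cdot>\<^bsub>B\<^esub> (evA p q \<boxtimes>\<^bsub>B\<^esub> evA p q')"
      by (simp add: ev_defs nat_of_FunD B.Cmp_Cmp B.TenA_fuse)
    finally show "evA p (q \<boxtimes>\<^bsub>A\<^esub> q') \<cdot>\<^bsub>B\<^esub> evD (Dom H p) (Dom A q) (Dom A q')
        = evD (Cod H p) (Cod A q) (Cod A q') \<cdot>\<^bsub>B\<^esub> (evA p q \<boxtimes>\<^bsub>B\<^esub> evA p q')" .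
  qed (simp_all add: ev_defs FunD_perm_sum fun_sum_simps B.TenA_TenA_Cmp FunD_Ten FunA_Sym)
qed

definition ev :: "('u, 'u) mulfun" where
  "ev = left_strict_bilinear.bilinear H A B evO evA evD"

lemma multilinear_ev: "multilinear [H, A] B ev"
  unfolding ev_def by (rule left_strict_bilinear.multilinear_bilinear) (rule left_strict_bilinear_ev)

end

section \<open>Composition as a bilinear functor\<close>

locale perm_homs3 = AB: perm_homs elts A B + BC: perm_homs elts B C + AC: perm_homs elts A C
  for elts :: "'u \<Rightarrow> 'u set" and A B C :: "'u permcat"

sublocale perm_homs3 \<subseteq> permutative_triple A B C ..

context perm_homs3
begin

definition compO :: "'u \<Rightarrow> 'u \<Rightarrow> 'u" where
  "compO u v = AB.fun_code A (fun_comp C (AB.fun_of u) (AB.fun_of v))"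

definition compA :: "'u \<Rightarrow> 'u \<Rightarrow> 'u" where
  "compA n m = AB.nat_code A (compO (AB.nat_dom n) (AB.nat_dom m)) (compO (AB.nat_cod n) (AB.nat_cod m))
    (\<lambda>a. BC.evA n (AB.nat_of m a))"

definition compD :: "'u \<Rightarrow> 'u \<Rightarrow> 'u \<Rightarrow> 'u" where
  "compD u v v' = AB.nat_code A (AB.perm_sum A C (compO u v) (compO u v')) (compO u (AB.perm_sum A B v v'))
    (\<lambda>a. BC.evD u (AB.evO v a) (AB.evO v' a))"

lemma compO_simps [simp]:
  assumes [simp]: "u \<in> Ob BC.H" "v \<in> Ob AB.H"
  shows "compO u v \<in> Ob AC.H"
    "a \<in> Ob A \<Longrightarrow> FunO (AB.fun_of (compO u v)) a = FunO (AB.fun_of u) (FunO (AB.fun_of v) a)"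
    "\<phi> \<in> Ar A \<Longrightarrow> FunA (AB.fun_of (compO u v)) \<phi> = FunA (AB.fun_of u) (FunA (AB.fun_of v) \<phi>)"
    "a \<in> Ob A \<Longrightarrow> a' \<in> Ob A \<Longrightarrow> FunD (AB.fun_of (compO u v)) a a' =
      FunD (fun_comp C (AB.fun_of u) (AB.fun_of v)) a a'"
proof -
  show "compO u v \<in> Ob AC.H"
    unfolding compO_def by (intro AC.fun_code_Ob lax_functor_comp) simp_all
qed (simp_all add: compO_def, simp_all add: fun_comp_def)

text \<open>The codomain of \<open>AB.nat_of m a\<close> is the value of the target functor of
  \<open>m\<close>, so these components are those of the Godement product in
  \<open>monoidal_nat_hcomp\<close>.\<close>

lemma compA_simps [simp]:
  assumes [simp]: "n \<in> Ar BC.H" "m \<in> Ar AB.H"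
  shows "compA n m \<in> Ar AC.H"
    "AB.nat_dom (compA n m) = compO (AB.nat_dom n) (AB.nat_dom m)"
    "AB.nat_cod (compA n m) = compO (AB.nat_cod n) (AB.nat_cod m)"
    "a \<in> Ob A \<Longrightarrow> AB.nat_of (compA n m) a = BC.evA n (AB.nat_of m a)"
proof -
  have "monoidal_nat A C (AB.fun_of (compO (AB.nat_dom n) (AB.nat_dom m)))
      (AB.fun_of (compO (AB.nat_cod n) (AB.nat_cod m))) (\<lambda>a. BC.evA n (AB.nat_of m a))"
    by (rule AC.monoidal_nat_cong[OF monoidal_nat_hcomp[where f = "AB.fun_of (AB.nat_dom m)"
            and f' = "AB.fun_of (AB.nat_cod m)" and g = "AB.fun_of (AB.nat_dom n)" and g' = "AB.fun_of (AB.nat_cod n)"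
            and \<tau> = "AB.nat_of m" and \<sigma> = "AB.nat_of n"]])
      (simp_all, simp_all add: fun_comp_def BC.evA_def)
  then show "compA n m \<in> Ar AC.H"
    unfolding compA_def by (intro AC.nat_code_Ar) simp_all
qed (simp_all add: compA_def)

lemma compD_simps [simp]:
  assumes [simp]: "u \<in> Ob BC.H" "v \<in> Ob AB.H" "v' \<in> Ob AB.H"
  shows "compD u v v' \<in> Ar AC.H"
    "AB.nat_dom (compD u v v') = AB.perm_sum A C (compO u v) (compO u v')"
    "AB.nat_cod (compD u v v') = compO u (AB.perm_sum A B v v')"
    "a \<in> Ob A \<Longrightarrow> AB.nat_of (compD u v v') a = BC.evD u (AB.evO v a) (AB.evO v' a)"
proof -
  have "monoidal_nat A C (AB.fun_of (AB.perm_sum A C (compO u v) (compO u v')))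
      (AB.fun_of (compO u (AB.perm_sum A B v v'))) (\<lambda>a. BC.evD u (AB.evO v a) (AB.evO v' a))"
    by (rule AC.monoidal_nat_cong[OF monoidal_nat_FunD[where f = "AB.fun_of v" and f' = "AB.fun_of v'"
            and g = "AB.fun_of u"]])
      (simp_all add: fun_sum_simps AC.FunD_perm_sum AB.FunD_perm_sum BC.evD_def AB.evO_def,
       simp_all add: fun_comp_def fun_sum_simps AB.FunD_perm_sum)
  then show "compD u v v' \<in> Ar AC.H"
    unfolding compD_def by (intro AC.nat_code_Ar) simp_all
qed (simp_all add: compD_def)


lemma compO_Unit [simp]:
  "v \<in> Ob AB.H \<Longrightarrow> compO (Unit BC.H) v = Unit AC.H"
  "u \<in> Ob BC.H \<Longrightarrow> compO u (Unit AB.H) = Unit AC.H"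
  by (rule AC.Ob_eqI; simp; simp add: fun_comp_def)+

text \<open>Values add pointwise, so only the structure morphism needs an argument: on both sides
  the interchange acts first, and the factors after it fuse by the interchange law for
  tensors.\<close>

lemma compO_perm_sum [simp]:
  assumes [simp]: "u \<in> Ob BC.H" "u' \<in> Ob BC.H" "v \<in> Ob AB.H"
  shows "compO (AB.perm_sum B C u u') v = AB.perm_sum A C (compO u v) (compO u' v)"
proof (rule AC.Ob_eqI)
  fix a a'
  assume "a \<in> Ob A" "a' \<in> Ob A"
  then show "FunD (AB.fun_of (compO (AB.perm_sum B C u u') v)) a a'
    = FunD (AB.fun_of (AB.perm_sum A C (compO u v) (compO u' v))) a a'"
    by (simp add: AC.FunD_perm_sum fun_sum_simps)
      (simp add: BC.FunD_perm_sum fun_sum_simps fun_comp_def BC.B.TenA_fuse BC.B.Cmp_Cmp)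
qed simp_all

text \<open>Read off at an object of \<open>A\<close>, the conditions on arrows become laws of
  evaluation from \<open>B\<close> to \<open>C\<close>, taken at values of the inner functors and
  transformations.\<close>

lemma left_strict_bilinear_comp: "left_strict_bilinear BC.H AB.H AC.H compO compA compD"
proof -
  interpret BCH: permutative_category BC.H by (rule BC.permutative_category_perm_hom)
  interpret ABH: permutative_category AB.H by (rule AB.permutative_category_perm_hom)
  interpret ACH: permutative_category AC.H by (rule AC.permutative_category_perm_hom)
  interpret ev: left_strict_bilinear BC.H B C BC.evO BC.evA BC.evD by (rule BC.left_strict_bilinear_ev)
  show ?thesis
  proof unfold_locales
    fix n n' m m'
    assume [simp]: "n \<in> Ar BC.H" "n' \<in> Ar BC.H" "m \<in> Ar AB.H" "m' \<in> Ar AB.H"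
      and "Cod BC.H n = Dom BC.H n'" "Cod AB.H m = Dom AB.H m'"
    then have [simp]: "AB.nat_cod n = AB.nat_dom n'" "AB.nat_cod m = AB.nat_dom m'"
      by simp_all
    show "compA (n' \<cdot>\<^bsub>BC.H\<^esub> n) (m' \<cdot>\<^bsub>AB.H\<^esub> m) = compA n' m' \<cdot>\<^bsub>AC.H\<^esub> compA n m"
      by (rule AC.Ar_eqI) (simp_all add: ev.FA_Cmp)
  next
    fix u u' v v'
    assume [simp]: "u \<in> Ob BC.H" "u' \<in> Ob BC.H" "v \<in> Ob AB.H" "v' \<in> Ob AB.H"
    show "continuous_map (prod_topology (HomT BC.H u u') (HomT AB.H v v'))
        (HomT AC.H (compO u v) (compO u' v')) (\<lambda>(n, m). compA n m)"
    proof (rule AC.continuous_map_HomT_H)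
      fix a
      assume [simp]: "a \<in> Ob A"
      have "continuous_map (prod_topology (HomT BC.H u u') (HomT AB.H v v'))
          (prod_topology (HomT BC.H u u') (HomT B (FunO (AB.fun_of v) a) (FunO (AB.fun_of v') a)))
          (\<lambda>(n, m). (n, AB.nat_of m a))"
        by (simp add: continuous_map_prod_top AB.continuous_map_nat_of)
      from continuous_map_compose[OF this ev.FA_continuous]
      have "continuous_map (prod_topology (HomT BC.H u u') (HomT AB.H v v'))
          (HomT C (BC.evO u (FunO (AB.fun_of v) a)) (BC.evO u' (FunO (AB.fun_of v') a)))
          ((\<lambda>(n, m). BC.evA n m) \<circ> (\<lambda>(n, m). (n, AB.nat_of m a)))"
        by simp
      then show "continuous_map (prod_topology (HomT BC.H u u') (HomT AB.H v v'))
          (HomT C (FunO (AB.fun_of (compO u v)) a) (FunO (AB.fun_of (compO u' v')) a))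
          (\<lambda>x. AB.nat_of (case x of (n, m) \<Rightarrow> compA n m) a)"
        by (auto simp: BC.evO_def AB.topspace_HomT_H BC.topspace_HomT_H AB.mem_Hom_iff BC.mem_Hom_iff
            elim!: continuous_map_eq)
    qed (auto simp: AB.topspace_HomT_H BC.topspace_HomT_H AB.mem_Hom_iff BC.mem_Hom_iff AC.mem_Hom_iff)
  next
    fix n m m'
    assume [simp]: "n \<in> Ar BC.H" "m \<in> Ar AB.H" "m' \<in> Ar AB.H"
    show "compA n (m \<boxtimes>\<^bsub>AB.H\<^esub> m') \<cdot>\<^bsub>AC.H\<^esub> compD (Dom BC.H n) (Dom AB.H m) (Dom AB.H m')
        = compD (Cod BC.H n) (Cod AB.H m) (Cod AB.H m') \<cdot>\<^bsub>AC.H\<^esub> (compA n m \<boxtimes>\<^bsub>AC.H\<^esub> compA n m')"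
    proof (rule AC.Ar_eqI)
      fix a
      assume "a \<in> Ob A"
      then show "AB.nat_of (compA n (m \<boxtimes>\<^bsub>AB.H\<^esub> m') \<cdot>\<^bsub>AC.H\<^esub> compD (Dom BC.H n) (Dom AB.H m) (Dom AB.H m')) a
        = AB.nat_of (compD (Cod BC.H n) (Cod AB.H m) (Cod AB.H m') \<cdot>\<^bsub>AC.H\<^esub> (compA n m \<boxtimes>\<^bsub>AC.H\<^esub> compA n m')) a"
        using ev.D_nat[of n "AB.nat_of m a" "AB.nat_of m' a"] by (simp add: AB.evO_def)
    qed simp_all
  qed ((simp; fail) | (rule AC.Ar_eqI; simp add: BC.ev_defs AB.ev_defs BC.FunD_perm_sum fun_sum_simps
      midswap_def BC.B.TenA_TenA_Cmp BC.FunD_Ten BC.FunA_Sym; fail))+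
qed

end

section \<open>Change of enrichment\<close>

text \<open>Composites in the underlying multicategory contain the inverse of a coherence
  isomorphism, while the enriched axioms have the isomorphism itself on the other side. This passes
  from the first form to the second.\<close>

lemma (in category) cancel_inverse:
  assumes e: "is_iso C e" and f: "f \<in> Ar C" and h: "h \<in> Ar C" and "Cod C h = Dom C f \<and> Dom C h = Dom C e"
    and "f \<cdot> h \<cdot> inverse_of C e = g"
  shows "f \<cdot> h = g \<cdot> e"
  using assms inverse_of_simps[OF e] by (auto simp: Cmp_Cmp)

text \<open>Preservation of composites, for the groupings of the associativity and unit laws.
  Identity arguments go to identities of \<open>C\<close>, and the coherence maps come from
  \<open>MCmp_2_1\<close> and its companions.\<close>

lemma (in symmetric_monoidal)
  assumes K: "multifunctor M (underlying_multicat C) KO KM"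
    and MId: "\<And>X. X \<in> MOb M \<Longrightarrow> MId M X \<in> MHom M [X] X"
  shows KM_2_1: "{X, Y, Z, R, T} \<subseteq> MOb M \<Longrightarrow> f \<in> MHom M [X, Y] R \<Longrightarrow> g \<in> MHom M [R, Z] T \<Longrightarrow>
      KM [X, Y, Z] T (MCmp M [[X, Y], [Z]] [R, Z] T g [f, MId M Z])
        = KM [R, Z] T g \<cdot> (KM [X, Y] R f \<boxtimes> Id C (KO Z)) \<cdot> inverse_of C (Assoc C (KO X) (KO Y) (KO Z))"
    and KM_1_2: "{X, Y, Z, R, T} \<subseteq> MOb M \<Longrightarrow> f \<in> MHom M [Y, Z] R \<Longrightarrow> g \<in> MHom M [X, R] T \<Longrightarrow>
      KM [X, Y, Z] T (MCmp M [[X], [Y, Z]] [X, R] T g [MId M X, f])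
        = KM [X, R] T g \<cdot> (Id C (KO X) \<boxtimes> KM [Y, Z] R f)"
    and KM_0_1: "{X, R, T} \<subseteq> MOb M \<Longrightarrow> f \<in> MHom M [] R \<Longrightarrow> g \<in> MHom M [R, X] T \<Longrightarrow>
      KM [X] T (MCmp M [[], [X]] [R, X] T g [f, MId M X])
        = KM [R, X] T g \<cdot> (KM [] R f \<boxtimes> Id C (KO X)) \<cdot> inverse_of C (LUnit C (KO X))"
    and KM_1_0: "{X, R, T} \<subseteq> MOb M \<Longrightarrow> f \<in> MHom M [] R \<Longrightarrow> g \<in> MHom M [X, R] T \<Longrightarrow>
      KM [X] T (MCmp M [[X], []] [X, R] T g [MId M X, f])
        = KM [X, R] T g \<cdot> (Id C (KO X) \<boxtimes> KM [] R f) \<cdot> inverse_of C (RUnit C (KO X))"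
proof -
  interpret K: multifunctor M "underlying_multicat C" KO KM by fact
  have MObC: "MOb (underlying_multicat C) = Ob C" and MIdC: "MId (underlying_multicat C) = Id C"
    and MHomC: "\<And>xs y. MHom (underlying_multicat C) xs y = Hom C (ten_list C xs) y"
    by (simp_all add: underlying_multicat_def)
  have [simp]: "KO X \<in> Ob C" if "X \<in> MOb M" for X
    using K.KO_MOb[OF that] by (simp add: MObC)
  have [simp]: "KM [X] X (MId M X) = Id C (KO X)" if "X \<in> MOb M" for X
    using K.KM_MId[OF that] by (simp add: MIdC)
  note MHom = K.KM_MHom[unfolded MHomC]
  \<comment> \<open>In all four cases the outer morphism has two arguments, so preservation is first
    put into that form.\<close>
  have MCmp2: "KM (Xs @ Ys) T' (MCmp M [Xs, Ys] [X', Y'] T' g' [p, q])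
      = MCmp (underlying_multicat C) [map KO Xs, map KO Ys] [KO X', KO Y'] (KO T')
          (KM [X', Y'] T' g') [KM Xs X' p, KM Ys Y' q]"
    if "p \<in> MHom M Xs X'" "q \<in> MHom M Ys Y'" "g' \<in> MHom M [X', Y'] T'"
      "set Xs \<subseteq> MOb M" "set Ys \<subseteq> MOb M" "X' \<in> MOb M" "Y' \<in> MOb M" "T' \<in> MOb M"
    for Xs Ys X' Y' T' p q g'
  proof -
    have "KM (concat [Xs, Ys]) T' (MCmp M [Xs, Ys] [X', Y'] T' g' [p, q])
        = MCmp (underlying_multicat C) (map (map KO) [Xs, Ys]) (map KO [X', Y']) (KO T') (KM [X', Y'] T' g')
          (map (\<lambda>j. KM ([Xs, Ys] ! j) ([X', Y'] ! j) ([p, q] ! j)) [0..<length [X', Y']])"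
      by (rule K.KM_MCmp) (use that in \<open>auto simp: less_Suc_eq\<close>)
    then show ?thesis
      by simp
  qed
  show "KM [X, Y, Z] T (MCmp M [[X, Y], [Z]] [R, Z] T g [f, MId M Z])
      = KM [R, Z] T g \<cdot> (KM [X, Y] R f \<boxtimes> Id C (KO Z)) \<cdot> inverse_of C (Assoc C (KO X) (KO Y) (KO Z))"
    if "{X, Y, Z, R, T} \<subseteq> MOb M" "f \<in> MHom M [X, Y] R" "g \<in> MHom M [R, Z] T"
    using MCmp2[where Xs = "[X, Y]" and Ys = "[Z]" and X' = R and Y' = Z and p = "f" and q = "MId M Z" and g' = g and T' = T] that MHom[of "[X, Y]" R f] by (simp add: MId MCmp_2_1)
  show "KM [X, Y, Z] T (MCmp M [[X], [Y, Z]] [X, R] T g [MId M X, f])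
        = KM [X, R] T g \<cdot> (Id C (KO X) \<boxtimes> KM [Y, Z] R f)"
    if "{X, Y, Z, R, T} \<subseteq> MOb M" "f \<in> MHom M [Y, Z] R" "g \<in> MHom M [X, R] T"
    using MCmp2[where Xs = "[X]" and Ys = "[Y, Z]" and X' = X and Y' = R and p = "MId M X" and q = "f" and g' = g and T' = T] that MHom[of "[Y, Z]" R f] by (simp add: MId MCmp_1_2)
  show "KM [X] T (MCmp M [[], [X]] [R, X] T g [f, MId M X])
        = KM [R, X] T g \<cdot> (KM [] R f \<boxtimes> Id C (KO X)) \<cdot> inverse_of C (LUnit C (KO X))"
    if "{X, R, T} \<subseteq> MOb M" "f \<in> MHom M [] R" "g \<in> MHom M [R, X] T"
    using MCmp2[where Xs = "[]" and Ys = "[X]" and X' = R and Y' = X and p = "f" and q = "MId M X" and g' = g and T' = T] that MHom[of "[]" R f] by (simp add: MId MCmp_0_1)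
  show "KM [X] T (MCmp M [[X], []] [X, R] T g [MId M X, f])
        = KM [X, R] T g \<cdot> (Id C (KO X) \<boxtimes> KM [] R f) \<cdot> inverse_of C (RUnit C (KO X))"
    if "{X, R, T} \<subseteq> MOb M" "f \<in> MHom M [] R" "g \<in> MHom M [X, R] T"
    using MCmp2[where Xs = "[X]" and Ys = "[]" and X' = X and Y' = R and p = "MId M X" and q = "f" and g' = g and T' = T] that MHom[of "[]" R f] by (simp add: MId MCmp_1_0)
qed

text \<open>The laws of a category enriched in a multicategory, with identity 1-morphisms in the
  arguments left alone. The typing of these identities is included because the record
  \<open>multicat\<close> carries no axioms.\<close>

locale multicat_enriched =
  fixes M :: "('o, 'm) multicat" and E :: "('e, 'o, 'm) enr"
  assumes MId_MHom: "X \<in> MOb M \<Longrightarrow> MId M X \<in> MHom M [X] X"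
    and EHom_MOb: "x \<in> EOb E \<Longrightarrow> y \<in> EOb E \<Longrightarrow> EHom E x y \<in> MOb M"
    and EComp_MHom: "x \<in> EOb E \<Longrightarrow> y \<in> EOb E \<Longrightarrow> z \<in> EOb E \<Longrightarrow>
      EComp E x y z \<in> MHom M [EHom E y z, EHom E x y] (EHom E x z)"
    and EId_MHom: "x \<in> EOb E \<Longrightarrow> EId E x \<in> MHom M [] (EHom E x x)"
    and MCmp_EComp: "w \<in> EOb E \<Longrightarrow> x \<in> EOb E \<Longrightarrow> y \<in> EOb E \<Longrightarrow> z \<in> EOb E \<Longrightarrow>
      MCmp M [[EHom E y z, EHom E x y], [EHom E w x]] [EHom E x z, EHom E w x] (EHom E w z)
        (EComp E w x z) [EComp E x y z, MId M (EHom E w x)]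
      = MCmp M [[EHom E y z], [EHom E x y, EHom E w x]] [EHom E y z, EHom E w y] (EHom E w z)
        (EComp E w y z) [MId M (EHom E y z), EComp E w x y]"
    and MCmp_EId_left: "x \<in> EOb E \<Longrightarrow> y \<in> EOb E \<Longrightarrow>
      MCmp M [[], [EHom E x y]] [EHom E y y, EHom E x y] (EHom E x y)
        (EComp E x y y) [EId E y, MId M (EHom E x y)] = MId M (EHom E x y)"
    and MCmp_EId_right: "x \<in> EOb E \<Longrightarrow> y \<in> EOb E \<Longrightarrow>
      MCmp M [[EHom E x y], []] [EHom E x y, EHom E x x] (EHom E x y)
        (EComp E x x y) [MId M (EHom E x y), EId E x] = MId M (EHom E x y)"
begin

lemma change_enr_sel [simp]:
  "EOb (change_enr KO KM E) = EOb E" "EHom (change_enr KO KM E) x y = KO (EHom E x y)"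
  "EComp (change_enr KO KM E) x y z = KM [EHom E y z, EHom E x y] (EHom E x z) (EComp E x y z)"
  "EId (change_enr KO KM E) x = KM [] (EHom E x x) (EId E x)"
  by (simp_all add: change_enr_def)

text \<open>The image of each strict law has an inverse coherence map on one side, and
  \<open>cancel_inverse\<close> brings it to the form of the enriched axiom.\<close>

lemma enriched_category_change_enr:
  assumes "symmetric_monoidal C" and K: "multifunctor M (underlying_multicat C) KO KM"
  shows "enriched_category C (change_enr KO KM E)"
proof -
  interpret C: symmetric_monoidal C by fact
  interpret K: multifunctor M "underlying_multicat C" KO KM by (rule K)
  have MHomC: "\<And>xs y. MHom (underlying_multicat C) xs y = Hom C (ten_list C xs) y"
    by (simp add: underlying_multicat_def)
  have KO: "KO X \<in> Ob C" if "X \<in> MOb M" for X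
    using K.KO_MOb[OF that] by (simp add: underlying_multicat_def)
  have KId: "KM [X] X (MId M X) = Id C (KO X)" if "X \<in> MOb M" for X
    using K.KM_MId[OF that] by (simp add: underlying_multicat_def)
  note [simp] = EHom_MOb KO EComp_MHom EId_MHom KId
  define c where "c x y z = KM [EHom E y z, EHom E x y] (EHom E x z) (EComp E x y z)" for x y z
  define e where "e x = KM [] (EHom E x x) (EId E x)" for x
  have c: "c x y z \<in> Hom C (KO (EHom E y z) \<otimes>\<^bsub>C\<^esub> KO (EHom E x y)) (KO (EHom E x z))"
    if "x \<in> EOb E" "y \<in> EOb E" "z \<in> EOb E" for x y z
    using K.KM_MHom[OF _ _ EComp_MHom[OF that]] that by (simp add: MHomC c_def)
  have e: "e x \<in> Hom C (Unit C) (KO (EHom E x x))" if "x \<in> EOb E" for x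
    using K.KM_MHom[OF _ _ EId_MHom[OF that]] that by (simp add: MHomC e_def)
  have c' [simp]: "c x y z \<in> Ar C" "Dom C (c x y z) = KO (EHom E y z) \<otimes>\<^bsub>C\<^esub> KO (EHom E x y)"
    "Cod C (c x y z) = KO (EHom E x z)"
    if "x \<in> EOb E" "y \<in> EOb E" "z \<in> EOb E" for x y z
    using c[OF that] by (simp_all add: C.Hom_iff)
  have e' [simp]: "e x \<in> Ar C" "Dom C (e x) = Unit C" "Cod C (e x) = KO (EHom E x x)"
    if "x \<in> EOb E" for x
    using e[OF that] by (simp_all add: C.Hom_iff)
  show ?thesis
  proof (unfold_locales, simp_all add: c_def[symmetric] e_def[symmetric] c e)
    fix w x y z
    assume [simp]: "w \<in> EOb E" "x \<in> EOb E" "y \<in> EOb E" "z \<in> EOb E"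
    let ?a = "Assoc C (KO (EHom E y z)) (KO (EHom E x y)) (KO (EHom E w x))"
    have "c w x z \<cdot>\<^bsub>C\<^esub> (c x y z \<boxtimes>\<^bsub>C\<^esub> Id C (KO (EHom E w x))) \<cdot>\<^bsub>C\<^esub> inverse_of C ?a
        = c w y z \<cdot>\<^bsub>C\<^esub> (Id C (KO (EHom E y z)) \<boxtimes>\<^bsub>C\<^esub> c w x y)"
      using C.KM_2_1[OF K, of "EHom E y z" "EHom E x y" "EHom E w x" "EHom E x z" "EHom E w z"
          "EComp E x y z" "EComp E w x z"]
        C.KM_1_2[OF K, of "EHom E y z" "EHom E x y" "EHom E w x" "EHom E w y" "EHom E w z"
          "EComp E w x y" "EComp E w y z"] MCmp_EComp[of w x y z]
      by (simp add: MId_MHom c_def)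
    from C.cancel_inverse[OF _ _ _ _ this]
    show "c w x z \<cdot>\<^bsub>C\<^esub> (c x y z \<boxtimes>\<^bsub>C\<^esub> Id C (KO (EHom E w x)))
        = c w y z \<cdot>\<^bsub>C\<^esub> (Id C (KO (EHom E y z)) \<boxtimes>\<^bsub>C\<^esub> c w x y) \<cdot>\<^bsub>C\<^esub> ?a"
      by (simp add: C.Assoc_iso C.Cmp_Cmp)
  next
    fix x y
    assume [simp]: "x \<in> EOb E" "y \<in> EOb E"
    have "c x y y \<cdot>\<^bsub>C\<^esub> (e y \<boxtimes>\<^bsub>C\<^esub> Id C (KO (EHom E x y))) \<cdot>\<^bsub>C\<^esub> inverse_of C (LUnit C (KO (EHom E x y)))
        = Id C (KO (EHom E x y))"
      using C.KM_0_1[OF K, of "EHom E x y" "EHom E y y" "EHom E x y" "EId E y" "EComp E x y y"]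
        MCmp_EId_left[of x y]
      by (simp add: MId_MHom c_def e_def)
    from C.cancel_inverse[OF _ _ _ _ this]
    show "c x y y \<cdot>\<^bsub>C\<^esub> (e y \<boxtimes>\<^bsub>C\<^esub> Id C (KO (EHom E x y))) = LUnit C (KO (EHom E x y))"
      by (simp add: C.LUnit_iso)
    have "c x x y \<cdot>\<^bsub>C\<^esub> (Id C (KO (EHom E x y)) \<boxtimes>\<^bsub>C\<^esub> e x) \<cdot>\<^bsub>C\<^esub> inverse_of C (RUnit C (KO (EHom E x y)))
        = Id C (KO (EHom E x y))"
      using C.KM_1_0[OF K, of "EHom E x y" "EHom E x x" "EHom E x y" "EId E x" "EComp E x x y"]
        MCmp_EId_right[of x y]
      by (simp add: MId_MHom c_def e_def)
    from C.cancel_inverse[OF _ _ _ _ this]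
    show "c x x y \<cdot>\<^bsub>C\<^esub> (Id C (KO (EHom E x y)) \<boxtimes>\<^bsub>C\<^esub> e x) = RUnit C (KO (EHom E x y))"
      by (simp add: C.RUnit_iso)
  qed
qed

text \<open>An action of \<open>E\<close> on the objects \<open>ob x\<close> by 2-morphisms of
  \<open>M\<close> is carried to an action of the transferred category on \<open>KO (ob x)\<close>;
  \<open>enriched_functor_self_enrichedI\<close> then takes adjoints.\<close>

lemma enriched_functor_change_enr:
  assumes "closed_symmetric_monoidal C" and K: "multifunctor M (underlying_multicat C) KO KM"
    and ob: "\<And>x. x \<in> EOb E \<Longrightarrow> ob x \<in> MOb M"
    and act: "\<And>x y. x \<in> EOb E \<Longrightarrow> y \<in> EOb E \<Longrightarrow> act x y \<in> MHom M [EHom E x y, ob x] (ob y)"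
    and act_comp: "\<And>x y z. x \<in> EOb E \<Longrightarrow> y \<in> EOb E \<Longrightarrow> z \<in> EOb E \<Longrightarrow>
      MCmp M [[EHom E y z, EHom E x y], [ob x]] [EHom E x z, ob x] (ob z)
        (act x z) [EComp E x y z, MId M (ob x)]
      = MCmp M [[EHom E y z], [EHom E x y, ob x]] [EHom E y z, ob y] (ob z)
        (act y z) [MId M (EHom E y z), act x y]"
    and act_id: "\<And>x. x \<in> EOb E \<Longrightarrow>
      MCmp M [[], [ob x]] [EHom E x x, ob x] (ob x) (act x x) [EId E x, MId M (ob x)] = MId M (ob x)"
  shows "enriched_functor C (change_enr KO KM E) (self_enriched C) (\<lambda>x. KO (ob x))
    (\<lambda>x y. adjunct C (KO (EHom E x y)) (KO (ob x)) (KO (ob y)) (KM [EHom E x y, ob x] (ob y) (act x y)))"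
proof -
  interpret C: closed_symmetric_monoidal C by fact
  interpret K: multifunctor M "underlying_multicat C" KO KM by (rule K)
  interpret change: enriched_category C "change_enr KO KM E"
    by (rule enriched_category_change_enr) (rule C.symmetric_monoidal_axioms, rule K)
  have MHomC: "\<And>xs y. MHom (underlying_multicat C) xs y = Hom C (ten_list C xs) y"
    by (simp add: underlying_multicat_def)
  have KO: "KO X \<in> Ob C" if "X \<in> MOb M" for X
    using K.KO_MOb[OF that] by (simp add: underlying_multicat_def)
  have KId: "KM [X] X (MId M X) = Id C (KO X)" if "X \<in> MOb M" for X
    using K.KM_MId[OF that] by (simp add: underlying_multicat_def)
  note [simp] = EHom_MOb KO EComp_MHom EId_MHom KId ob act
  define c where "c = EComp (change_enr KO KM E)"
  define e where "e = EId (change_enr KO KM E)"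
  define k where "k x y = KM [EHom E x y, ob x] (ob y) (act x y)" for x y
  have k: "k x y \<in> Hom C (KO (EHom E x y) \<otimes>\<^bsub>C\<^esub> KO (ob x)) (KO (ob y))"
    if "x \<in> EOb E" "y \<in> EOb E" for x y
    using K.KM_MHom[OF _ _ act[OF that]] that by (simp add: MHomC k_def)
  then have k' [simp]: "k x y \<in> Ar C" "Dom C (k x y) = KO (EHom E x y) \<otimes>\<^bsub>C\<^esub> KO (ob x)"
    "Cod C (k x y) = KO (ob y)" if "x \<in> EOb E" "y \<in> EOb E" for x y
    using that by (simp_all add: C.Hom_iff)
  have c [simp]: "c x y z \<in> Ar C" "Dom C (c x y z) = KO (EHom E y z) \<otimes>\<^bsub>C\<^esub> KO (EHom E x y)"
    "Cod C (c x y z) = KO (EHom E x z)"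
    if "x \<in> EOb E" "y \<in> EOb E" "z \<in> EOb E" for x y z
    using change.EComp_Hom[of x y z] that by (simp_all add: C.Hom_iff c_def)
  have e [simp]: "e x \<in> Ar C" "Dom C (e x) = Unit C" "Cod C (e x) = KO (EHom E x x)"
    if "x \<in> EOb E" for x
    using change.EId_Hom[of x] that by (simp_all add: C.Hom_iff e_def)
  have "enriched_functor C (change_enr KO KM E) (self_enriched C) (\<lambda>x. KO (ob x))
    (\<lambda>x y. adjunct C (EHom (change_enr KO KM E) x y) (KO (ob x)) (KO (ob y)) (k x y))"
  proof (rule C.enriched_functor_self_enrichedI, unfold c_def[symmetric] e_def[symmetric])
    show "enriched_category C (change_enr KO KM E)" ..
    fix x y z
    assume "x \<in> EOb (change_enr KO KM E)" "y \<in> EOb (change_enr KO KM E)" "z \<in> EOb (change_enr KO KM E)"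
    then have [simp]: "x \<in> EOb E" "y \<in> EOb E" "z \<in> EOb E"
      by simp_all
    let ?a = "Assoc C (KO (EHom E y z)) (KO (EHom E x y)) (KO (ob x))"
    have "k x z \<cdot>\<^bsub>C\<^esub> (c x y z \<boxtimes>\<^bsub>C\<^esub> Id C (KO (ob x))) \<cdot>\<^bsub>C\<^esub> inverse_of C ?a
        = k y z \<cdot>\<^bsub>C\<^esub> (Id C (KO (EHom E y z)) \<boxtimes>\<^bsub>C\<^esub> k x y)"
      using C.KM_2_1[OF K, of "EHom E y z" "EHom E x y" "ob x" "EHom E x z" "ob z"
          "EComp E x y z" "act x z"]
        C.KM_1_2[OF K, of "EHom E y z" "EHom E x y" "ob x" "ob y" "ob z" "act x y" "act y z"]
        act_comp[of x y z]
      by (simp add: MId_MHom c_def k_def)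
    from C.cancel_inverse[OF _ _ _ _ this]
    show "k x z \<cdot>\<^bsub>C\<^esub> (c x y z \<boxtimes>\<^bsub>C\<^esub> Id C (KO (ob x)))
        = k y z \<cdot>\<^bsub>C\<^esub> (Id C (EHom (change_enr KO KM E) y z) \<boxtimes>\<^bsub>C\<^esub> k x y) \<cdot>\<^bsub>C\<^esub>
          Assoc C (EHom (change_enr KO KM E) y z) (EHom (change_enr KO KM E) x y) (KO (ob x))"
      by (simp add: C.Assoc_iso C.Cmp_Cmp)
  next
    fix x
    assume "x \<in> EOb (change_enr KO KM E)"
    then have [simp]: "x \<in> EOb E"
      by simp
    have "k x x \<cdot>\<^bsub>C\<^esub> (e x \<boxtimes>\<^bsub>C\<^esub> Id C (KO (ob x))) \<cdot>\<^bsub>C\<^esub> inverse_of C (LUnit C (KO (ob x)))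
        = Id C (KO (ob x))"
      using C.KM_0_1[OF K, of "ob x" "EHom E x x" "ob x" "EId E x" "act x x"] act_id[of x]
      by (simp add: MId_MHom k_def e_def)
    from C.cancel_inverse[OF _ _ _ _ this]
    show "k x x \<cdot>\<^bsub>C\<^esub> (e x \<boxtimes>\<^bsub>C\<^esub> Id C (KO (ob x))) = LUnit C (KO (ob x))"
      by (simp add: C.LUnit_iso)
  qed (simp_all add: k)
  then show ?thesis
    by (simp add: k_def)
qed

end

section \<open>The action of the enriched category Perm\<close>

context perm_homs3
begin

text \<open>\<open>BC.evA n (AB.nat_of m a)\<close> takes \<open>n\<close> at the codomain of its
  second argument, which is the object written out in \<open>perm_comp\<close>. The two formulas
  agree on \<open>Ob A\<close>, and codes see no more than that.\<close>

lemma perm_comp_eq: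
  "AB.perm_comp A B C = left_strict_bilinear.bilinear BC.H AB.H AC.H compO compA compD"
proof -
  interpret comp: left_strict_bilinear BC.H AB.H AC.H compO compA compD
    by (rule left_strict_bilinear_comp)
  show ?thesis
    unfolding comp.bilinear_def bilin_def
  proof (rule mulfun.equality)
    let ?c = "AB.perm_comp A B C"
    let ?PP = "prod_cat [BC.H, AB.H]"
    have O: "MulO ?c = restrict (\<lambda>us. compO (us ! 0) (us ! 1)) (Ob ?PP)"
      by (simp add: AB.perm_comp_def Let_def compO_def)
    \<comment> \<open>The two other fields are arbitrary, since the selector does not see
      them.\<close>
    then show "MulO ?c = MulO \<lparr>MulO = restrict (\<lambda>us. compO (us ! 0) (us ! 1)) (Ob ?PP), MulA = a, MulD = d\<rparr>" for a d
      by simp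
    show "MulA ?c = MulA \<lparr>MulO = a, MulA = restrict (\<lambda>ms. compA (ms ! 0) (ms ! 1)) (Ar ?PP), MulD = d\<rparr>" for a d
      by (auto simp: AB.perm_comp_def Let_def compO_def compA_def BC.evA_def prod_cat_Cons_iff
          intro!: restrict_ext AB.nat_code_cong)
    show "MulD ?c = MulD \<lparr>MulO = a, MulA = b, MulD = (\<lambda>i xs x'.
       if i = 0 \<and> xs \<in> Ob ?PP \<and> x' \<in> Ob BC.H
       then Id AC.H (compO (xs ! 0) (xs ! 1) \<otimes>\<^bsub>AC.H\<^esub> compO x' (xs ! 1))
       else if i = 1 \<and> xs \<in> Ob ?PP \<and> x' \<in> Ob AB.H then compD (xs ! 0) (xs ! 1) x'
       else undefined)\<rparr>" for a b
      by (auto simp: AB.perm_comp_def Let_def compO_def[symmetric] compD_def BC.evD_def AB.evO_def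
          prod_cat_Cons_iff fun_eq_iff)
  qed simp
qed

lemma multilinear_perm_comp: "multilinear [BC.H, AB.H] AC.H (AB.perm_comp A B C)"
  unfolding perm_comp_eq
  by (rule left_strict_bilinear.multilinear_bilinear) (rule left_strict_bilinear_comp)

text \<open>The four equations demanded by \<open>mul_comp_assoc\<close>. The last is the definition
  of the structure morphism of a composite functor.\<close>

lemma ev_comp:
  "u \<in> Ob BC.H \<Longrightarrow> v \<in> Ob AB.H \<Longrightarrow> a \<in> Ob A \<Longrightarrow> AC.evO (compO u v) a = BC.evO u (AB.evO v a)"
  "n \<in> Ar BC.H \<Longrightarrow> m \<in> Ar AB.H \<Longrightarrow> \<phi> \<in> Ar A \<Longrightarrow> AC.evA (compA n m) \<phi> = BC.evA n (AB.evA m \<phi>)"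
  "u \<in> Ob BC.H \<Longrightarrow> v \<in> Ob AB.H \<Longrightarrow> v' \<in> Ob AB.H \<Longrightarrow> a \<in> Ob A \<Longrightarrow>
    AC.evA (compD u v v') (Id A a) = BC.evD u (AB.evO v a) (AB.evO v' a)"
  "u \<in> Ob BC.H \<Longrightarrow> v \<in> Ob AB.H \<Longrightarrow> a \<in> Ob A \<Longrightarrow> a' \<in> Ob A \<Longrightarrow>
    AC.evD (compO u v) a a'
      = BC.evA (AB.perm_id B C u) (AB.evD v a a') \<cdot>\<^bsub>C\<^esub> BC.evD u (AB.evO v a) (AB.evO v a')"
  by (simp_all add: AC.ev_defs AB.ev_defs BC.ev_defs BC.B.Cmp_Cmp) (simp_all add: fun_comp_def)

text \<open>The associativity pattern with composition as the inner functor on the left and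
  evaluation in the three other places.\<close>

lemma mul_comp_ev:
  "mul_comp [[BC.H, AB.H], [A]] [AC.H, A] C AC.ev [AB.perm_comp A B C, mul_id A]
    = mul_comp [[BC.H], [AB.H, A]] [BC.H, B] C BC.ev [mul_id BC.H, AB.ev]"
  unfolding perm_comp_eq AB.ev_def BC.ev_def AC.ev_def
  by (rule mul_comp_assoc[OF left_strict_bilinear_comp AC.left_strict_bilinear_ev
        AB.left_strict_bilinear_ev BC.left_strict_bilinear_ev]) (simp_all add: ev_comp)

end

context universe
begin

lemma perm_homsI: "small_permcat A \<Longrightarrow> small_permcat B \<Longrightarrow> perm_homs elts A B"
  by (simp add: small_permcat_def perm_homs_def perm_homs_axioms_def permutative_pair_def universe_axioms)

lemma perm_homs3I: "small_permcat A \<Longrightarrow> small_permcat B \<Longrightarrow> small_permcat C \<Longrightarrow> perm_homs3 elts A B C"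
  by (simp add: perm_homs3_def perm_homsI)

lemma small_permcat_perm_hom: "small_permcat A \<Longrightarrow> small_permcat B \<Longrightarrow> small_permcat (perm_hom A B)"
  using perm_homs.permutative_category_perm_hom[OF perm_homsI] perm_homs.small_perm_hom[OF perm_homsI]
  by (simp add: small_permcat_def)

text \<open>At each object of \<open>A\<close> the equations for arrows and constraints are
  \<open>BCD.ev_comp\<close>, taken at the values and components supplied by the innermost
  argument.\<close>

lemma mul_comp_perm_comp:
  assumes "small_permcat A" "small_permcat B" "small_permcat C" "small_permcat D"
  shows "mul_comp [[perm_hom C D, perm_hom B C], [perm_hom A B]] [perm_hom B D, perm_hom A B] (perm_hom A D)
      (perm_comp A B D) [perm_comp B C D, mul_id (perm_hom A B)]
    = mul_comp [[perm_hom C D], [perm_hom B C, perm_hom A B]] [perm_hom C D, perm_hom A C] (perm_hom A D)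
      (perm_comp A C D) [mul_id (perm_hom C D), perm_comp A B C]"
proof -
  interpret ABC: perm_homs3 elts A B C using assms by (intro perm_homs3I)
  interpret ABD: perm_homs3 elts A B D using assms by (intro perm_homs3I)
  interpret ACD: perm_homs3 elts A C D using assms by (intro perm_homs3I)
  interpret BCD: perm_homs3 elts B C D using assms by (intro perm_homs3I)
  let ?AB = "perm_hom A B" and ?BC = "perm_hom B C" and ?CD = "perm_hom C D"
  \<comment> \<open>Needed before the arrows: equality of coded transformations includes equality of
    their domains and codomains.\<close>
  have O: "ABD.compO (BCD.compO u v) w = ACD.compO u (ABC.compO v w)"
    if [simp]: "u \<in> Ob ?CD" "v \<in> Ob ?BC" "w \<in> Ob ?AB" for u v w
    by (rule ABD.AC.Ob_eqI; simp; simp add: fun_comp_def ABD.BC.B.Cmp_Cmp)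
  have "ABD.compA (BCD.compA n m) l = ACD.compA n (ABC.compA m l)"
    if [simp]: "n \<in> Ar ?CD" "m \<in> Ar ?BC" "l \<in> Ar ?AB" for n m l
    by (rule ABD.AC.Ar_eqI) (simp_all add: O BCD.ev_comp)
  moreover have "ABD.compA (BCD.compD u v v') (perm_id A B w) = ACD.compD u (ABC.compO v w) (ABC.compO v' w)"
    if [simp]: "u \<in> Ob ?CD" "v \<in> Ob ?BC" "v' \<in> Ob ?BC" "w \<in> Ob ?AB" for u v v' w
    by (rule ABD.AC.Ar_eqI) (simp_all add: O BCD.ev_comp ABC.AB.evO_def ABC.BC.evO_def)
  moreover have "ABD.compD (BCD.compO u v) w w' = Cmp (perm_hom A D)
      (ACD.compA (perm_id C D u) (ABC.compD v w w')) (ACD.compD u (ABC.compO v w) (ABC.compO v w'))"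
    if [simp]: "u \<in> Ob ?CD" "v \<in> Ob ?BC" "w \<in> Ob ?AB" "w' \<in> Ob ?AB" for u v w w'
    by (rule ABD.AC.Ar_eqI) (simp_all add: O BCD.ev_comp ABC.AB.evO_def ABC.BC.evO_def)
  moreover note O
  ultimately show ?thesis
    unfolding ABC.perm_comp_eq ABD.perm_comp_eq ACD.perm_comp_eq BCD.perm_comp_eq
    by (intro mul_comp_assoc[OF BCD.left_strict_bilinear_comp ABD.left_strict_bilinear_comp
        ABC.left_strict_bilinear_comp ACD.left_strict_bilinear_comp]) simp_all
qed

definition id_code :: "'u permcat \<Rightarrow> 'u" where
  "id_code A = fun_code A (fun_id A)"

lemma id_code_simps:
  assumes "small_permcat A"
  shows "id_code A \<in> Ob (perm_hom A A)"
    "a \<in> Ob A \<Longrightarrow> FunO (fun_of (id_code A)) a = a"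
    "\<phi> \<in> Ar A \<Longrightarrow> FunA (fun_of (id_code A)) \<phi> = \<phi>"
    "a \<in> Ob A \<Longrightarrow> a' \<in> Ob A \<Longrightarrow> FunD (fun_of (id_code A)) a a' = Id A (a \<otimes>\<^bsub>A\<^esub> a')"
proof -
  interpret perm_homs elts A A using assms by (intro perm_homsI)
  show "id_code A \<in> Ob (perm_hom A A)"
    unfolding id_code_def by (intro fun_code_Ob A.lax_functor_id)
qed (use assms in \<open>simp_all add: id_code_def small_permcat_def, simp_all add: fun_id_def\<close>)

lemma mul_comp_ev_id:
  assumes "small_permcat A"
  shows "mul_comp [[], [A]] [perm_hom A A, A] A (perm_homs.ev elts A A) [mul_ob (perm_hom A A) (id_code A), mul_id A]
    = mul_id A"
proof -
  interpret perm_homs elts A A using assms by (intro perm_homsI)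
  note [simp] = id_code_simps[OF assms]
  show ?thesis
    unfolding ev_def by (rule mul_comp_mul_ob_left[OF left_strict_bilinear_ev]) (simp_all add: ev_defs)
qed

text \<open>On the left, the structure morphism of the identity functor supplies an identity
  constraint; on the right, the strict first variable of composition remains.\<close>

lemma mul_comp_perm_comp_id:
  assumes A: "small_permcat A" and B: "small_permcat B"
  shows "mul_comp [[], [perm_hom A B]] [perm_hom B B, perm_hom A B] (perm_hom A B)
      (perm_comp A B B) [mul_ob (perm_hom B B) (id_code B), mul_id (perm_hom A B)] = mul_id (perm_hom A B)"
    and "mul_comp [[perm_hom A B], []] [perm_hom A B, perm_hom A A] (perm_hom A B)
      (perm_comp A A B) [mul_id (perm_hom A B), mul_ob (perm_hom A A) (id_code A)] = mul_id (perm_hom A B)"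
proof -
  interpret ABB: perm_homs3 elts A B B using A B by (intro perm_homs3I)
  interpret AAB: perm_homs3 elts A A B using A B by (intro perm_homs3I)
  note [simp] = id_code_simps[OF A] id_code_simps[OF B]
  have l [simp]: "ABB.compO (id_code B) v = v" if [simp]: "v \<in> Ob (perm_hom A B)" for v
    by (rule ABB.AB.Ob_eqI; simp; simp add: fun_comp_def)
  have r [simp]: "AAB.compO v (id_code A) = v" if [simp]: "v \<in> Ob (perm_hom A B)" for v
    by (rule ABB.AB.Ob_eqI; simp; simp add: fun_comp_def)
  show "mul_comp [[], [perm_hom A B]] [perm_hom B B, perm_hom A B] (perm_hom A B)
      (perm_comp A B B) [mul_ob (perm_hom B B) (id_code B), mul_id (perm_hom A B)] = mul_id (perm_hom A B)"
    unfolding ABB.perm_comp_eq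
  proof (rule mul_comp_mul_ob_left[OF ABB.left_strict_bilinear_comp])
    show "ABB.compA (Id (perm_hom B B) (id_code B)) m = m" if "m \<in> Ar (perm_hom A B)" for m
      by (rule ABB.AB.Ar_eqI) (use that in \<open>simp_all add: ABB.BC.evA_def\<close>)
    show "ABB.compD (id_code B) v v' = Id (perm_hom A B) (v \<otimes>\<^bsub>perm_hom A B\<^esub> v')"
      if "v \<in> Ob (perm_hom A B)" "v' \<in> Ob (perm_hom A B)" for v v'
      by (rule ABB.AB.Ar_eqI) (use that in \<open>simp_all add: ABB.BC.evD_def ABB.AB.evO_def\<close>)
  qed simp_all
  show "mul_comp [[perm_hom A B], []] [perm_hom A B, perm_hom A A] (perm_hom A B)
      (perm_comp A A B) [mul_id (perm_hom A B), mul_ob (perm_hom A A) (id_code A)] = mul_id (perm_hom A B)"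
    unfolding AAB.perm_comp_eq
  proof (rule mul_comp_mul_ob_right[OF AAB.left_strict_bilinear_comp])
    show "AAB.compA m (Id (perm_hom A A) (id_code A)) = m" if "m \<in> Ar (perm_hom A B)" for m
      by (rule ABB.AB.Ar_eqI) (use that in \<open>simp_all add: ABB.AB.evA_def\<close>)
  qed simp_all
qed

lemma perm_multicat_sel [simp]:
  "MOb perm_multicat = Collect small_permcat" "MHom perm_multicat As B = Collect (multilinear As B)"
  "MId perm_multicat = mul_id" "MCmp perm_multicat = mul_comp"
  by (simp_all add: perm_multicat_def)

lemma perm_enr_sel [simp]:
  "EOb perm_enr = Collect small_permcat" "EHom perm_enr = perm_hom" "EComp perm_enr = perm_comp"
  "EId perm_enr A = mul_ob (perm_hom A A) (id_code A)"
  by (simp_all add: perm_enr_def id_code_def)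

lemma multicat_enriched_perm_enr: "multicat_enriched perm_multicat perm_enr"
proof (unfold_locales, simp_all add: small_permcat_perm_hom mul_comp_perm_comp mul_comp_perm_comp_id)
  show "multilinear [X] X (mul_id X)" if "small_permcat X" for X
    using that by (intro multilinear_mul_id) (simp add: small_permcat_def)
  show "multilinear [perm_hom B C, perm_hom A B] (perm_hom A C) (perm_comp A B C)"
    if "small_permcat A" "small_permcat B" "small_permcat C" for A B C
    using perm_homs3.multilinear_perm_comp[OF perm_homs3I[OF that]] .
  show "multilinear [] (perm_hom A A) (mul_ob (perm_hom A A) (id_code A))" if "small_permcat A" for A
    using small_permcat_perm_hom[OF that that] id_code_simps(1)[OF that]
    by (intro multilinear_mul_ob) (simp_all add: small_permcat_def)
qed

end

theorem theorem1p4: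
  fixes elts :: "'u \<Rightarrow> 'u set"
    and Spec :: "('s, 't) clmoncat"
    and KO :: "'u permcat \<Rightarrow> 's"
    and KM :: "'u permcat list \<Rightarrow> 'u permcat \<Rightarrow> ('u, 'u) mulfun \<Rightarrow> 't"
  assumes "universe elts"
    and "closed_symmetric_monoidal Spec"
    and "multifunctor (universe.perm_multicat elts) (underlying_multicat Spec) KO KM"
  shows "\<exists>\<Phi>O \<Phi>M.
    enriched_functor Spec (change_enr KO KM (universe.perm_enr elts)) (self_enriched Spec) \<Phi>O \<Phi>M \<and>
    (\<forall>A. universe.small_permcat elts A \<longrightarrow> \<Phi>O A = KO A)"
proof -
  interpret universe elts by fact
  interpret perm: multicat_enriched perm_multicat perm_enr by (rule multicat_enriched_perm_enr)
  \<comment> \<open>The family \<open>ob\<close> is the identity here: a small permutative category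
    is at once an object of \<open>perm_enr\<close> and the object of the multicategory on which
    evaluation acts.\<close>
  have "enriched_functor Spec (change_enr KO KM perm_enr) (self_enriched Spec) (\<lambda>A. KO A)
      (\<lambda>A B. adjunct Spec (KO (EHom perm_enr A B)) (KO A) (KO B)
        (KM [EHom perm_enr A B, A] B (perm_homs.ev elts A B)))"
  proof (rule perm.enriched_functor_change_enr[OF assms(2,3)])
    fix A B
    assume "A \<in> EOb perm_enr" "B \<in> EOb perm_enr"
    then show "perm_homs.ev elts A B \<in> MHom perm_multicat [EHom perm_enr A B, A] B"
      by (simp add: perm_homs.multilinear_ev perm_homsI)
    fix C
    assume "A \<in> EOb perm_enr" "B \<in> EOb perm_enr" "C \<in> EOb perm_enr"
    then show "MCmp perm_multicat [[EHom perm_enr B C, EHom perm_enr A B], [A]] [EHom perm_enr A C, A] C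
        (perm_homs.ev elts A C) [EComp perm_enr A B C, MId perm_multicat A]
      = MCmp perm_multicat [[EHom perm_enr B C], [EHom perm_enr A B, A]] [EHom perm_enr B C, B] C
        (perm_homs.ev elts B C) [MId perm_multicat (EHom perm_enr B C), perm_homs.ev elts A B]"
      using perm_homs3.mul_comp_ev[of elts A B C] by (simp add: perm_homs3I)
  qed (simp_all add: mul_comp_ev_id)
  then show ?thesis
    by blast
qed

end
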